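(* Let $X$ be a totally bounded metric space, $k\ge 0$ an integer and $\mathbb{F}$ a field. Then there is a (unique) persistence barcode associated to the Vietoris-Rips persistent homology $\mathrm{PH}_k(\mathrm{VR}_*(X);\mathbb{F})$; that is, there is a multiset of intervals $(I_\lambda)_{\lambda\in\Lambda}$, unique up to reordering, such that $\mathrm{PH}_k(\mathrm{VR}_*(X);\mathbb{F})\cong\bigoplus_{\lambda\in\Lambda}\mathbb{F}_*[I_\lambda]$ as persistence modules.
   Context: For a metric space $X$ and $r>0$, $\mathrm{VR}_r(X)$ is the simplicial complex whose vertices are the points of $X$ and whose simplices are the nonempty finite subsets of $X$ of diameter strictly less than $r$. A persistence module over $T\subseteq\mathbb{R}$ is a functor from the poset $(T,\le)$ to the category of $\mathbb{F}$-vector spaces. $\mathrm{PH}_k(\mathrm{VR}_*(X);\mathbb{F})$ is the persistence module over $T=(0,\infty)$ with vector spaces $\mathrm{H}_k(\mathrm{VR}_r(X);\mathbb{F})$ and linear maps induced by the inclusions $\mathrm{VR}_r(X)\subseteq\mathrm{VR}_s(X)$ for $r\le s$. An interval in $T$ is a nonempty subset $I\subseteq T$ such that $r\le s\le t$, $s\in T$ and $r,t\in I$ imply $s\in I$. For an interval $I$, the persistence module $\mathbb{F}_*[I]$ has vector space $\mathbb{F}$ at each $r\in I$ and $0$ otherwise, and the structure map for $r\le s$ is the identity if $r,s\in I$ and zero otherwise. *)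

theory Defs
  imports
    "HOL-Analysis.Abstract_Metric_Spaces"
    "HOL-Algebra.Algebraic_Closure_Type"
    "HOL-Combinatorics.Permutations"
begin

section \<open>Vector spaces\<close>

text \<open>
  The ground field is a type \<open>'f\<close> of class \<open>field\<close>; a vector space over it is a module, in the
  sense of HOL-Algebra, over the ring record of that type. The components \<open>mult\<close> and \<open>one\<close> that a
  module record inherits from the ring record play no role and are left unspecified.
\<close>

definition vect_space :: "('f::field, 'v) module \<Rightarrow> bool" where
  "vect_space V \<longleftrightarrow> Module.module (ring_of_type_algebra :: 'f ring) V"

definition linear_maps :: "('f, 'v) module \<Rightarrow> ('f, 'w) module \<Rightarrow> ('v \<Rightarrow> 'w) set" where
  "linear_maps V W =
     {h \<in> carrier V \<rightarrow> carrier W.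
        (\<forall>x\<in>carrier V. \<forall>y\<in>carrier V. h (x \<oplus>\<^bsub>V\<^esub> y) = h x \<oplus>\<^bsub>W\<^esub> h y) \<and>
        (\<forall>a. \<forall>x\<in>carrier V. h (a \<odot>\<^bsub>V\<^esub> x) = a \<odot>\<^bsub>W\<^esub> h x)}"

definition quotient_module :: "('f, 'v) module \<Rightarrow> 'v set \<Rightarrow> ('f, 'v set) module" where
  "quotient_module V N =
     \<lparr>carrier = a_rcosets\<^bsub>V\<^esub> N, monoid.mult = undefined, one = undefined,
      ring.zero = N, add = set_add V,
      module.smult = (\<lambda>a A. \<Union>x\<in>A. N +>\<^bsub>V\<^esub> (a \<odot>\<^bsub>V\<^esub> x))\<rparr>"

definition direct_sum :: "'i set \<Rightarrow> ('i \<Rightarrow> ('f, 'v) module) \<Rightarrow> ('f, 'i \<Rightarrow> 'v) module" where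
  "direct_sum L V =
     \<lparr>carrier = {x \<in> (\<Pi>\<^sub>E i\<in>L. carrier (V i)). finite {i \<in> L. x i \<noteq> \<zero>\<^bsub>V i\<^esub>}},
      monoid.mult = undefined, one = undefined,
      ring.zero = (\<lambda>i\<in>L. \<zero>\<^bsub>V i\<^esub>), add = (\<lambda>x y. \<lambda>i\<in>L. x i \<oplus>\<^bsub>V i\<^esub> y i),
      module.smult = (\<lambda>a x. \<lambda>i\<in>L. a \<odot>\<^bsub>V i\<^esub> x i)\<rparr>"


section \<open>Persistence modules\<close>

record ('f, 'v) pmodule =
  pspace :: "real \<Rightarrow> ('f, 'v) module"
  pmap :: "real \<Rightarrow> real \<Rightarrow> 'v \<Rightarrow> 'v"

definition persistence_module :: "real set \<Rightarrow> ('f::field, 'v) pmodule \<Rightarrow> bool" where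
  "persistence_module T P \<longleftrightarrow>
     (\<forall>t\<in>T. vect_space (pspace P t)) \<and>
     (\<forall>s\<in>T. \<forall>t\<in>T. s \<le> t \<longrightarrow> pmap P s t \<in> linear_maps (pspace P s) (pspace P t)) \<and>
     (\<forall>t\<in>T. \<forall>x\<in>carrier (pspace P t). pmap P t t x = x) \<and>
     (\<forall>r\<in>T. \<forall>s\<in>T. \<forall>t\<in>T. r \<le> s \<longrightarrow> s \<le> t \<longrightarrow>
        (\<forall>x\<in>carrier (pspace P r). pmap P s t (pmap P r s x) = pmap P r t x))"

definition pmodule_iso ::
    "real set \<Rightarrow> ('f::field, 'v) pmodule \<Rightarrow> ('f, 'w) pmodule \<Rightarrow> bool" where
  "pmodule_iso T P Q \<longleftrightarrow>
     persistence_module T P \<and> persistence_module T Q \<and>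
     (\<exists>\<phi>. (\<forall>t\<in>T. \<phi> t \<in> linear_maps (pspace P t) (pspace Q t) \<and>
                   bij_betw (\<phi> t) (carrier (pspace P t)) (carrier (pspace Q t))) \<and>
          (\<forall>s\<in>T. \<forall>t\<in>T. s \<le> t \<longrightarrow>
             (\<forall>x\<in>carrier (pspace P s). \<phi> t (pmap P s t x) = pmap Q s t (\<phi> s x))))"

definition pmodule_sum :: "'i set \<Rightarrow> ('i \<Rightarrow> ('f, 'v) pmodule) \<Rightarrow> ('f, 'i \<Rightarrow> 'v) pmodule" where
  "pmodule_sum L P =
     \<lparr>pspace = (\<lambda>t. direct_sum L (\<lambda>i. pspace (P i) t)),
      pmap = (\<lambda>s t x. \<lambda>i\<in>L. pmap (P i) s t (x i))\<rparr>"

definition is_interval_in :: "real set \<Rightarrow> real set \<Rightarrow> bool" where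
  "is_interval_in T J \<longleftrightarrow> J \<noteq> {} \<and> J \<subseteq> T \<and>
     (\<forall>r\<in>J. \<forall>t\<in>J. \<forall>s\<in>T. r \<le> s \<longrightarrow> s \<le> t \<longrightarrow> s \<in> J)"

definition interval_module :: "real set \<Rightarrow> ('f::field, 'f) pmodule" where
  "interval_module J =
     \<lparr>pspace = (\<lambda>t. \<lparr>carrier = (if t \<in> J then UNIV else {0}), monoid.mult = (*), one = 1,
                      ring.zero = 0, add = (+), module.smult = (*)\<rparr>),
      pmap = (\<lambda>s t x. if s \<in> J \<and> t \<in> J then x else 0)\<rparr>"

text \<open>A multiset of intervals, possibly infinite, is a family \<open>J\<close> indexed by a set \<open>L\<close>.\<close>

definition persistence_barcode ::
    "real set \<Rightarrow> ('f::field, 'v) pmodule \<Rightarrow> 'i set \<Rightarrow> ('i \<Rightarrow> real set) \<Rightarrow> bool" where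
  "persistence_barcode T P L J \<longleftrightarrow>
     (\<forall>i\<in>L. is_interval_in T (J i)) \<and>
     pmodule_iso T P (pmodule_sum L (\<lambda>i. interval_module (J i)))"


section \<open>Simplicial homology\<close>

text \<open>
  A complex is given by its set \<open>K\<close> of simplices (nonempty finite sets, closed under nonempty
  subsets). Oriented chains are encoded without choosing an ordering of the vertices: a \<open>k\<close>-chain
  is a finitely supported alternating function on the lists of \<open>k + 1\<close> distinct vertices of a
  simplex, where the oriented simplex \<open>[v\<^sub>0, \<dots>, v\<^sub>k]\<close> is the function with value
  \<open>sign \<pi>\<close> at the list of the \<open>v\<close> permuted by \<open>\<pi>\<close> and value \<open>0\<close> elsewhere. Since only
  lists of distinct vertices are used, choosing one ordering of each \<open>k\<close>-simplex gives a basis in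
  every characteristic.
\<close>

definition chains :: "'a set set \<Rightarrow> nat \<Rightarrow> ('a list \<Rightarrow> 'f::field) set" where
  "chains K k = {c. finite {xs. c xs \<noteq> 0} \<and>
     (\<forall>xs. c xs \<noteq> 0 \<longrightarrow> length xs = Suc k \<and> distinct xs \<and> set xs \<in> K) \<and>
     (\<forall>xs \<pi>. \<pi> permutes {..<length xs} \<longrightarrow> c (permute_list \<pi> xs) = of_int (sign \<pi>) * c xs)}"

definition chain_module :: "('a list \<Rightarrow> 'f::field) set \<Rightarrow> ('f, 'a list \<Rightarrow> 'f) module" where
  "chain_module C =
     \<lparr>carrier = C, monoid.mult = undefined, one = undefined, ring.zero = (\<lambda>xs. 0),
      add = (\<lambda>b c xs. b xs + c xs), module.smult = (\<lambda>a c xs. a * c xs)\<rparr>"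

text \<open>
  This is the usual boundary \<open>[v\<^sub>0, \<dots>, v\<^sub>k] \<mapsto> \<Sum>i. (-1)^i [v\<^sub>0, \<dots>, v\<^sub>k without v\<^sub>i]\<close>: the value of
  \<open>[v\<^sub>0, \<dots>, v\<^sub>k]\<close> at \<open>v\<^sub>i\<close> followed by the other vertices in order is \<open>(-1)^i\<close>. The value at the
  empty list is \<open>0\<close> because the homology is unreduced.
\<close>

definition boundary :: "('a list \<Rightarrow> 'f::field) \<Rightarrow> 'a list \<Rightarrow> 'f" where
  "boundary c ys = (if ys = [] then 0 else \<Sum>v | c (v # ys) \<noteq> 0. c (v # ys))"

definition cycles :: "'a set set \<Rightarrow> nat \<Rightarrow> ('a list \<Rightarrow> 'f::field) set" where
  "cycles K k = {c \<in> chains K k. boundary c = (\<lambda>ys. 0)}"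

definition boundaries :: "'a set set \<Rightarrow> nat \<Rightarrow> ('a list \<Rightarrow> 'f::field) set" where
  "boundaries K k = boundary ` chains K (Suc k)"

definition homology :: "'a set set \<Rightarrow> nat \<Rightarrow> ('f::field, ('a list \<Rightarrow> 'f) set) module" where
  "homology K k = quotient_module (chain_module (cycles K k)) (boundaries K k)"

text \<open>The map induced by an inclusion \<open>K \<subseteq> K'\<close> sends the class of a cycle in \<open>K\<close> to its class in \<open>K'\<close>.\<close>

definition homology_incl ::
    "'a set set \<Rightarrow> nat \<Rightarrow> ('a list \<Rightarrow> 'f::field) set \<Rightarrow> ('a list \<Rightarrow> 'f) set" where
  "homology_incl K' k A =
     (\<Union>c\<in>A. boundaries K' k +>\<^bsub>chain_module (cycles K' k)\<^esub> c)"


section \<open>Vietoris-Rips complexes\<close>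

context Metric_space
begin

definition mdiameter :: "'a set \<Rightarrow> real" where
  "mdiameter S = (if S = {} then 0 else SUP (x, y)\<in>S \<times> S. d x y)"

definition VR :: "real \<Rightarrow> 'a set set" where
  "VR r = {S. S \<noteq> {} \<and> finite S \<and> S \<subseteq> M \<and> mdiameter S < r}"

definition VR_PH :: "nat \<Rightarrow> ('f::field, ('a list \<Rightarrow> 'f) set) pmodule" where
  "VR_PH k = \<lparr>pspace = (\<lambda>r. homology (VR r) k), pmap = (\<lambda>r s. homology_incl (VR s) k)\<rparr>"

end

text \<open>
  The existence of a barcode has to fix a type of indices. For a persistence module with vectors of
  type \<open>'v\<close> the type \<open>real \<times> 'v\<close> is no restriction on the index set: given a barcode indexed
  by any set, choosing \<open>r\<close> in the interval of \<open>i\<close> and pairing it with the vector at \<open>r\<close> that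
  corresponds to the generator of the summand \<open>i\<close> is an injection of the index set into this type.
\<close>

type_synonym ('a, 'f) bar_index = "real \<times> ('a list \<Rightarrow> 'f) set"

end

(* Since simplices have diameter strictly less than r, the cycles Z r and boundaries B r of VR_r are
   left continuous in r. Total boundedness makes the maps Z r / B r -> Z s / B s, r < s, of finite
   rank: a cycle of VR_r can be pushed, one vertex at a time, to a finite net without leaving VR_s.

   For a >= 0 consider the inverse limit of Z s / B s for s decreasing to a, filtered by the death
   time of its elements. A basis of each graded piece, taken modulo the elements that come from time
   a, gives the bars born at a. They are independent by looking at the latest birth, then the latest
   death; they span because chains of images and kernels stabilise by finite rank. So all bars are of
   the form (a, b], and the number of bars containing r < s is the rank of Z r / B r -> Z s / B s,
   which determines the multiplicities by inclusion-exclusion. *)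

theory Submission
  imports Defs "HOL-Library.Function_Algebras" "HOL-Library.Extended_Real"
begin

text \<open>For a fixed scale the homology of an infinite \<open>VR r\<close> may be infinite
  dimensional, so decomposition theorems for pointwise finite dimensional modules do not apply.
  Finite rank between distinct times is not enough either: the product of the interval modules of
  [0, 1/n] has it without being a sum of intervals. What saves the case at hand is left continuity.
  It makes the infimum of the times at which something new appears, or disappears, a genuine birth
  or death, because nothing new happens at the infimum itself. A bar born at a is therefore absent
  at a, and there is no vector at time a to serve as its generator; the inverse limit over s > a
  stands in for it and lets a generator be chosen for all times at once. The linear algebra forms no
  quotients: vectors are representatives and equations hold modulo \<open>B t\<close>. On the
  topological side, moving all vertices to the net at once would collapse simplices and call for a
  chain homotopy; moving a single vertex changes a cycle by the boundary of one explicit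
  chain.\<close>

section \<open>Linear algebra relative to a subspace\<close>

context vector_space
begin

text \<open>Stands in for the quotient map by \<open>N\<close>: the image of a subspace under
  \<open>p\<close> is a copy of its quotient, inside the same type. Here \<open>p\<close> kills a
  basis of \<open>N\<close> and fixes the vectors that extend it to a basis of the whole
  space.\<close>

lemma exists_linear_with_kernel:
  assumes N: "subspace N"
  shows "\<exists>p. Vector_Spaces.linear scale scale p \<and> (\<forall>x. p x = 0 \<longleftrightarrow> x \<in> N)"
proof -
  interpret vp: vector_space_pair scale scale by unfold_locales
  obtain b where b: "b \<subseteq> N" "independent b" "N \<subseteq> span b"
    by (rule maximal_independent_subset)
  obtain e where e: "b \<subseteq> e" "independent e" "UNIV \<subseteq> span e"
    by (rule maximal_independent_subset_extend[of b UNIV]) (use b in auto)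
  define p where "p = vp.construct e (\<lambda>x. if x \<in> b then 0 else x)"
  have lp: "Vector_Spaces.linear scale scale p"
    unfolding p_def using e by (intro vp.linear_construct)
  interpret p: Vector_Spaces.linear scale scale p by fact
  have pe: "p x = (if x \<in> b then 0 else x)" if "x \<in> e" for x
    unfolding p_def using vp.construct_basis[OF e(2) that] by simp
  have "p x = 0 \<longleftrightarrow> x \<in> N" for x
  proof
    assume "x \<in> N"
    then have "x \<in> span b" using b by blast
    then show "p x = 0"
      by (rule p.eq_0_on_span[rotated]) (use pe e in auto)
  next
    assume px: "p x = 0"
    have "e = b \<union> (e - b)" using e by blast
    then have "x \<in> span (b \<union> (e - b))" using e by auto
    then obtain y z where yz: "x = y + z" "y \<in> span b" "z \<in> span (e - b)"
      unfolding span_Un by auto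
    have "p y = 0"
      using yz(2) by (rule p.eq_0_on_span[rotated]) (use pe e in auto)
    \<comment> \<open>\<open>p\<close> fixes the basis vectors outside \<open>b\<close>, so
      \<open>p - id\<close> vanishes on their span.\<close>
    moreover have "p z = z"
    proof -
      interpret q: Vector_Spaces.linear scale scale "\<lambda>x. p x - x"
        by unfold_locales (simp_all add: p.add p.scale scale_right_diff_distrib algebra_simps)
      have "p z - z = 0" using yz(3) by (rule q.eq_0_on_span[rotated]) (use pe in auto)
      then show ?thesis by simp
    qed
    ultimately have "z = 0" using px yz by (simp add: p.add)
    then show "x \<in> N" using yz b N by (metis add.right_neutral span_minimal subsetD)
  qed
  then show ?thesis using lp by blast
qed

text \<open>The finite set \<open>F\<close> bounds the size of independent subsets of
  \<open>S'\<close>, so \<open>dim\<close> counts a finite basis and one more vector really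
  increases it.\<close>

lemma dim_less_of_psubset:
  assumes "subspace S" "S \<subset> S'" "finite F" "S' \<subseteq> span F"
  shows "dim S < dim S'"
proof -
  obtain b where b: "b \<subseteq> S" "independent b" "S \<subseteq> span b" "card b = dim S"
    by (rule basis_exists)
  obtain x where x: "x \<in> S'" "x \<notin> S" using assms by blast
  have "x \<notin> span b" using x b assms(1) by (meson span_minimal subsetD)
  then have ind: "independent (insert x b)" using b by (simp add: independent_insert)
  have "insert x b \<subseteq> S'" using b x assms by auto
  then obtain e where e: "insert x b \<subseteq> e" "e \<subseteq> S'" "independent e" "S' \<subseteq> span e"
    by (rule maximal_independent_subset_extend[OF _ ind])
  have "finite e" using independent_span_bound[OF assms(3) e(3)] e assms by auto
  then have "card (insert x b) \<le> card e" using e by (simp add: card_mono)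
  moreover have "card e = dim S'" using basis_card_eq_dim e by blast
  moreover have "x \<notin> b" using b x by auto
  moreover have "finite b" using \<open>finite e\<close> e by (meson finite_insert finite_subset)
  ultimately show ?thesis using b by simp
qed

text \<open>Descending chain condition: all members have finite dimension modulo \<open>N\<close>,
  and one of least dimension is minimal. A subspace containing \<open>N\<close> can be recovered
  from its image under \<open>p\<close>.\<close>

lemma minimal_subspace:
  assumes F: "finite F" and N: "subspace N" and ne: "\<S> \<noteq> {}"
    and \<S>: "\<And>S. S \<in> \<S> \<Longrightarrow> subspace S \<and> N \<subseteq> S \<and> (\<forall>z\<in>S. \<exists>f\<in>span F. z - f \<in> N)"
  shows "\<exists>S\<in>\<S>. \<forall>S'\<in>\<S>. S' \<subseteq> S \<longrightarrow> S' = S"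
proof -
  obtain p where lp: "Vector_Spaces.linear scale scale p" and p0: "\<And>x. p x = 0 \<longleftrightarrow> x \<in> N"
    using exists_linear_with_kernel[OF N] by auto
  interpret p: Vector_Spaces.linear scale scale p by fact
  obtain S where S: "S \<in> \<S>" and min: "\<And>S'. S' \<in> \<S> \<Longrightarrow> dim (p ` S) \<le> dim (p ` S')"
    using ne ex_has_least_nat[of "\<lambda>S. S \<in> \<S>" _ "\<lambda>S. dim (p ` S)"] by blast
  have "S' = S" if S': "S' \<in> \<S>" "S' \<subseteq> S" for S'
  proof (rule ccontr)
    assume "S' \<noteq> S"
    then obtain x where x: "x \<in> S" "x \<notin> S'" using S' by blast
    have "p x \<notin> p ` S'"
    proof
      assume "p x \<in> p ` S'"
      then obtain y where y: "y \<in> S'" "p x = p y" by blast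
      then have "x - y \<in> N" using p0[of "x - y"] by (simp add: p.diff)
      then have "x - y + y \<in> S'" using \<S>[OF S'(1)] y subspace_add by blast
      then show False using x by simp
    qed
    then have ps: "p ` S' \<subset> p ` S" using x S' by blast
    have "p ` S \<subseteq> span (p ` F)"
    proof
      fix w assume "w \<in> p ` S"
      then obtain z where z: "z \<in> S" "w = p z" by blast
      then obtain f where f: "f \<in> span F" "z - f \<in> N" using \<S>[OF S] by blast
      then have "p z = p f" using p0[of "z - f"] by (simp add: p.diff)
      then show "w \<in> span (p ` F)" using f z by (simp add: p.span_image)
    qed
    moreover have "subspace (p ` S')" using \<S>[OF S'(1)] p.subspace_image by blast
    ultimately have "dim (p ` S') < dim (p ` S)"
      using dim_less_of_psubset[OF _ ps, of "p ` F"] F by auto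
    then show False using min[OF S'(1)] by simp
  qed
  then show ?thesis using S by blast
qed

text \<open>A basis of \<open>D\<close> modulo \<open>N\<close>: the vectors of \<open>D\<close> by
  which a basis \<open>b\<close> of \<open>N\<close> is enlarged to one of
  \<open>N + D\<close>.\<close>

lemma relative_basis:
  assumes N: "subspace N" and D: "subspace D"
  shows "\<exists>Q\<subseteq>D. (\<forall>d\<in>D. \<exists>q\<in>span Q. d - q \<in> N) \<and>
    (\<forall>S k. finite S \<longrightarrow> S \<subseteq> Q \<longrightarrow> (\<Sum>q\<in>S. scale (k q) q) \<in> N \<longrightarrow> (\<forall>q\<in>S. k q = 0))"
proof -
  obtain b where b: "b \<subseteq> N" "independent b" "N \<subseteq> span b"
    by (rule maximal_independent_subset)
  obtain e where e: "b \<subseteq> e" "e \<subseteq> b \<union> D" "independent e" "b \<union> D \<subseteq> span e"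
    by (rule maximal_independent_subset_extend[of b "b \<union> D"]) (use b in auto)
  have h1: "\<exists>q\<in>span (e - b). d - q \<in> N" if "d \<in> D" for d
  proof -
    have "e = b \<union> (e - b)" using e by blast
    then have "d \<in> span (b \<union> (e - b))" using e that by auto
    then obtain y z where yz: "d = y + z" "y \<in> span b" "z \<in> span (e - b)"
      unfolding span_Un by auto
    then show ?thesis using b N by (metis add_diff_cancel_right' span_minimal subsetD)
  qed
  have h2: "k q = 0"
    if S: "finite S" "S \<subseteq> e - b" "(\<Sum>q\<in>S. scale (k q) q) \<in> N" "q \<in> S" for S k q
  proof (rule ccontr)
    assume kq: "k q \<noteq> 0"
    have "b \<subseteq> e - {q}" using e S by blast
    have 1: "(\<Sum>q\<in>S. scale (k q) q) \<in> span (e - {q})"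
      using S b span_mono[OF \<open>b \<subseteq> e - {q}\<close>] by blast
    have 2: "(\<Sum>q\<in>S - {q}. scale (k q) q) \<in> span (e - {q})"
      by (intro span_sum span_scale span_base) (use S in auto)
    have "(\<Sum>q\<in>S. scale (k q) q) = scale (k q) q + (\<Sum>q\<in>S - {q}. scale (k q) q)"
      using S by (simp add: sum.remove)
    then have "scale (k q) q \<in> span (e - {q})"
      using span_diff[OF 1 2] by simp
    then have "q \<in> span (e - {q})"
      using kq by (metis scale_scale left_inverse scale_one span_scale)
    then show False using e S dependent_def by blast
  qed
  have "e - b \<subseteq> D" using e by blast
  with h1 h2 show ?thesis
    by (intro exI[of _ "e - b"] conjI ballI allI impI) assumption+
qed

end

lemma sum_fun_apply: "(\<Sum>i\<in>S. f i) x = (\<Sum>i\<in>S. f i x)"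
  by (induction S rule: infinite_finite_induct) auto

text \<open>Bars are indexed, so combinations run over indices rather than vectors; one index is
  kept for each vector that occurs.\<close>

lemma (in vector_space) span_image_explicit:
  assumes "y \<in> span (f ` I)"
  obtains S k where "finite S" "S \<subseteq> I" "y = (\<Sum>i\<in>S. scale (k i) (f i))"
proof -
  obtain T r where T: "finite T" "T \<subseteq> f ` I" "y = (\<Sum>a\<in>T. scale (r a) a)"
    using assms unfolding span_explicit by blast
  obtain S where S: "S \<subseteq> I" "inj_on f S" "T = f ` S"
    using T(2) by (auto simp: subset_image_inj)
  have "finite S" using S T finite_imageD by blast
  moreover have "y = (\<Sum>i\<in>S. scale (r (f i)) (f i))"
    using T(3) S by (simp add: sum.reindex)
  ultimately show thesis using S that[of S "\<lambda>i. r (f i)"] by blast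
qed

section \<open>Filtered quotients\<close>

text \<open>The right end is an extended real so that a bar that never dies,
  \<open>half_open a \<infinity>\<close>, is treated like the others.\<close>

definition half_open :: "real \<Rightarrow> ereal \<Rightarrow> real set" where
  "half_open a \<beta> = {s. a < s \<and> ereal s \<le> \<beta>}"

text \<open>The persistence module in question is \<open>t \<mapsto> Z t / B t\<close>. A subspace of \<open>Z t / B t\<close> is represented
  by its preimage in \<open>Z t\<close>; for instance \<open>im s t\<close> below stands for the image of \<open>Z s / B s\<close>.\<close>

locale filtered_quotient = vector_space scale
  for scale :: "'f::field \<Rightarrow> 'v::ab_group_add \<Rightarrow> 'v" +
  fixes Z B :: "real \<Rightarrow> 'v set"
  assumes subspace_Z: "subspace (Z t)" and subspace_B: "subspace (B t)"
    and B_le_Z: "B t \<subseteq> Z t"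
    and Z_mono: "s \<le> t \<Longrightarrow> Z s \<subseteq> Z t" and B_mono: "s \<le> t \<Longrightarrow> B s \<subseteq> B t"
    and Z_left: "x \<in> Z t \<Longrightarrow> \<exists>s<t. x \<in> Z s"
    and B_left: "x \<in> B t \<Longrightarrow> \<exists>s<t. x \<in> B s"
    and tame: "s < t \<Longrightarrow> \<exists>F. finite F \<and> (\<forall>z\<in>Z s. \<exists>f\<in>span F. z - f \<in> B t)"
    and Z_nonpos: "t \<le> 0 \<Longrightarrow> Z t \<subseteq> {0}"
begin

lemmas Z_simps = subspace_0[OF subspace_Z] subspace_add[OF subspace_Z] subspace_diff[OF subspace_Z]
  subspace_neg[OF subspace_Z] subspace_scale[OF subspace_Z] subspace_sum[OF subspace_Z]
lemmas B_simps = subspace_0[OF subspace_B] subspace_add[OF subspace_B] subspace_diff[OF subspace_B]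
  subspace_neg[OF subspace_B] subspace_scale[OF subspace_B] subspace_sum[OF subspace_B]

lemma B_sym: "x - y \<in> B t \<Longrightarrow> y - x \<in> B t"
  using subspace_neg[OF subspace_B, of "x - y" t] by simp

lemma B_trans: "x - y \<in> B t \<Longrightarrow> y - z \<in> B t \<Longrightarrow> x - z \<in> B t"
  using subspace_add[OF subspace_B, of "x - y" t "y - z"] by simp

lemma B_cong: "x - y \<in> B t \<Longrightarrow> x \<in> B t \<longleftrightarrow> y \<in> B t"
  using subspace_add[OF subspace_B, of "x - y" t y] subspace_diff[OF subspace_B, of x t "x - y"]
  by auto

section \<open>Images of the structure maps and their stabilisation\<close>

definition im :: "real \<Rightarrow> real \<Rightarrow> 'v set" where
  "im s t = {x. \<exists>z\<in>Z s. x - z \<in> B t}"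

lemma subspace_im: "subspace (im s t)"
proof -
  have "x + y \<in> im s t" if xy: "x \<in> im s t" "y \<in> im s t" for x y
  proof -
    obtain z w where "z \<in> Z s" "x - z \<in> B t" "w \<in> Z s" "y - w \<in> B t"
      using xy unfolding im_def by blast
    then have "z + w \<in> Z s" "(x + y) - (z + w) \<in> B t"
      using Z_simps(2) B_simps(2)[of "x - z" t "y - w"] by (auto simp: algebra_simps)
    then show ?thesis unfolding im_def by blast
  qed
  moreover have "scale r x \<in> im s t" if x: "x \<in> im s t" for r x
  proof -
    obtain z where "z \<in> Z s" "x - z \<in> B t" using x unfolding im_def by blast
    then have "scale r z \<in> Z s" "scale r x - scale r z \<in> B t"
      using Z_simps(5) B_simps(5)[of "x - z" t r] by (auto simp: scale_right_diff_distrib)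
    then show ?thesis unfolding im_def by blast
  qed
  moreover have "0 \<in> im s t" unfolding im_def using Z_simps(1) B_simps(1) by force
  ultimately show ?thesis by (simp add: subspace_def)
qed

lemma im_mono: "s \<le> s' \<Longrightarrow> im s t \<subseteq> im s' t"
  unfolding im_def using Z_mono by blast

lemma Z_le_im: "Z s \<subseteq> im s t"
  unfolding im_def using B_simps(1) by force

lemma B_le_im: "B t \<subseteq> im s t"
  unfolding im_def using Z_simps(1) by force

lemma im_le_Z: "s \<le> t \<Longrightarrow> im s t \<subseteq> Z t"
  unfolding im_def using Z_mono B_le_Z Z_simps(2)[of _ t]
  by (smt (verit) diff_add_cancel mem_Collect_eq subset_iff)

text \<open>\<open>tame\<close> says that \<open>im s t\<close> has finite dimension modulo
  \<open>B t\<close>. The existence of bars uses finite rank only in this form.\<close>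

lemma tame_minimal:
  assumes "s < t" "\<S> \<noteq> {}" "\<And>S. S \<in> \<S> \<Longrightarrow> subspace S \<and> B t \<subseteq> S \<and> S \<subseteq> im s t"
  shows "\<exists>S\<in>\<S>. \<forall>S'\<in>\<S>. S' \<subseteq> S \<longrightarrow> S' = S"
proof -
  obtain F where F: "finite F" "\<forall>z\<in>Z s. \<exists>f\<in>span F. z - f \<in> B t"
    using tame[OF assms(1)] by blast
  have "\<exists>f\<in>span F. x - f \<in> B t" if "x \<in> im s t" for x
    using that F(2) B_trans unfolding im_def by blast
  then show ?thesis
    using minimal_subspace[OF F(1) subspace_B assms(2), of t] assms(3) by (meson subsetD)
qed

text \<open>The images at time \<open>t\<close> shrink as \<open>s\<close> decreases to
  \<open>a\<close>. They form a chain, so a minimal one is contained in all of them.\<close>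

lemma stable_image:
  assumes "a < t"
  shows "\<exists>s>a. s < t \<and> (\<forall>s'. a < s' \<longrightarrow> s' \<le> s \<longrightarrow> im s t \<subseteq> im s' t)"
proof -
  \<comment> \<open>The cap at the midpoint keeps \<open>s\<close> away from \<open>t\<close>, as
    \<open>tame\<close> asks for a strict inequality.\<close>
  let ?m = "(a + t) / 2"
  have m: "a < ?m" "?m < t" using assms by auto
  define \<S> where "\<S> = (\<lambda>s. im s t) ` {a<..?m}"
  have "\<S> \<noteq> {}" unfolding \<S>_def using m by auto
  moreover have "subspace S \<and> B t \<subseteq> S \<and> S \<subseteq> im ?m t" if "S \<in> \<S>" for S
  proof -
    obtain s where "s \<le> ?m" "S = im s t" using \<open>S \<in> \<S>\<close> unfolding \<S>_def by auto
    then show ?thesis using subspace_im B_le_im im_mono by blast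
  qed
  ultimately obtain S where S: "S \<in> \<S>" "\<forall>S'\<in>\<S>. S' \<subseteq> S \<longrightarrow> S' = S"
    using tame_minimal[OF m(2), of \<S>] by blast
  then obtain s where s: "a < s" "s \<le> ?m" "S = im s t" unfolding \<S>_def by auto
  have "im s t \<subseteq> im s' t" if "a < s'" "s' \<le> s" for s'
  proof -
    have "im s' t \<in> \<S>" unfolding \<S>_def using that s by auto
    then have "im s' t = im s t" using S(2) s(3) im_mono[OF that(2)] by simp
    then show ?thesis by simp
  qed
  moreover have "s < t" using s m by linarith
  ultimately show ?thesis using s by blast
qed

text \<open>What is hit at time \<open>t\<close> from every time after \<open>a\<close>: the
  elements that extend to coherent families.\<close>

definition deep :: "real \<Rightarrow> real \<Rightarrow> 'v set" where
  "deep a t = {x \<in> Z t. \<forall>s. a < s \<longrightarrow> s \<le> t \<longrightarrow> x \<in> im s t}"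

text \<open>The maps between stable images are onto: a preimage taken at a time \<open>r\<close>
  where the images in \<open>Z s / B s\<close> have stabilised is again hit from every time after
  \<open>a\<close>.\<close>

lemma deep_step:
  assumes x: "x \<in> deep a t" and s: "a < s" "s \<le> t"
  shows "\<exists>y\<in>deep a s. x - y \<in> B t"
proof -
  obtain r where r: "a < r" "r < s" "\<And>s'. a < s' \<Longrightarrow> s' \<le> r \<Longrightarrow> im r s \<subseteq> im s' s"
    using stable_image[OF s(1)] by blast
  then have "x \<in> im r t" using x s unfolding deep_def by auto
  then obtain y where y: "y \<in> Z r" "x - y \<in> B t" unfolding im_def by blast
  have "y \<in> im s' s" if "a < s'" for s'
    using r(3)[OF that] im_mono[of r s' s] y Z_le_im[of r s] by (cases "s' \<le> r") auto
  moreover have "y \<in> Z s" using y Z_mono[of r s] r by auto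
  ultimately show ?thesis using y unfolding deep_def by blast
qed

text \<open>Representatives of the elements of the inverse limit of \<open>Z s / B s\<close> for \<open>s\<close> decreasing to \<open>a\<close>.\<close>

definition coherent :: "real \<Rightarrow> (real \<Rightarrow> 'v) set" where
  "coherent a = {c. \<forall>s>a. c s \<in> Z s \<and> (\<forall>t\<ge>s. c s - c t \<in> B t)}"

text \<open>A Mittag-Leffler argument: images stabilise because they are finite dimensional.\<close>

lemma coherent_lift:
  assumes at: "a < t" and x: "x \<in> deep a t"
  shows "\<exists>c\<in>coherent a. c t = x"
proof -
  \<comment> \<open>A sequence decreasing from \<open>t\<close> to \<open>a\<close>. Being cofinal,
    it reduces the lifting to a countable dependent choice.\<close>
  define \<tau> where "\<tau> n = a + (t - a) / real (Suc n)" for n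
  have \<tau>_gt: "a < \<tau> n" for n unfolding \<tau>_def using at by simp
  have \<tau>_0: "\<tau> 0 = t" unfolding \<tau>_def by simp
  have \<tau>_Suc: "\<tau> (Suc n) \<le> \<tau> n" for n
    unfolding \<tau>_def using at by (simp add: frac_le)
  have \<tau>_lim: "\<exists>n. \<tau> n \<le> s" if "a < s" for s
  proof -
    obtain n where n: "(t - a) / (s - a) < real n" using reals_Archimedean2 by blast
    then have "(t - a) < real (Suc n) * (s - a)" using that by (simp add: field_simps)
    then show ?thesis unfolding \<tau>_def by (intro exI[of _ n]) (simp add: field_simps)
  qed
  have "\<exists>f. \<forall>n. (f n \<in> deep a (\<tau> n) \<and> (n = 0 \<longrightarrow> f n = x)) \<and> f n - f (Suc n) \<in> B (\<tau> n)"
  proof (rule dependent_nat_choice)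
    show "\<exists>y. y \<in> deep a (\<tau> 0) \<and> (0 = (0::nat) \<longrightarrow> y = x)" using x \<tau>_0 by auto
    show "\<exists>z. (z \<in> deep a (\<tau> (Suc n)) \<and> (Suc n = 0 \<longrightarrow> z = x)) \<and> y - z \<in> B (\<tau> n)"
      if "y \<in> deep a (\<tau> n) \<and> (n = 0 \<longrightarrow> y = x)" for y n
      using deep_step[of y a "\<tau> n" "\<tau> (Suc n)"] that \<tau>_gt \<tau>_Suc by auto
  qed
  then obtain f where f: "\<And>n. f n \<in> deep a (\<tau> n)" "f 0 = x" "\<And>n. f n - f (Suc n) \<in> B (\<tau> n)"
    by metis
  have fB: "f m - f (m + n) \<in> B (\<tau> m)" for m n
  proof (induction n)
    case (Suc n)
    have "\<tau> (m + n) \<le> \<tau> m" using lift_Suc_antimono_le[of \<tau> m "m + n"] \<tau>_Suc by simp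
    then show ?case using Suc f(3)[of "m + n"] B_mono B_trans by (metis add_Suc_right subsetD)
  qed (simp add: B_simps)
  \<comment> \<open>The value at time \<open>s\<close> is taken from the first term of the sequence
    that is not after \<open>s\<close>. At \<open>s = t\<close> this is the term of index 0, hence
    \<open>x\<close>.\<close>
  define N where "N s = (LEAST n. \<tau> n \<le> s)" for s
  have N: "\<tau> (N s) \<le> s" if "a < s" for s unfolding N_def using LeastI_ex[OF \<tau>_lim[OF that]] .
  have "(\<lambda>s. f (N s)) \<in> coherent a"
  proof -
    have "f (N s) \<in> Z s" if "a < s" for s
      using f(1)[of "N s"] Z_mono[OF N[OF that]] unfolding deep_def by blast
    moreover have "f (N s) - f (N s') \<in> B s'" if s: "a < s" "s \<le> s'" for s s'
    proof -
      have "N s' \<le> N s" unfolding N_def[of s'] using N[of s] s by (intro Least_le) auto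
      then have "f (N s') - f (N s) \<in> B (\<tau> (N s'))" using fB[of "N s'" "N s - N s'"] by simp
      then show ?thesis using B_sym B_mono[OF N[of s']] s by fastforce
    qed
    ultimately show ?thesis unfolding coherent_def by blast
  qed
  moreover have "f (N t) = x" unfolding N_def using \<tau>_0 f(2) by (simp add: Least_eq_0)
  ultimately show ?thesis by auto
qed

text \<open>A barcode in terms of representatives: \<open>c i t\<close> represents the generator of the bar \<open>i\<close> at time
  \<open>t\<close>, and is junk for \<open>t \<notin> J i\<close>.\<close>

definition adapted_bars :: "'i set \<Rightarrow> ('i \<Rightarrow> real set) \<Rightarrow> ('i \<Rightarrow> real \<Rightarrow> 'v) \<Rightarrow> bool" where
  "adapted_bars L J c \<longleftrightarrow>
     (\<forall>i\<in>L. is_interval_in {0<..} (J i)) \<and>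
     (\<forall>i\<in>L. \<forall>t\<in>J i. c i t \<in> Z t) \<and>
     (\<forall>i\<in>L. \<forall>s\<in>J i. \<forall>t\<ge>s. if t \<in> J i then c i s - c i t \<in> B t else c i s \<in> B t) \<and>
     (\<forall>t>0. \<forall>S k. finite S \<longrightarrow> S \<subseteq> {i\<in>L. t \<in> J i} \<longrightarrow> (\<Sum>i\<in>S. scale (k i) (c i t)) \<in> B t \<longrightarrow>
        (\<forall>i\<in>S. k i = 0)) \<and>
     (\<forall>t>0. \<forall>z\<in>Z t. \<exists>S k. finite S \<and> S \<subseteq> {i\<in>L. t \<in> J i} \<and>
        z - (\<Sum>i\<in>S. scale (k i) (c i t)) \<in> B t)"

text \<open>Strictness matters: a bar \<open>(a, \<beta>]\<close> is still alive at
  \<open>\<beta>\<close>. For \<open>\<beta> = \<infinity>\<close> these are all coherent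
  families.\<close>

definition dying :: "real \<Rightarrow> ereal \<Rightarrow> (real \<Rightarrow> 'v) set" where
  "dying a \<beta> = {c \<in> coherent a. \<forall>s. a < s \<longrightarrow> \<beta> < ereal s \<longrightarrow> c s \<in> B s}"

text \<open>With \<open>y = 0\<close> these are the families that are already dead at some time of
  \<open>(a, \<beta>]\<close>; a general \<open>y\<close> adds whatever comes from time
  \<open>a\<close>. So \<open>dying a \<beta>\<close> modulo this space is made of the bars that are
  born exactly at \<open>a\<close> and die exactly at \<open>\<beta>\<close>.\<close>

definition earlier :: "real \<Rightarrow> ereal \<Rightarrow> (real \<Rightarrow> 'v) set" where
  "earlier a \<beta> = {c \<in> coherent a. \<exists>y\<in>Z a. \<exists>s\<in>half_open a \<beta>. c s - y \<in> B s}"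

sublocale fn: vector_space "\<lambda>r c (s::real). scale r (c s)"
  by unfold_locales (auto simp: fun_eq_iff scale_right_distrib scale_left_distrib)

lemma subspace_coherent: "fn.subspace (coherent a)"
proof -
  have "c + d \<in> coherent a" if c: "c \<in> coherent a" and d: "d \<in> coherent a" for c d
  proof -
    have "c s + d s - (c t + d t) \<in> B t" if "a < s" "s \<le> t" for s t
    proof -
      have "(c s - c t) + (d s - d t) \<in> B t"
        using c d that B_simps(2) unfolding coherent_def by blast
      then show ?thesis by (simp add: algebra_simps)
    qed
    then show ?thesis using c d Z_simps(2) unfolding coherent_def by auto
  qed
  moreover have "(\<lambda>s. scale r (c s)) \<in> coherent a" if c: "c \<in> coherent a" for c r
    using c Z_simps(5) B_simps(5) unfolding coherent_def
    by (auto simp flip: scale_right_diff_distrib)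
  moreover have "0 \<in> coherent a" unfolding coherent_def using Z_simps(1) B_simps(1) by auto
  ultimately show ?thesis unfolding fn.subspace_def by blast
qed

lemma subspace_dying: "fn.subspace (dying a \<beta>)"
  unfolding dying_def fn.subspace_def
  using subspace_coherent[of a] B_simps(1,2,5) by (auto simp: fn.subspace_def)

lemma subspace_earlier:
  assumes "ereal a < \<beta>"
  shows "fn.subspace (earlier a \<beta>)"
proof -
  \<comment> \<open>Agreement with \<open>y\<close> persists at later times, so two witnesses can be
    compared at the later of their times, which still lies in
    \<open>half_open a \<beta>\<close>.\<close>
  have push: "c t - y \<in> B t" if "c \<in> coherent a" "a < s" "s \<le> t" "c s - y \<in> B s" for c s t y
    using that B_mono[of s t] B_sym B_trans[of "c t" "c s" t y] unfolding coherent_def by blast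
  have "c + d \<in> earlier a \<beta>" if c: "c \<in> earlier a \<beta>" and d: "d \<in> earlier a \<beta>" for c d
  proof -
    obtain y s where 1: "y \<in> Z a" "s \<in> half_open a \<beta>" "c s - y \<in> B s"
      using c unfolding earlier_def by blast
    obtain z t where 2: "z \<in> Z a" "t \<in> half_open a \<beta>" "d t - z \<in> B t"
      using d unfolding earlier_def by blast
    have cd: "c \<in> coherent a" "d \<in> coherent a" using c d unfolding earlier_def by auto
    let ?m = "max s t"
    have m: "?m \<in> half_open a \<beta>" using 1 2 unfolding half_open_def by (auto simp: max_def)
    have "c ?m - y \<in> B ?m" "d ?m - z \<in> B ?m"
      using push[OF cd(1), of s ?m y] push[OF cd(2), of t ?m z] 1 2 unfolding half_open_def by auto
    then have "(c ?m - y) + (d ?m - z) \<in> B ?m" by (rule B_simps(2))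
    then have "(c + d) ?m - (y + z) \<in> B ?m" by (simp add: algebra_simps)
    moreover have "c + d \<in> coherent a" using cd subspace_coherent fn.subspace_add by blast
    ultimately show ?thesis using m Z_simps(2) 1 2 unfolding earlier_def by blast
  qed
  moreover have "(\<lambda>s. scale r (c s)) \<in> earlier a \<beta>" if c: "c \<in> earlier a \<beta>" for c r
  proof -
    obtain y s where 1: "y \<in> Z a" "s \<in> half_open a \<beta>" "c s - y \<in> B s"
      using c unfolding earlier_def by blast
    have "scale r (c s) - scale r y \<in> B s" using 1 B_simps(5) by (metis scale_right_diff_distrib)
    moreover have "(\<lambda>s. scale r (c s)) \<in> coherent a"
      using c subspace_coherent fn.subspace_scale unfolding earlier_def by blast
    ultimately show ?thesis using 1 Z_simps(5) unfolding earlier_def by blast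
  qed
  moreover have "0 \<in> earlier a \<beta>"
  proof -
    obtain s where "s \<in> half_open a \<beta>"
      using ereal_dense2[OF assms] unfolding half_open_def by (auto intro: less_imp_le)
    moreover have "0 \<in> coherent a" using subspace_coherent fn.subspace_0 by blast
    ultimately show ?thesis using Z_simps(1) B_simps(1) unfolding earlier_def by force
  qed
  ultimately show ?thesis unfolding fn.subspace_def by blast
qed

end

section \<open>Existence of bars\<close>

text \<open>Finds a time in \<open>[t, \<beta>]\<close> that comes after finitely many deaths
  preceding \<open>\<beta>\<close>. A finite \<open>\<beta>\<close> is itself such a time, as bars
  are closed on the right.\<close>

lemma exists_between_ereal:
  assumes "finite Y" "\<And>x. x \<in> Y \<Longrightarrow> x < \<beta>" "ereal t \<le> \<beta>"
  shows "\<exists>s\<ge>t. ereal s \<le> \<beta> \<and> (\<forall>x\<in>Y. x < ereal s)"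
proof (cases \<beta>)
  case (real b)
  then show ?thesis using assms by (intro exI[of _ b]) auto
next
  case PInf
  have "Max (insert (ereal t) Y) \<in> insert (ereal t) Y" using assms(1) by (intro Max_in) auto
  then have "Max (insert (ereal t) Y) < \<infinity>" using assms(2) PInf by (metis PInfty_neq_ereal(1) insertE ereal_infty_less(1))
  then obtain s where s: "Max (insert (ereal t) Y) < ereal s" using less_PInf_Ex_of_nat by auto
  then have "t < s" "\<forall>x\<in>Y. x < ereal s" using assms by auto
  then show ?thesis using PInf by (intro exI[of _ s]) auto
next
  case MInf
  then show ?thesis using assms by auto
qed

context filtered_quotient
begin

lemma coherent_Z: "c \<in> coherent a \<Longrightarrow> a < s \<Longrightarrow> c s \<in> Z s"
  unfolding coherent_def by blast

lemma coherent_B: "c \<in> coherent a \<Longrightarrow> a < s \<Longrightarrow> s \<le> t \<Longrightarrow> c s - c t \<in> B t"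
  unfolding coherent_def by blast

lemma coherent_im: "c \<in> coherent a \<Longrightarrow> a < s \<Longrightarrow> s \<le> t \<Longrightarrow> c t \<in> im s t"
  unfolding im_def using coherent_Z coherent_B B_sym by blast

text \<open>A basis of \<open>dying a \<beta>\<close> modulo \<open>earlier a \<beta>\<close>: these are the bars born at \<open>a\<close> and dying at \<open>\<beta>\<close>.
  Working in the space of coherent families makes the choice independent of the time parameter.\<close>

definition gens :: "real \<Rightarrow> ereal \<Rightarrow> (real \<Rightarrow> 'v) set" where
  "gens a \<beta> = (SOME Q. Q \<subseteq> dying a \<beta> \<and> (\<forall>d\<in>dying a \<beta>. \<exists>q\<in>fn.span Q. d - q \<in> earlier a \<beta>) \<and>
    (\<forall>S k. finite S \<longrightarrow> S \<subseteq> Q \<longrightarrow> (\<Sum>q\<in>S. (\<lambda>s. scale (k q) (q s))) \<in> earlier a \<beta> \<longrightarrow>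
       (\<forall>q\<in>S. k q = 0)))"

lemma gens:
  assumes "ereal a < \<beta>"
  shows "gens a \<beta> \<subseteq> dying a \<beta>"
    and "d \<in> dying a \<beta> \<Longrightarrow> \<exists>q\<in>fn.span (gens a \<beta>). d - q \<in> earlier a \<beta>"
    and "finite S \<Longrightarrow> S \<subseteq> gens a \<beta> \<Longrightarrow> (\<Sum>q\<in>S. (\<lambda>s. scale (k q) (q s))) \<in> earlier a \<beta> \<Longrightarrow>
      q \<in> S \<Longrightarrow> k q = 0"
proof -
  let ?Q = "gens a \<beta>"
  note * = someI_ex[OF fn.relative_basis[OF subspace_earlier[OF assms] subspace_dying[of a \<beta>]],
      folded gens_def]
  show "?Q \<subseteq> dying a \<beta>" using * by (rule conjunct1)
  show "\<exists>q\<in>fn.span ?Q. d - q \<in> earlier a \<beta>" if "d \<in> dying a \<beta>"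
    using *[THEN conjunct2, THEN conjunct1] that by (rule bspec)
  show "k q = 0" if "finite S" "S \<subseteq> ?Q" "(\<Sum>q\<in>S. (\<lambda>s. scale (k q) (q s))) \<in> earlier a \<beta>" "q \<in> S"
    using *[THEN conjunct2, THEN conjunct2, rule_format, OF that] .
qed

text \<open>A bar is named by its birth, its death and its generator, so the multiplicity of an
  interval is the size of \<open>gens\<close>. The bound on \<open>a\<close> keeps the bars inside
  the positive times.\<close>

definition bar_set :: "(real \<times> ereal \<times> (real \<Rightarrow> 'v)) set" where
  "bar_set = {(a, \<beta>, c). 0 \<le> a \<and> ereal a < \<beta> \<and> c \<in> gens a \<beta>}"

abbreviation bar_J :: "real \<times> ereal \<times> (real \<Rightarrow> 'v) \<Rightarrow> real set" where
  "bar_J i \<equiv> half_open (fst i) (fst (snd i))"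

abbreviation bar_c :: "real \<times> ereal \<times> (real \<Rightarrow> 'v) \<Rightarrow> real \<Rightarrow> 'v" where
  "bar_c i \<equiv> snd (snd i)"

lemma bar_dying: "i \<in> bar_set \<Longrightarrow> bar_c i \<in> dying (fst i) (fst (snd i))"
  unfolding bar_set_def using gens(1) by fastforce

lemma bar_coherent: "i \<in> bar_set \<Longrightarrow> bar_c i \<in> coherent (fst i)"
  using bar_dying[of i] unfolding dying_def by simp

text \<open>In a vanishing combination, the bars of latest birth and, among them, latest death are
  congruent to zero modulo bars that are born or die earlier.\<close>

lemma bars_independent:
  assumes S: "finite S" "S \<subseteq> {i \<in> bar_set. t \<in> bar_J i}"
    and sum: "(\<Sum>i\<in>S. scale (k i) (bar_c i t)) \<in> B t"
  shows "\<forall>i\<in>S. k i = 0"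
proof (rule ccontr)
  assume ex: "\<not> ?thesis"
  define S1 where "S1 = {i\<in>S. k i \<noteq> 0}"
  define a where "a = Max (fst ` S1)"
  define S2 where "S2 = {i\<in>S1. fst i = a}"
  define \<beta> where "\<beta> = Max ((\<lambda>i. fst (snd i)) ` S2)"
  define S3 where "S3 = {i\<in>S2. fst (snd i) = \<beta>}"
  define S4 where "S4 = {i\<in>S2. fst (snd i) \<noteq> \<beta>}"
  define S5 where "S5 = {i\<in>S1. fst i \<noteq> a}"
  have fin: "finite S1" "finite S2" "finite S3" "finite S4" "finite S5"
    unfolding S1_def S2_def S3_def S4_def S5_def using S(1) by auto
  have S1ne: "S1 \<noteq> {}" using ex unfolding S1_def by blast
  have le_a: "fst i \<le> a" if "i \<in> S1" for i unfolding a_def using fin that by simp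
  have S2ne: "S2 \<noteq> {}"
    using Max_in[of "fst ` S1"] S1ne fin unfolding S2_def a_def[symmetric] by auto
  have le_\<beta>: "fst (snd i) \<le> \<beta>" if "i \<in> S2" for i unfolding \<beta>_def using fin that by simp
  have S3ne: "S3 \<noteq> {}"
    using Max_in[of "(\<lambda>i. fst (snd i)) ` S2"] S2ne fin unfolding S3_def \<beta>_def[symmetric] by auto
  have S1: "i \<in> bar_set" "fst i < t" "ereal t \<le> fst (snd i)" if "i \<in> S1" for i
    using that S(2) unfolding S1_def half_open_def by auto
  obtain i0 where i0: "i0 \<in> S3" using S3ne by blast
  have a\<beta>: "a < t" "ereal t \<le> \<beta>" "0 \<le> a" "ereal a < \<beta>"
    using S1[of i0] i0 unfolding S3_def S2_def bar_set_def by (auto simp: case_prod_beta)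
  \<comment> \<open>At this time the bars \<open>S4\<close>, with the same birth but an earlier
    death, are already zero, while the bars \<open>S3\<close> are alive.\<close>
  obtain s where s: "t \<le> s" "ereal s \<le> \<beta>" "\<And>i. i \<in> S4 \<Longrightarrow> fst (snd i) < ereal s"
    using exists_between_ereal[of "(\<lambda>i. fst (snd i)) ` S4" \<beta> t] fin(4) a\<beta>(2) le_\<beta>
    unfolding S4_def by force
  define w where "w i = scale (k i) (bar_c i s)" for i
  have sub: "S3 \<subseteq> S1" "S4 \<subseteq> S1" "S5 \<subseteq> S1" unfolding S3_def S4_def S2_def S5_def by auto
  have "(\<Sum>i\<in>S1. scale (k i) (bar_c i t)) = (\<Sum>i\<in>S. scale (k i) (bar_c i t))"
    unfolding S1_def using S(1) by (intro sum.mono_neutral_left) auto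
  then have "(\<Sum>i\<in>S1. scale (k i) (bar_c i t)) \<in> B s" using sum B_mono[OF s(1)] by auto
  moreover have "(\<Sum>i\<in>S1. scale (k i) (bar_c i t)) - (\<Sum>i\<in>S1. w i) \<in> B s"
    unfolding w_def sum_subtractf[symmetric] scale_right_diff_distrib[symmetric]
    by (intro B_simps(5,6)) (use coherent_B[OF bar_coherent] S1 s(1) in auto)
  ultimately have all: "(\<Sum>i\<in>S1. w i) \<in> B s" using B_cong by blast
  have S4: "(\<Sum>i\<in>S4. w i) \<in> B s"
    unfolding w_def
  proof (intro B_simps(5,6))
    fix i assume i: "i \<in> S4"
    then have "i \<in> S1" using sub by blast
    then have "i \<in> bar_set" "fst i < s" using S1[of i] s(1) by auto
    then show "bar_c i s \<in> B s" using bar_dying[of i] s(3)[OF i] unfolding dying_def by simp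
  qed
  \<comment> \<open>The bars \<open>S5\<close> are born before \<open>a\<close>, so their
    contribution is the image of a vector at time \<open>a\<close>; the sign makes the combination
    of \<open>S3\<close> congruent to \<open>y\<close>.\<close>
  define y where "y = - (\<Sum>i\<in>S5. scale (k i) (bar_c i a))"
  have S5a: "i \<in> bar_set \<and> fst i < a" if "i \<in> S5" for i
    using that S1 le_a[of i] unfolding S5_def by auto
  have y: "y \<in> Z a"
    unfolding y_def by (intro Z_simps(4,5,6)) (use coherent_Z[OF bar_coherent] S5a in auto)
  have S5: "(\<Sum>i\<in>S5. w i) + y \<in> B s"
  proof -
    have *: "bar_c i a - bar_c i s \<in> B s" if "i \<in> S5" for i
      using coherent_B[OF bar_coherent, of i a s] S5a[OF that] s(1) a\<beta>(1) by auto
    then have "(\<Sum>i\<in>S5. scale (k i) (bar_c i a)) - (\<Sum>i\<in>S5. w i) \<in> B s"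
      unfolding w_def sum_subtractf[symmetric] scale_right_diff_distrib[symmetric]
      by (intro B_simps(5,6) *)
    then show ?thesis unfolding y_def using B_sym[of "\<Sum>i\<in>S5. scale (k i) (bar_c i a)"] by simp
  qed
  have "(\<Sum>i\<in>S1. w i) = (\<Sum>i\<in>S3. w i) + (\<Sum>i\<in>S4. w i) + (\<Sum>i\<in>S5. w i)"
  proof -
    have "S1 = S3 \<union> S4 \<union> S5" "S3 \<inter> S4 = {}" "(S3 \<union> S4) \<inter> S5 = {}"
      unfolding S3_def S4_def S5_def S2_def by auto
    then show ?thesis using fin by (simp add: sum.union_disjoint)
  qed
  then have "(\<Sum>i\<in>S3. w i) - y = (\<Sum>i\<in>S1. w i) - (\<Sum>i\<in>S4. w i) - ((\<Sum>i\<in>S5. w i) + y)"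
    by (simp add: algebra_simps)
  then have *: "(\<Sum>i\<in>S3. w i) - y \<in> B s" using all S4 S5 B_simps(3) by metis
  \<comment> \<open>The bars \<open>S3\<close> share birth and death and differ only in their
    generators, so the relation becomes one between elements of \<open>gens a \<beta>\<close> modulo
    \<open>earlier a \<beta>\<close>.\<close>
  define R where "R = (\<lambda>i. snd (snd i)) ` S3"
  have S3R: "S3 = (\<lambda>q. (a, \<beta>, q)) ` R"
    unfolding R_def image_image S3_def S2_def by (force simp: image_iff)
  have finR: "finite R" unfolding R_def using fin by simp
  have RQ: "R \<subseteq> gens a \<beta>"
    using S1(1) sub(1) unfolding S3R bar_set_def by auto
  let ?z = "\<Sum>q\<in>R. (\<lambda>s. scale (k (a, \<beta>, q)) (q s))"
  have zs: "?z s = (\<Sum>i\<in>S3. w i)"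
    unfolding S3R w_def sum_fun_apply by (subst sum.reindex) (auto simp: inj_on_def)
  have "?z \<in> coherent a"
  proof (intro fn.subspace_sum[OF subspace_coherent] fn.subspace_scale[OF subspace_coherent])
    show "q \<in> coherent a" if "q \<in> R" for q
      using subsetD[OF gens(1)[OF a\<beta>(4)], of q] RQ that unfolding dying_def by auto
  qed
  moreover have "s \<in> half_open a \<beta>" unfolding half_open_def using s a\<beta> by auto
  moreover have "?z s - y \<in> B s" using * zs by simp
  ultimately have "?z \<in> earlier a \<beta>"
    unfolding earlier_def by (intro CollectI conjI bexI[OF _ y] bexI[of _ s])
  then have "\<forall>q\<in>R. k (a, \<beta>, q) = 0" using gens(3)[OF a\<beta>(4) finR RQ, of "\<lambda>q. k (a, \<beta>, q)"] by simp
  then have "k i0 = 0" using i0 unfolding S3R by auto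
  then show False using i0 sub(1) unfolding S1_def by auto
qed

text \<open>If the bars do not span at \<open>t\<close>, there is a smallest image \<open>I\<close> that is not in their span, which
  determines a birth \<open>a\<close>, and then a smallest kernel in \<open>I\<close> that is not, which determines a death \<open>\<beta>\<close>.\<close>

lemma bars_span:
  assumes t: "t > 0" and z: "z \<in> Z t"
  shows "\<exists>S k. finite S \<and> S \<subseteq> {i \<in> bar_set. t \<in> bar_J i} \<and>
    z - (\<Sum>i\<in>S. scale (k i) (bar_c i t)) \<in> B t"
proof -
  let ?G = "(\<lambda>i. bar_c i t) ` {i \<in> bar_set. t \<in> bar_J i}"
  define Sp where "Sp = span (?G \<union> B t)"
  have subSp: "subspace Sp" unfolding Sp_def by (rule subspace_span)
  note Sp_simps = subspace_0[OF subSp] subspace_add[OF subSp] subspace_diff[OF subSp]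
    subspace_scale[OF subSp]
  have BSp: "B t \<subseteq> Sp" unfolding Sp_def using span_superset by blast
  have imSp: "im s t \<subseteq> Sp \<longleftrightarrow> Z s \<subseteq> Sp" for s
  proof
    assume "Z s \<subseteq> Sp"
    then show "im s t \<subseteq> Sp"
      unfolding im_def using BSp Sp_simps(2) by (smt (verit) diff_add_cancel mem_Collect_eq subset_iff)
  qed (use Z_le_im[of s t] in blast)
  have "Z t \<subseteq> Sp"
  proof (rule ccontr)
    assume "\<not> Z t \<subseteq> Sp"
    then obtain x where "x \<in> Z t" "x \<notin> Sp" by blast
    \<comment> \<open>Left continuity moves the failure to a time strictly before \<open>t\<close>,
      where \<open>tame\<close> applies.\<close>
    then obtain s0 where s0: "s0 < t" "\<not> Z s0 \<subseteq> Sp" using Z_left[of x t] by blast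
    define \<S> where "\<S> = (\<lambda>s. im s t) ` {s. s \<le> s0 \<and> \<not> Z s \<subseteq> Sp}"
    have "\<S> \<noteq> {}" unfolding \<S>_def using s0 by auto
    moreover have "subspace S \<and> B t \<subseteq> S \<and> S \<subseteq> im s0 t" if "S \<in> \<S>" for S
    proof -
      obtain s where "s \<le> s0" "S = im s t" using \<open>S \<in> \<S>\<close> unfolding \<S>_def by auto
      then show ?thesis using subspace_im B_le_im im_mono[of s s0 t] by simp
    qed
    ultimately obtain S where S: "S \<in> \<S>" "\<forall>S'\<in>\<S>. S' \<subseteq> S \<longrightarrow> S' = S"
      using tame_minimal[OF s0(1), of \<S>] by meson
    then obtain s1 where s1: "s1 \<le> s0" "\<not> Z s1 \<subseteq> Sp" "S = im s1 t" unfolding \<S>_def by auto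
    define A where "A = {s. s \<le> s1 \<and> \<not> Z s \<subseteq> Sp}"
    have A0: "0 \<le> s" if "s \<in> A" for s
    proof (rule ccontr)
      assume "\<not> 0 \<le> s"
      then have "Z s \<subseteq> {0}" using Z_nonpos[of s] by simp
      then show False using that Sp_simps(1) unfolding A_def by blast
    qed
    have s1A: "s1 \<in> A" using s1 unfolding A_def by simp
    define a where "a = Inf A"
    have bdd: "bdd_below A" using A0 by (meson bdd_below.I)
    have a0: "0 \<le> a" unfolding a_def using A0 s1A by (intro cInf_greatest) auto
    have as1: "a \<le> s1" unfolding a_def using bdd s1A by (rule cInf_lower[rotated])
    \<comment> \<open>By left continuity the infimum is not attained: everything present at
      \<open>a\<close> is spanned, and the failure begins right after \<open>a\<close>.\<close>
    have Za: "Z a \<subseteq> Sp"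
    proof
      fix x assume "x \<in> Z a"
      then obtain s where s: "s < a" "x \<in> Z s" using Z_left by blast
      then have "s \<notin> A" unfolding a_def using bdd cInf_lower by (meson not_le)
      then show "x \<in> Sp" using s as1 unfolding A_def by auto
    qed
    then have "a \<noteq> s1" using s1 by auto
    then have as1: "a < s1" using as1 by simp
    have s1t: "s1 < t" using s1 s0 by simp
    \<comment> \<open>By minimality every image from a time after \<open>a\<close> contains
      \<open>im s1 t\<close>, whence each vector of \<open>im s1 t\<close> extends to a coherent
      family.\<close>
    have stable: "im s1 t \<subseteq> im s t" if s: "a < s" for s
    proof (cases "s \<le> s1")
      case True
      obtain s' where s': "s' \<in> A" "s' < s" using cInf_lessD[of A s] s s1A unfolding a_def by blast
      then have "\<not> Z s \<subseteq> Sp" using Z_mono[of s' s] unfolding A_def by auto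
      then have "im s t \<in> \<S>" unfolding \<S>_def using True s1 by auto
      then show ?thesis using S(2) s1(3) im_mono[OF True, of t] by blast
    next
      case False
      then show ?thesis using im_mono[of s1 s t] by simp
    qed
    have lift: "\<exists>c\<in>coherent a. c t = x" if "x \<in> im s1 t" for x
    proof -
      have "x \<in> deep a t" unfolding deep_def using that stable im_le_Z[of s1 t] s1t by auto
      then show ?thesis using coherent_lift[of a t x] as1 s1t by simp
    qed
    define I where "I = im s1 t"
    have I: "subspace I" "B t \<subseteq> I" "\<not> I \<subseteq> Sp" unfolding I_def
      using subspace_im B_le_im imSp s1 by auto
    \<comment> \<open>\<open>I \<inter> B u\<close> is the kernel on \<open>I\<close> of the map
      from \<open>t\<close> to \<open>u\<close>. The last conjunct says that no vector of
      \<open>I\<close> outside \<open>Sp\<close> is dead by time \<open>\<beta>\<close>, while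
      \<open>c\<close> is dead at all times after it.\<close>
    have "\<exists>c \<beta>. c \<in> dying a \<beta> \<and> c t \<in> I \<and> c t \<notin> Sp \<and> ereal t \<le> \<beta> \<and>
      (\<forall>u. t \<le> u \<longrightarrow> ereal u \<le> \<beta> \<longrightarrow> I \<inter> B u \<subseteq> Sp)"
    proof (cases "\<exists>u\<ge>t. \<not> I \<inter> B u \<subseteq> Sp")
      case False
      obtain x where x: "x \<in> I" "x \<notin> Sp" using I by blast
      then obtain c where "c \<in> coherent a" "c t = x" using lift unfolding I_def by blast
      then have "c \<in> dying a \<infinity>" "c t \<in> I" "c t \<notin> Sp" unfolding dying_def using x by auto
      then show ?thesis using False by (intro exI[of _ c] exI[of _ \<infinity>]) auto
    next
      case True
      define \<U> where "\<U> = (\<lambda>u. I \<inter> B u) ` {u. t \<le> u \<and> \<not> I \<inter> B u \<subseteq> Sp}"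
      have "\<U> \<noteq> {}" unfolding \<U>_def using True by auto
      moreover have "subspace S \<and> B t \<subseteq> S \<and> S \<subseteq> im s1 t" if "S \<in> \<U>" for S
      proof -
        obtain u where "t \<le> u" "S = I \<inter> B u" using \<open>S \<in> \<U>\<close> unfolding \<U>_def by auto
        then show ?thesis using I subspace_B B_mono[of t u] subspace_inter unfolding I_def by auto
      qed
      ultimately obtain S where S: "S \<in> \<U>" "\<forall>S'\<in>\<U>. S' \<subseteq> S \<longrightarrow> S' = S"
        using tame_minimal[OF s1t, of \<U>] by meson
      then obtain u1 where u1: "t \<le> u1" "\<not> I \<inter> B u1 \<subseteq> Sp" "S = I \<inter> B u1" unfolding \<U>_def by auto
      define U where "U = {u. t \<le> u \<and> \<not> I \<inter> B u \<subseteq> Sp}"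
      have u1U: "u1 \<in> U" using u1 unfolding U_def by simp
      have bddU: "bdd_below U" unfolding U_def by (auto intro: bdd_belowI)
      define b where "b = Inf U"
      have tb: "t \<le> b" unfolding b_def using u1U unfolding U_def by (intro cInf_greatest) auto
      have small: "I \<inter> B u \<subseteq> Sp" if "t \<le> u" "u < b" for u
        using that bddU cInf_lower[of u U] unfolding b_def U_def by fastforce
      \<comment> \<open>Left continuity of \<open>B\<close> excludes a death at the infimum itself,
        which is why bars are closed on the right.\<close>
      have Ib: "I \<inter> B b \<subseteq> Sp"
      proof
        fix x assume x: "x \<in> I \<inter> B b"
        then obtain u where u: "u < b" "x \<in> B u" using B_left by blast
        then show "x \<in> Sp"
          using small[of u] x BSp B_mono[of u t] by (cases "t \<le> u") auto
      qed
      \<comment> \<open>The minimal kernel is contained in the kernel of every time after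
        \<open>b\<close>, so a single vector outside \<open>Sp\<close> is dead at all of
        them.\<close>
      have u1_B: "I \<inter> B u1 \<subseteq> B u" if u: "b < u" for u
      proof (cases "u \<le> u1")
        case True
        obtain u' where u': "u' \<in> U" "u' < u" using cInf_lessD[of U u] u u1U unfolding b_def by blast
        then have "\<not> I \<inter> B u \<subseteq> Sp" using B_mono[of u' u] unfolding U_def by auto
        then have "I \<inter> B u \<in> \<U>" unfolding \<U>_def using u tb by auto
        then show ?thesis using S(2) u1(3) B_mono[OF True] by blast
      next
        case False
        then show ?thesis using B_mono[of u1 u] by auto
      qed
      obtain x where x: "x \<in> I \<inter> B u1" "x \<notin> Sp" using u1 by blast
      then obtain c where c: "c \<in> coherent a" "c t = x" using lift unfolding I_def by blast
      have "c \<in> dying a (ereal b)"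
      proof -
        have "c s \<in> B s" if "b < s" for s
          using u1_B[OF that] x c coherent_B[OF c(1), of t s] as1 s1t tb that
            B_cong[of "c t" "c s" s] by auto
        then show ?thesis unfolding dying_def using c by auto
      qed
      moreover have "I \<inter> B u \<subseteq> Sp" if "t \<le> u" "u \<le> b" for u
        using small[of u] Ib that by (cases "u = b") auto
      ultimately show ?thesis using x c tb by (intro exI[of _ c] exI[of _ "ereal b"]) auto
    qed
    then obtain c \<beta> where c: "c \<in> dying a \<beta>" "c t \<in> I" "c t \<notin> Sp" "ereal t \<le> \<beta>"
      and small: "\<And>u. t \<le> u \<Longrightarrow> ereal u \<le> \<beta> \<Longrightarrow> I \<inter> B u \<subseteq> Sp" by blast
    have at: "a < t" using as1 s1t by simp
    have a\<beta>: "ereal a < \<beta>" using at c(4) by (intro less_le_trans[of "ereal a" "ereal t" \<beta>]) auto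
    have tJ: "t \<in> half_open a \<beta>" using at c(4) unfolding half_open_def by simp
    obtain q where q: "q \<in> fn.span (gens a \<beta>)" "c - q \<in> earlier a \<beta>"
      using gens(2)[OF a\<beta> c(1)] by blast
    have "q t \<in> Sp \<and> q \<in> coherent a"
      using q(1)
    proof (induction rule: fn.span_induct)
      case base
      have "fn.subspace {q. q t \<in> Sp}" using Sp_simps unfolding fn.subspace_def by auto
      then have "fn.subspace ({q. q t \<in> Sp} \<inter> coherent a)"
        using subspace_coherent fn.subspace_inter by blast
      moreover have "{q. q t \<in> Sp} \<inter> coherent a = {q. q t \<in> Sp \<and> q \<in> coherent a}" by blast
      ultimately show ?case by simp
    next
      case (step x)
      then have "(a, \<beta>, x) \<in> bar_set" unfolding bar_set_def using a0 a\<beta> by auto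
      then have "bar_c (a, \<beta>, x) t \<in> ?G" using tJ by (intro imageI) auto
      then have "x t \<in> Sp" unfolding Sp_def by (simp add: span_base)
      moreover have "x \<in> coherent a" using step gens(1)[OF a\<beta>] unfolding dying_def by blast
      ultimately show ?case by simp
    qed
    then have qSp: "q t \<in> Sp" and qc: "q \<in> coherent a" by auto
    have cc: "c \<in> coherent a" using c unfolding dying_def by blast
    obtain y s where ys: "y \<in> Z a" "s \<in> half_open a \<beta>" "(c - q) s - y \<in> B s"
      using q(2) unfolding earlier_def by blast
    \<comment> \<open>The error of replacing \<open>c\<close> by \<open>q\<close> and a vector from
      time \<open>a\<close>, which vanishes at time \<open>s\<close>. If \<open>s \<le> t\<close> it
      lies in \<open>B t\<close>; otherwise it is a vector of \<open>I\<close> that is dead by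
      \<open>\<beta>\<close>, hence in \<open>Sp\<close> by the choice of
      \<open>\<beta>\<close>.\<close>
    let ?e = "c t - q t - y"
    have "c - q \<in> coherent a" using subspace_coherent fn.subspace_diff cc qc by blast
    note cq = coherent_B[OF this]
    have "?e \<in> Sp"
    proof (cases "s \<le> t")
      case True
      have "(c - q) s - (c - q) t \<in> B t" using cq[of s t] ys True unfolding half_open_def by auto
      then have "(c - q) t - y \<in> B t" using ys(3) B_mono[OF True] B_sym B_trans by blast
      then show ?thesis using BSp by auto
    next
      case False
      have "(c - q) t - (c - q) s \<in> B s" using cq[of t s] at False by auto
      then have "(c - q) t - y \<in> B s" using ys(3) B_trans by blast
      moreover have "?e \<in> I"
      proof -
        have "q t \<in> I" unfolding I_def using coherent_im[OF qc as1] s1t by simp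
        moreover have "y \<in> I" unfolding I_def using ys(1) Z_mono[of a s1] Z_le_im[of s1 t] as1 by auto
        ultimately show ?thesis using c(2) I(1) subspace_diff by blast
      qed
      ultimately show ?thesis using small[of s] False ys(2) unfolding half_open_def by auto
    qed
    then have "?e + q t + y \<in> Sp" using qSp ys(1) Za Sp_simps(2) by blast
    then show False using c(3) by simp
  qed
  then have "z \<in> span (?G \<union> B t)" using z unfolding Sp_def by blast
  then obtain x b where xb: "z = x + b" "x \<in> span ?G" "b \<in> span (B t)"
    unfolding span_Un by auto
  obtain S k where S: "finite S" "S \<subseteq> {i \<in> bar_set. t \<in> bar_J i}" "x = (\<Sum>i\<in>S. scale (k i) (bar_c i t))"
    by (rule span_image_explicit[OF xb(2)])
  moreover have "z - x \<in> B t" using xb span_minimal[OF subset_refl subspace_B, of t] by auto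
  ultimately show ?thesis by blast
qed

theorem exists_adapted_bars: "adapted_bars bar_set bar_J bar_c"
  unfolding adapted_bars_def
proof (intro conjI)
  have "is_interval_in {0<..} (bar_J i)" if "i \<in> bar_set" for i
  proof -
    obtain a \<beta> c where i: "i = (a, \<beta>, c)" "0 \<le> a" "ereal a < \<beta>"
      using \<open>i \<in> bar_set\<close> unfolding bar_set_def by auto
    obtain s where "a < s" "ereal s < \<beta>" using ereal_dense2[OF i(3)] by auto
    then have "half_open a \<beta> \<noteq> {}" unfolding half_open_def by (auto intro: less_imp_le)
    then show ?thesis
      using i unfolding is_interval_in_def half_open_def by (auto intro: order_trans[rotated])
  qed
  then show "\<forall>i\<in>bar_set. is_interval_in {0<..} (bar_J i)" by blast
  show "\<forall>i\<in>bar_set. \<forall>t\<in>bar_J i. bar_c i t \<in> Z t"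
    using coherent_Z[OF bar_coherent] unfolding half_open_def by simp
  have "if t \<in> bar_J i then bar_c i s - bar_c i t \<in> B t else bar_c i s \<in> B t"
    if i: "i \<in> bar_set" "s \<in> bar_J i" "s \<le> t" for i s t
  proof -
    have *: "bar_c i s - bar_c i t \<in> B t"
      using coherent_B[OF bar_coherent[OF i(1)]] i(2,3) unfolding half_open_def by simp
    moreover have "bar_c i t \<in> B t" if "t \<notin> bar_J i"
      using bar_dying[OF i(1)] i(2,3) that unfolding half_open_def dying_def by auto
    ultimately show ?thesis using B_cong by auto
  qed
  then show "\<forall>i\<in>bar_set. \<forall>s\<in>bar_J i. \<forall>t\<ge>s.
      if t \<in> bar_J i then bar_c i s - bar_c i t \<in> B t else bar_c i s \<in> B t" by simp
  show "\<forall>t>0. \<forall>S k. finite S \<longrightarrow> S \<subseteq> {i \<in> bar_set. t \<in> bar_J i} \<longrightarrow>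
      (\<Sum>i\<in>S. scale (k i) (bar_c i t)) \<in> B t \<longrightarrow> (\<forall>i\<in>S. k i = 0)"
    using bars_independent by simp
  show "\<forall>t>0. \<forall>z\<in>Z t. \<exists>S k. finite S \<and> S \<subseteq> {i \<in> bar_set. t \<in> bar_J i} \<and>
      z - (\<Sum>i\<in>S. scale (k i) (bar_c i t)) \<in> B t"
    using bars_span by simp
qed

end

section \<open>Uniqueness of bars\<close>

lemma exists_real_below:
  assumes "finite Y" "a < (r0::real)"
  shows "\<exists>r>a. r \<le> r0 \<and> (\<forall>y\<in>Y. a < y \<longrightarrow> r \<le> y)"
proof -
  let ?Y = "insert r0 {y\<in>Y. a < y}"
  have "a < Min ?Y" using assms by (subst Min_gr_iff) auto
  then show ?thesis using assms by (intro exI[of _ "Min ?Y"]) auto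
qed

lemma exists_ereal_above:
  assumes "finite Y"
  shows "\<exists>s>b. \<forall>y\<in>Y. ereal b < y \<longrightarrow> ereal s \<le> y"
proof -
  let ?Y = "insert \<infinity> {y\<in>Y. ereal b < y}"
  have "ereal b < Min ?Y" using assms by (subst Min_gr_iff) auto
  then obtain s where s: "b < s" "ereal s < Min ?Y" using ereal_dense2 by fastforce
  have "ereal s \<le> y" if "y \<in> Y" "ereal b < y" for y
    using s(2) Min_le[of ?Y y] that assms by (auto intro: less_imp_le less_le_trans)
  then show ?thesis using s by blast
qed

lemma exists_ereal_top:
  assumes "finite Y"
  shows "\<exists>s\<ge>t. \<forall>y\<in>Y. y < \<infinity> \<longrightarrow> y < ereal s"
proof -
  let ?Y = "insert (ereal t) {y\<in>Y. y < \<infinity>}"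
  have "Max ?Y < \<infinity>" using assms by (subst Max_less_iff) auto
  then obtain s where s: "Max ?Y < ereal s" using less_PInf_Ex_of_nat by auto
  have "y < ereal s" if "y \<in> ?Y" for y
    using Max_ge[of ?Y y] s that assms by (auto intro: le_less_trans)
  from this[of "ereal t"] this show ?thesis by (intro exI[of _ s]) auto
qed

lemma half_open_convex:
  assumes "r \<in> half_open a \<beta>" "t \<in> half_open a \<beta>" "r \<le> s" "s \<le> t"
  shows "s \<in> half_open a \<beta>"
  using assms order_trans[of "ereal s" "ereal t" \<beta>] unfolding half_open_def by auto

definition both :: "'i set \<Rightarrow> ('i \<Rightarrow> real set) \<Rightarrow> real \<Rightarrow> real \<Rightarrow> 'i set" where
  "both L J r s = {i\<in>L. r \<in> J i \<and> s \<in> J i}"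

text \<open>The bar \<open>(a, b]\<close> is alive at \<open>b\<close> and at \<open>r\<close>, just
  after its birth, but neither at \<open>a\<close> nor at \<open>s\<close>, just after its death.
  The candidates are the bars containing \<open>r0\<close> and \<open>b\<close>; when these are
  finitely many, \<open>r\<close> and \<open>s\<close> can be chosen with no birth strictly between
  \<open>a\<close> and \<open>r\<close> and no death strictly between \<open>b\<close> and
  \<open>s\<close>.\<close>

lemma bars_eq_half_open:
  assumes J: "\<And>i. i \<in> L \<Longrightarrow> J i = half_open (lo i) (hi i)"
    and ab: "a < r" "r \<le> r0" "r0 \<le> b" "b < s"
    and r: "\<And>i. i \<in> both L J r0 b \<Longrightarrow> a < lo i \<Longrightarrow> r \<le> lo i"
    and s: "\<And>i. i \<in> both L J r0 b \<Longrightarrow> ereal b < hi i \<Longrightarrow> ereal s \<le> hi i"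
  shows "{i\<in>L. J i = half_open a (ereal b)} = both L J r b - (both L J a b \<union> both L J r s)"
proof (intro equalityI subsetI)
  fix i assume "i \<in> {i\<in>L. J i = half_open a (ereal b)}"
  then show "i \<in> both L J r b - (both L J a b \<union> both L J r s)"
    using ab unfolding both_def by (auto simp: half_open_def)
next
  fix i assume i: "i \<in> both L J r b - (both L J a b \<union> both L J r s)"
  then have iL: "i \<in> L" and rb: "lo i < r" "ereal b \<le> hi i" unfolding both_def
    by (auto simp: J half_open_def)
  have i0: "i \<in> both L J r0 b"
    using iL rb ab unfolding both_def by (auto simp: J half_open_def intro: order_trans[of _ "ereal b"])
  have "a \<le> lo i"
  proof (rule ccontr)
    assume "\<not> a \<le> lo i"
    then have "a \<in> J i" using iL rb ab by (auto simp: J half_open_def intro: order_trans[of _ "ereal b"])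
    then show False using i unfolding both_def by auto
  qed
  moreover have "\<not> a < lo i" using r[OF i0] rb by auto
  moreover have "\<not> ereal b < hi i"
  proof
    assume "ereal b < hi i"
    then have "s \<in> J i" using s[OF i0] iL rb ab by (auto simp: J half_open_def)
    then show False using i unfolding both_def by auto
  qed
  ultimately have "lo i = a" "hi i = ereal b" using rb by auto
  then show "i \<in> {i\<in>L. J i = half_open a (ereal b)}" using iL J by auto
qed

text \<open>An immortal bar is recognised by a time \<open>s\<close> beyond all finite deaths of the
  candidates, the bars containing \<open>r0\<close> and \<open>s0\<close>.\<close>

lemma bars_eq_half_open_infinity:
  assumes J: "\<And>i. i \<in> L \<Longrightarrow> J i = half_open (lo i) (hi i)"
    and ab: "a < r" "r \<le> r0" "r0 < s0" "s0 \<le> s"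
    and r: "\<And>i. i \<in> both L J r0 s0 \<Longrightarrow> a < lo i \<Longrightarrow> r \<le> lo i"
    and s: "\<And>i. i \<in> both L J r0 s0 \<Longrightarrow> hi i < \<infinity> \<Longrightarrow> hi i < ereal s"
  shows "{i\<in>L. J i = half_open a \<infinity>} = both L J r s - both L J a s"
proof (intro equalityI subsetI)
  fix i assume "i \<in> {i\<in>L. J i = half_open a \<infinity>}"
  then show "i \<in> both L J r s - both L J a s"
    using ab unfolding both_def by (auto simp: half_open_def)
next
  fix i assume i: "i \<in> both L J r s - both L J a s"
  then have iL: "i \<in> L" and rb: "lo i < r" "ereal s \<le> hi i" unfolding both_def
    by (auto simp: J half_open_def)
  have i0: "i \<in> both L J r0 s0"
    using iL rb ab unfolding both_def by (auto simp: J half_open_def intro: order_trans[of _ "ereal s"])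
  have "a \<le> lo i"
  proof (rule ccontr)
    assume "\<not> a \<le> lo i"
    then have "a \<in> J i" using iL rb ab by (auto simp: J half_open_def intro: order_trans[of _ "ereal s"])
    then show False using i unfolding both_def by auto
  qed
  moreover have "\<not> a < lo i" using r[OF i0] rb by auto
  moreover have "hi i = \<infinity>" using s[OF i0] rb(2) by (meson ereal_infty_less(1) not_le)
  ultimately have "lo i = a" "hi i = \<infinity>" using rb by auto
  then show "i \<in> {i\<in>L. J i = half_open a \<infinity>}" using iL J by auto
qed

text \<open>Inclusion-exclusion in additive form, which avoids subtraction of natural
  numbers.\<close>

lemma card_Diff_Un:
  assumes "finite M" "A \<subseteq> M" "B \<subseteq> M"
  shows "card (M - (A \<union> B)) + card A + card B = card M + card (A \<inter> B)"
proof -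
  have f: "finite A" "finite B" using assms finite_subset by auto
  have "card (M - (A \<union> B)) + card (A \<union> B) = card M"
    using assms f by (metis Un_least card_Diff_subset card_mono finite_Un le_add_diff_inverse2)
  then show ?thesis using card_Un_Int[OF f] by simp
qed

text \<open>The multiplicity of an interval is an alternating sum of the common counts, so it is the
  same in both families; bijections between the fibres over the intervals are glued
  together.\<close>

lemma half_open_families_bij:
  fixes J :: "'i \<Rightarrow> real set" and J' :: "'j \<Rightarrow> real set"
  assumes J: "\<And>i. i \<in> L \<Longrightarrow> \<exists>a \<beta>. 0 \<le> a \<and> ereal a < \<beta> \<and> J i = half_open a \<beta>"
    and J': "\<And>j. j \<in> L' \<Longrightarrow> \<exists>a \<beta>. 0 \<le> a \<and> ereal a < \<beta> \<and> J' j = half_open a \<beta>"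
    and cnt: "\<And>r s. 0 < r \<Longrightarrow> r < s \<Longrightarrow> finite (both L J r s) \<and> finite (both L' J' r s) \<and>
      card (both L J r s) = card (both L' J' r s)"
  shows "\<exists>\<sigma>. bij_betw \<sigma> L L' \<and> (\<forall>i\<in>L. J' (\<sigma> i) = J i)"
proof -
  obtain lo hi where lh: "\<And>i. i \<in> L \<Longrightarrow> 0 \<le> lo i \<and> ereal (lo i) < hi i \<and> J i = half_open (lo i) (hi i)"
    using J by metis
  obtain lo' hi' where lh': "\<And>i. i \<in> L' \<Longrightarrow> 0 \<le> lo' i \<and> ereal (lo' i) < hi' i \<and> J' i = half_open (lo' i) (hi' i)"
    using J' by metis
  have J: "\<And>i. i \<in> L \<Longrightarrow> J i = half_open (lo i) (hi i)" using lh by blast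
  have J': "\<And>i. i \<in> L' \<Longrightarrow> J' i = half_open (lo' i) (hi' i)" using lh' by blast
  have conv: "s \<in> J i" if "i \<in> L" "r \<in> J i" "t \<in> J i" "r \<le> s" "s \<le> t" for i r s t
    using that half_open_convex unfolding J[OF that(1)] by blast
  have conv': "s \<in> J' i" if "i \<in> L'" "r \<in> J' i" "t \<in> J' i" "r \<le> s" "s \<le> t" for i r s t
    using that half_open_convex unfolding J'[OF that(1)] by blast
  \<comment> \<open>Extends the counts to times up to 0, which no bar contains, so that the left end
    \<open>a\<close> itself can be used as a time.\<close>
  have cnt: "finite (both L J r s) \<and> finite (both L' J' r s) \<and>
      card (both L J r s) = card (both L' J' r s)" if "r < s" for r s
  proof (cases "0 < r")
    case False
    then have "both L J r s = {}" "both L' J' r s = {}"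
      using lh lh' unfolding both_def by (fastforce simp: half_open_def)+
    then show ?thesis by simp
  qed (use cnt that in auto)
  let ?M = "\<lambda>K. {i\<in>L. J i = K}" and ?M' = "\<lambda>K. {j\<in>L'. J' j = K}"
  have main: "finite (?M K) \<and> finite (?M' K) \<and> card (?M K) = card (?M' K)"
    if K: "K = half_open a \<beta>" "ereal a < \<beta>" for K a \<beta>
  proof (cases \<beta>)
    case (real b)
    then have ab: "a < b" using K by simp
    \<comment> \<open>Any time strictly inside will do; \<open>r0 < b\<close> makes the set of
      candidates finite.\<close>
    define r0 where "r0 = (a + b) / 2"
    have r0: "a < r0" "r0 < b" unfolding r0_def using ab by auto
    have fin: "finite (both L J r0 b)" "finite (both L' J' r0 b)" using cnt[OF r0(2)] by auto
    obtain r where r: "a < r" "r \<le> r0"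
        "\<And>y. y \<in> lo ` both L J r0 b \<union> lo' ` both L' J' r0 b \<Longrightarrow> a < y \<Longrightarrow> r \<le> y"
      using exists_real_below[of "lo ` both L J r0 b \<union> lo' ` both L' J' r0 b", OF _ r0(1)] fin by auto
    obtain s where s: "b < s"
        "\<And>y. y \<in> hi ` both L J r0 b \<union> hi' ` both L' J' r0 b \<Longrightarrow> ereal b < y \<Longrightarrow> ereal s \<le> y"
      using exists_ereal_above[of "hi ` both L J r0 b \<union> hi' ` both L' J' r0 b" b] fin by auto
    have 1: "?M K = both L J r b - (both L J a b \<union> both L J r s)"
      unfolding K real by (rule bars_eq_half_open[OF J r(1,2) less_imp_le[OF r0(2)] s(1)]) (use r(3) s(2) in auto)
    have 2: "?M' K = both L' J' r b - (both L' J' a b \<union> both L' J' r s)"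
      unfolding K real by (rule bars_eq_half_open[OF J' r(1,2) less_imp_le[OF r0(2)] s(1)]) (use r(3) s(2) in auto)
    \<comment> \<open>By convexity the correction term of the inclusion-exclusion is again a count,
      from \<open>a\<close> to \<open>s\<close>.\<close>
    have sub: "both L J a b \<subseteq> both L J r b" "both L J r s \<subseteq> both L J r b"
        "both L J a b \<inter> both L J r s = both L J a s"
      using r r0 s unfolding both_def by (auto intro: conv)
    have sub': "both L' J' a b \<subseteq> both L' J' r b" "both L' J' r s \<subseteq> both L' J' r b"
        "both L' J' a b \<inter> both L' J' r s = both L' J' a s"
      using r r0 s unfolding both_def by (auto intro: conv')
    have lt: "r < b" "a < b" "r < s" "a < s" using r r0 s by auto
    note c = cnt[OF lt(1)] cnt[OF lt(2)] cnt[OF lt(3)] cnt[OF lt(4)]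
    show ?thesis
      using card_Diff_Un[of "both L J r b", OF _ sub(1,2)] card_Diff_Un[of "both L' J' r b", OF _ sub'(1,2)] c
      unfolding 1 2 sub(3) sub'(3) by auto
  next
    case PInf
    \<comment> \<open>Two arbitrary times after \<open>a\<close>, distinct so that only finitely
      many bars contain both.\<close>
    define r0 s0 where "r0 = a + 1" "s0 = a + 2"
    have r0: "a < r0" "r0 < s0" unfolding r0_s0_def by auto
    have fin: "finite (both L J r0 s0)" "finite (both L' J' r0 s0)" using cnt[OF r0(2)] by auto
    obtain r where r: "a < r" "r \<le> r0"
        "\<And>y. y \<in> lo ` both L J r0 s0 \<union> lo' ` both L' J' r0 s0 \<Longrightarrow> a < y \<Longrightarrow> r \<le> y"
      using exists_real_below[of "lo ` both L J r0 s0 \<union> lo' ` both L' J' r0 s0", OF _ r0(1)] fin by auto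
    obtain s where s: "s0 \<le> s"
        "\<And>y. y \<in> hi ` both L J r0 s0 \<union> hi' ` both L' J' r0 s0 \<Longrightarrow> y < \<infinity> \<Longrightarrow> y < ereal s"
      using exists_ereal_top[of "hi ` both L J r0 s0 \<union> hi' ` both L' J' r0 s0" s0] fin by auto
    have 1: "?M K = both L J r s - both L J a s"
      unfolding K PInf by (rule bars_eq_half_open_infinity[OF J r(1,2) r0(2) s(1)]) (use r(3) s(2) in auto)
    have 2: "?M' K = both L' J' r s - both L' J' a s"
      unfolding K PInf by (rule bars_eq_half_open_infinity[OF J' r(1,2) r0(2) s(1)]) (use r(3) s(2) in auto)
    have lt: "r < s" "a < s" using r r0 s by auto
    have sub: "both L J a s \<subseteq> both L J r s"
      using r lt unfolding both_def by (auto intro: conv)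
    have sub': "both L' J' a s \<subseteq> both L' J' r s"
      using r lt unfolding both_def by (auto intro: conv')
    show ?thesis
      using cnt[OF lt(1)] cnt[OF lt(2)] card_Diff_subset[OF _ sub] card_Diff_subset[OF _ sub']
      unfolding 1 2 by auto
  qed (use K in auto)
  have "\<exists>h. bij_betw h (?M K) (?M' K)" for K
  proof (cases "\<exists>a \<beta>. ereal a < \<beta> \<and> K = half_open a \<beta>")
    case True
    then show ?thesis using main finite_same_card_bij by blast
  next
    case False
    then have "?M K = {}" "?M' K = {}" using lh lh' by blast+
    then show ?thesis using finite_same_card_bij[of "?M K" "?M' K"] by (metis card.empty finite.emptyI)
  qed
  then obtain h where h: "\<And>K. bij_betw (h K) (?M K) (?M' K)" by metis
  have hJ: "h (J i) i \<in> L' \<and> J' (h (J i) i) = J i" if "i \<in> L" for i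
    using bij_betwE[OF h[of "J i"]] that by auto
  have "bij_betw (\<lambda>i. h (J i) i) L L'"
    unfolding bij_betw_def
  proof (intro conjI equalityI subsetI)
    show "inj_on (\<lambda>i. h (J i) i) L"
    proof (rule inj_onI)
      fix i j assume ij: "i \<in> L" "j \<in> L" "h (J i) i = h (J j) j"
      then have "J i = J j" using hJ by metis
      then show "i = j" using ij bij_betw_imp_inj_on[OF h[of "J i"]] by (auto dest: inj_onD)
    qed
    fix j assume j: "j \<in> L'"
    then have "j \<in> h (J' j) ` ?M (J' j)" using bij_betw_imp_surj_on[OF h[of "J' j"]] by auto
    then obtain i where "i \<in> L" "J i = J' j" "j = h (J' j) i" by auto
    then show "j \<in> (\<lambda>i. h (J i) i) ` L" by (intro image_eqI[of _ _ i]) auto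
  qed (use hJ in auto)
  then show ?thesis using hJ by blast
qed

section \<open>Counting bars by ranks, and the shape of their intervals\<close>

context filtered_quotient
begin

lemma adapted_bars_interval: "adapted_bars L J c \<Longrightarrow> i \<in> L \<Longrightarrow> is_interval_in {0<..} (J i)"
  and adapted_bars_Z: "adapted_bars L J c \<Longrightarrow> i \<in> L \<Longrightarrow> t \<in> J i \<Longrightarrow> c i t \<in> Z t"
  and adapted_bars_alive: "adapted_bars L J c \<Longrightarrow> i \<in> L \<Longrightarrow> s \<in> J i \<Longrightarrow> t \<in> J i \<Longrightarrow> s \<le> t \<Longrightarrow>
    c i s - c i t \<in> B t"
  and adapted_bars_dead: "adapted_bars L J c \<Longrightarrow> i \<in> L \<Longrightarrow> s \<in> J i \<Longrightarrow> t \<notin> J i \<Longrightarrow> s \<le> t \<Longrightarrow>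
    c i s \<in> B t"
  unfolding adapted_bars_def by meson+

lemma adapted_bars_indep:
  assumes "adapted_bars L J c" "t > 0" "finite S" "S \<subseteq> {i\<in>L. t \<in> J i}"
    "(\<Sum>i\<in>S. scale (k i) (c i t)) \<in> B t" "i \<in> S"
  shows "k i = 0"
  using assms unfolding adapted_bars_def by simp

lemma adapted_bars_span:
  assumes "adapted_bars L J c" "t > 0" "z \<in> Z t"
  obtains S k where "finite S" "S \<subseteq> {i\<in>L. t \<in> J i}" "z - (\<Sum>i\<in>S. scale (k i) (c i t)) \<in> B t"
  using assms unfolding adapted_bars_def by meson

text \<open>The dimension of \<open>Z r\<close> modulo \<open>B s\<close>; it does not depend on the map chosen by \<open>SOME\<close>.\<close>

definition rank :: "real \<Rightarrow> real \<Rightarrow> nat" where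
  "rank r s = dim ((SOME p. Vector_Spaces.linear scale scale p \<and> (\<forall>x. p x = 0 \<longleftrightarrow> x \<in> B s)) ` Z r)"

lemma adapted_bars_pos: "adapted_bars L J c \<Longrightarrow> i \<in> L \<Longrightarrow> t \<in> J i \<Longrightarrow> 0 < t"
  using adapted_bars_interval[of L J c i] unfolding is_interval_in_def by auto

text \<open>The generators of the bars alive at both times form a basis of \<open>Z r\<close> modulo
  \<open>B s\<close>: those alive at \<open>r\<close> span it, and among these the ones dead at
  \<open>s\<close> contribute zero. The rank does not refer to the barcode, which is what uniqueness
  rests on.\<close>

lemma card_both_eq_rank:
  assumes ad: "adapted_bars L J c" and rs: "0 < r" "r < s"
  shows "finite (both L J r s) \<and> card (both L J r s) = rank r s"
proof -
  define p where "p = (SOME p. Vector_Spaces.linear scale scale p \<and> (\<forall>x. p x = 0 \<longleftrightarrow> x \<in> B s))"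
  have p: "Vector_Spaces.linear scale scale p \<and> (\<forall>x. p x = 0 \<longleftrightarrow> x \<in> B s)"
    unfolding p_def by (rule someI_ex[OF exists_linear_with_kernel[OF subspace_B]])
  interpret p: Vector_Spaces.linear scale scale p using p by blast
  have p0: "p x = 0 \<longleftrightarrow> x \<in> B s" for x using p by blast
  have pB: "p x = p y" if "x - y \<in> B s" for x y using p0[of "x - y"] that by (simp add: p.diff)
  let ?A = "both L J r s"
  let ?f = "\<lambda>i. p (c i s)"
  have indep: "k i = 0" if "finite S" "S \<subseteq> ?A" "(\<Sum>i\<in>S. scale (k i) (?f i)) = 0" "i \<in> S" for S k i
  proof (rule adapted_bars_indep[OF ad _ that(1) _ _ that(4)])
    show "(\<Sum>i\<in>S. scale (k i) (c i s)) \<in> B s"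
      using that(3) p0[of "\<Sum>i\<in>S. scale (k i) (c i s)"] by (simp add: p.sum p.scale)
  qed (use that rs in \<open>auto simp: both_def\<close>)
  \<comment> \<open>Two bars with the same class at \<open>s\<close> would satisfy the relation with
    coefficients 1 and -1.\<close>
  have inj: "inj_on ?f ?A"
  proof (rule inj_onI, rule ccontr)
    fix i j assume ij: "i \<in> ?A" "j \<in> ?A" "?f i = ?f j" "i \<noteq> j"
    have "(if i = i then 1 else - 1) = (0::'f)"
      by (rule indep[of "{i, j}" "\<lambda>x. if x = i then 1 else - 1"]) (use ij in auto)
    then show False by simp
  qed
  have ind: "independent (?f ` ?A)"
    unfolding independent_explicit_module
  proof (intro allI impI)
    fix T u v assume T: "finite T" "T \<subseteq> ?f ` ?A" "(\<Sum>v\<in>T. scale (u v) v) = 0" "v \<in> T"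
    obtain S where S: "S \<subseteq> ?A" "inj_on ?f S" "T = ?f ` S" using T(2) by (auto simp: subset_image_inj)
    have "finite S" using S T finite_imageD by blast
    moreover have "(\<Sum>i\<in>S. scale (u (?f i)) (?f i)) = 0" using T(3) S by (simp add: sum.reindex)
    ultimately have "u (?f i) = 0" if "i \<in> S" for i
      using indep[of S "\<lambda>i. u (?f i)" i] S that by blast
    then show "u v = 0" using T(4) S by auto
  qed
  have f_r: "?f i = p (c i r)" if "i \<in> ?A" for i
    using pB[OF adapted_bars_alive[OF ad, of i r s]] that rs unfolding both_def by auto
  have sub: "?f ` ?A \<subseteq> p ` Z r"
    using f_r adapted_bars_Z[OF ad] unfolding both_def by auto
  have span: "p ` Z r \<subseteq> span (?f ` ?A)"
  proof
    fix w assume "w \<in> p ` Z r"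
    then obtain z where z: "z \<in> Z r" "w = p z" by blast
    obtain S k where S: "finite S" "S \<subseteq> {i\<in>L. r \<in> J i}" "z - (\<Sum>i\<in>S. scale (k i) (c i r)) \<in> B r"
      by (rule adapted_bars_span[OF ad rs(1) z(1)])
    have "z - (\<Sum>i\<in>S. scale (k i) (c i r)) \<in> B s" using S(3) B_mono[of r s] rs by auto
    then have "w = (\<Sum>i\<in>S. scale (k i) (p (c i r)))" using pB z by (simp add: p.sum p.scale)
    moreover have "p (c i r) \<in> span (?f ` ?A)" if "i \<in> S" for i
    proof (cases "s \<in> J i")
      case True
      then have "i \<in> ?A" using that S unfolding both_def by auto
      then show ?thesis using f_r by (auto intro: span_base)
    next
      case False
      then have "p (c i r) = 0"
        using adapted_bars_dead[OF ad, of i r s] that S rs p0 by auto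
      then show ?thesis by (simp add: span_zero)
    qed
    ultimately show "w \<in> span (?f ` ?A)" by (auto intro: span_sum span_scale)
  qed
  obtain F where F: "finite F" "\<forall>z\<in>Z r. \<exists>f\<in>span F. z - f \<in> B s" using tame[OF rs(2)] by blast
  have "p ` Z r \<subseteq> span (p ` F)"
  proof
    fix w assume "w \<in> p ` Z r"
    then obtain z where z: "z \<in> Z r" "w = p z" by blast
    then obtain f where f: "f \<in> span F" "z - f \<in> B s" using F by blast
    then show "w \<in> span (p ` F)" using z pB[OF f(2)] by (simp add: p.span_image)
  qed
  then have "finite (?f ` ?A)"
    using independent_span_bound[of "p ` F", OF _ ind] sub F by auto
  then have "finite ?A" using inj by (rule finite_imageD)
  moreover have "card ?A = dim (p ` Z r)"
    using basis_card_eq_dim[OF sub span ind] card_image[OF inj] by simp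
  ultimately show ?thesis unfolding rank_def p_def[symmetric] by simp
qed

text \<open>The generator at \<open>t\<close> comes from an earlier time \<open>s\<close>. The bar
  itself must occur in its expansion at \<open>s\<close>, since otherwise its generator would at
  time \<open>t\<close> be a combination of those of other bars.\<close>

lemma adapted_bars_open_left:
  assumes ad: "adapted_bars L J c" and i: "i \<in> L" "t \<in> J i"
  shows "\<exists>s<t. s \<in> J i"
proof -
  have t: "0 < t" using adapted_bars_pos[OF ad i] .
  obtain s' where s': "s' < t" "c i t \<in> Z s'" using Z_left[OF adapted_bars_Z[OF ad i]] by blast
  \<comment> \<open>The bars are known to span at positive times only, hence the maximum with
    \<open>t / 2\<close>.\<close>
  define s where "s = max s' (t / 2)"
  have s: "0 < s" "s < t" "s' \<le> s" unfolding s_def using t s' by auto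
  have "c i t \<in> Z s" using s' Z_mono[OF s(3)] by auto
  then obtain S k where S: "finite S" "S \<subseteq> {i\<in>L. s \<in> J i}" "c i t - (\<Sum>j\<in>S. scale (k j) (c j s)) \<in> B s"
    by (rule adapted_bars_span[OF ad s(1)])
  have "i \<in> S"
  proof (rule ccontr)
    assume iS: "i \<notin> S"
    define S' where "S' = {j\<in>S. t \<in> J j}"
    have "(\<Sum>j\<in>S. scale (k j) (c j s)) - (\<Sum>j\<in>S. if t \<in> J j then scale (k j) (c j t) else 0) \<in> B t"
      unfolding sum_subtractf[symmetric]
    proof (intro B_simps(6))
      fix j assume "j \<in> S"
      then have j: "j \<in> L" "s \<in> J j" using S by auto
      show "scale (k j) (c j s) - (if t \<in> J j then scale (k j) (c j t) else 0) \<in> B t"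
        using adapted_bars_alive[OF ad j(1,2), of t] adapted_bars_dead[OF ad j(1,2), of t] s B_simps(5)
        by (auto simp flip: scale_right_diff_distrib)
    qed
    moreover have "(\<Sum>j\<in>S. if t \<in> J j then scale (k j) (c j t) else 0) = (\<Sum>j\<in>S'. scale (k j) (c j t))"
      unfolding S'_def using S(1) by (simp add: sum.inter_filter)
    ultimately have "c i t - (\<Sum>j\<in>S'. scale (k j) (c j t)) \<in> B t"
      using S(3) B_mono[of s t] s B_trans by (metis less_imp_le subsetD)
    moreover have "i \<notin> S'" "finite S'" unfolding S'_def using iS S by auto
    moreover have "(\<Sum>j\<in>S'. scale (if j = i then 1 else - k j) (c j t)) = - (\<Sum>j\<in>S'. scale (k j) (c j t))"
      unfolding sum_negf[symmetric] using \<open>i \<notin> S'\<close> by (intro sum.cong) auto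
    ultimately have "(\<Sum>j\<in>insert i S'. scale (if j = i then 1 else - k j) (c j t)) \<in> B t"
      by simp
    moreover have "insert i S' \<subseteq> {i\<in>L. t \<in> J i}" unfolding S'_def using S i by auto
    ultimately have "(if i = i then 1 else - k i) = 0"
      using adapted_bars_indep[OF ad t, of "insert i S'" "\<lambda>j. if j = i then 1 else - k j" i] \<open>finite S'\<close>
      by simp
    then show False by simp
  qed
  then show ?thesis using S s by auto
qed

text \<open>A generator that is dead at \<open>t\<close> is dead slightly earlier by left
  continuity, and the bar cannot contain a time at which its generator is zero.\<close>

lemma adapted_bars_closed_right:
  assumes ad: "adapted_bars L J c" and i: "i \<in> L" "s \<in> J i" and t: "t \<notin> J i" "s \<le> t"
  shows "\<exists>u. s \<le> u \<and> u < t \<and> u \<notin> J i"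
proof -
  have "s \<noteq> t" using i t by auto
  obtain u' where u': "u' < t" "c i s \<in> B u'" using B_left[OF adapted_bars_dead[OF ad i t]] by blast
  define u where "u = max s u'"
  have u: "s \<le> u" "u < t" "c i s \<in> B u" unfolding u_def using u' t \<open>s \<noteq> t\<close> B_mono[of u' "max s u'"] by auto
  have "u \<notin> J i"
  proof
    assume uJ: "u \<in> J i"
    then have "c i u \<in> B u" using adapted_bars_alive[OF ad i uJ u(1)] u(3) B_cong by blast
    then have "(\<Sum>j\<in>{i}. scale 1 (c j u)) \<in> B u" by simp
    then have "(1::'f) = 0"
      using adapted_bars_indep[OF ad adapted_bars_pos[OF ad i(1) uJ], of "{i}" "\<lambda>_. 1" i] uJ i by simp
    then show False by simp
  qed
  then show ?thesis using u by blast
qed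

text \<open>For a convex set of positive times, the two preceding properties leave only this
  shape.\<close>

lemma adapted_bars_half_open:
  assumes ad: "adapted_bars L J c" and i: "i \<in> L"
  shows "\<exists>a \<beta>. 0 \<le> a \<and> ereal a < \<beta> \<and> J i = half_open a \<beta>"
proof -
  note int = adapted_bars_interval[OF ad i]
  obtain t where t: "t \<in> J i" using int unfolding is_interval_in_def by auto
  have pos: "0 < s" if "s \<in> J i" for s using adapted_bars_pos[OF ad i that] .
  have conv: "s \<in> J i" if "r \<in> J i" "r \<le> s" "s \<le> u" "u \<in> J i" for r s u
  proof -
    have "s \<in> {0<..}" using pos[OF that(1)] that(2) by simp
    then show ?thesis using int that unfolding is_interval_in_def by meson
  qed
  have bdd: "bdd_below (J i)" using pos by (meson bdd_belowI less_imp_le)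
  define a where "a = Inf (J i)"
  define \<beta> where "\<beta> = (SUP s\<in>J i. ereal s)"
  have a_less: "a < s" if "s \<in> J i" for s
  proof -
    obtain r where "r < s" "r \<in> J i" using adapted_bars_open_left[OF ad i \<open>s \<in> J i\<close>] by blast
    then show ?thesis unfolding a_def using cInf_lower[OF _ bdd, of r] by simp
  qed
  have "0 \<le> a" unfolding a_def using t pos by (intro cInf_greatest) (auto intro: less_imp_le)
  moreover have "ereal a < \<beta>"
    unfolding \<beta>_def using less_SUP_iff[of "ereal a" ereal "J i"] a_less[OF t] t by auto
  moreover have "J i = half_open a \<beta>"
  proof (intro equalityI subsetI)
    fix s assume s: "s \<in> J i"
    then show "s \<in> half_open a \<beta>" unfolding half_open_def \<beta>_def using a_less SUP_upper[OF s] by auto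
  next
    fix s assume "s \<in> half_open a \<beta>"
    then have s: "a < s" "ereal s \<le> \<beta>" unfolding half_open_def by auto
    show "s \<in> J i"
    proof (rule ccontr)
      assume nJ: "s \<notin> J i"
      obtain r where r: "r \<in> J i" "r < s" using cInf_lessD[of "J i" s] s t unfolding a_def by blast
      obtain u where u: "r \<le> u" "u < s" "u \<notin> J i"
        using adapted_bars_closed_right[OF ad i r(1) nJ] r by auto
      \<comment> \<open>By convexity the missing time \<open>u\<close> bounds the whole bar, against
        \<open>ereal s \<le> \<beta>\<close>.\<close>
      have "v \<le> u" if "v \<in> J i" for v
        using conv[OF r(1) u(1) _ that] u(3) by (meson linear)
      then have "\<beta> \<le> ereal u" unfolding \<beta>_def by (intro SUP_least) auto
      then have "ereal s \<le> ereal u" using s(2) order_trans by blast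
      then show False using u by simp
    qed
  qed
  ultimately show ?thesis by blast
qed

theorem adapted_bars_unique:
  assumes "adapted_bars L J c" "adapted_bars L' J' c'"
  shows "\<exists>\<sigma>. bij_betw \<sigma> L L' \<and> (\<forall>i\<in>L. J' (\<sigma> i) = J i)"
proof (rule half_open_families_bij)
  show "finite (both L J r s) \<and> finite (both L' J' r s) \<and> card (both L J r s) = card (both L' J' r s)"
    if "0 < r" "r < s" for r s
    using card_both_eq_rank[OF assms(1) that] card_both_eq_rank[OF assms(2) that] by simp
qed (use adapted_bars_half_open[OF assms(1)] adapted_bars_half_open[OF assms(2)] in blast)+

lemma adapted_bars_reindex:
  assumes ad: "adapted_bars L J c" and h: "bij_betw h L' L"
  shows "adapted_bars L' (\<lambda>i. J (h i)) (\<lambda>i. c (h i))"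
proof -
  have hL: "h i \<in> L" if "i \<in> L'" for i using bij_betwE[OF h] that by blast
  have inj: "inj_on h L'" and sur: "h ` L' = L" using h by (auto simp: bij_betw_def)
  have indep: "k i = 0" if t: "t > 0" and S: "finite S" "S \<subseteq> {i\<in>L'. t \<in> J (h i)}"
    and sum: "(\<Sum>i\<in>S. scale (k i) (c (h i) t)) \<in> B t" and i: "i \<in> S" for t S k i
  proof -
    have injS: "inj_on h S" using inj S(2) by (auto intro: inj_on_subset)
    let ?k = "\<lambda>j. k (inv_into S h j)"
    have "(\<Sum>j\<in>h ` S. scale (?k j) (c j t)) = (\<Sum>i\<in>S. scale (k i) (c (h i) t))"
      using injS by (simp add: sum.reindex)
    moreover have "h ` S \<subseteq> {i\<in>L. t \<in> J i}" using S(2) hL by auto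
    ultimately have "?k (h i) = 0"
      using adapted_bars_indep[OF ad t, of "h ` S" ?k "h i"] S(1) sum i by simp
    then show ?thesis using i injS by simp
  qed
  have span: "\<exists>S k. finite S \<and> S \<subseteq> {i\<in>L'. t \<in> J (h i)} \<and> z - (\<Sum>i\<in>S. scale (k i) (c (h i) t)) \<in> B t"
    if t: "t > 0" and z: "z \<in> Z t" for t z
  proof -
    obtain S k where S: "finite S" "S \<subseteq> {i\<in>L. t \<in> J i}" "z - (\<Sum>i\<in>S. scale (k i) (c i t)) \<in> B t"
      by (rule adapted_bars_span[OF ad t z])
    have "S \<subseteq> h ` L'" using S(2) sur by blast
    then obtain S' where S': "S' \<subseteq> L'" "inj_on h S'" "S = h ` S'" by (auto simp: subset_image_inj)
    have "finite S'" using S' S finite_imageD by blast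
    moreover have "S' \<subseteq> {i\<in>L'. t \<in> J (h i)}" using S S' by auto
    moreover have "z - (\<Sum>i\<in>S'. scale (k (h i)) (c (h i) t)) \<in> B t"
      using S(3) S' by (simp add: sum.reindex)
    ultimately show ?thesis by (intro exI[of _ S'] exI[of _ "\<lambda>i. k (h i)"]) auto
  qed
  show ?thesis
    unfolding adapted_bars_def
    using adapted_bars_interval[OF ad] adapted_bars_Z[OF ad] adapted_bars_alive[OF ad]
      adapted_bars_dead[OF ad] hL indep span by simp
qed

text \<open>A bar is renamed by one of its times and the class of its generator there. Two bars with
  the same name would have congruent generators at a common time, against independence.\<close>

theorem adapted_bars_small_index:
  assumes ad: "adapted_bars L J c"
  shows "\<exists>(L' :: (real \<times> 'v set) set) J' c'. adapted_bars L' J' c'"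
proof -
  have "\<exists>r. r \<in> J i" if "i \<in> L" for i
    using adapted_bars_interval[OF ad that] unfolding is_interval_in_def by auto
  then obtain r where r: "\<And>i. i \<in> L \<Longrightarrow> r i \<in> J i" by metis
  let ?g = "\<lambda>i. (r i, {x. x - c i (r i) \<in> B (r i)})"
  have "inj_on ?g L"
  proof (rule inj_onI, rule ccontr)
    fix i j assume ij: "i \<in> L" "j \<in> L" "?g i = ?g j" "i \<noteq> j"
    then have rij: "r j = r i" and
      eq: "{x. x - c i (r i) \<in> B (r i)} = {x. x - c j (r j) \<in> B (r j)}" by auto
    have "c i (r i) \<in> {x. x - c i (r i) \<in> B (r i)}" using B_simps(1) by simp
    then have *: "c i (r i) - c j (r i) \<in> B (r i)" unfolding eq using rij by simp
    let ?k = "\<lambda>x. if x = i then 1 else - 1 :: 'f"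
    have "?k i = 0"
    proof (rule adapted_bars_indep[OF ad, of "r i" "{i, j}" ?k])
      show "0 < r i" using adapted_bars_pos[OF ad ij(1) r[OF ij(1)]] .
      show "{i, j} \<subseteq> {ia \<in> L. r i \<in> J ia}" using rij r[OF ij(1)] r[OF ij(2)] ij(1,2) by simp
      show "(\<Sum>x\<in>{i, j}. scale (?k x) (c x (r i))) \<in> B (r i)" using * ij(4) by simp
    qed auto
    then show False by simp
  qed
  then have "bij_betw ?g L (?g ` L)" by (simp add: bij_betw_def)
  then obtain h where "bij_betw h (?g ` L) L" using bij_betw_inv by blast
  from adapted_bars_reindex[OF ad this] show ?thesis by blast
qed

end

section \<open>Barcodes as families of representatives\<close>

lemma carrier_ring_of_type: "carrier (ring_of_type_algebra :: 'f::field ring) = UNIV"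
  by (simp add: ring_of_type_algebra_def)

lemma vect_spaceI:
  assumes "\<And>x y. x \<in> carrier V \<Longrightarrow> y \<in> carrier V \<Longrightarrow> x \<oplus>\<^bsub>V\<^esub> y \<in> carrier V"
    and "\<zero>\<^bsub>V\<^esub> \<in> carrier V"
    and "\<And>x y z. x \<in> carrier V \<Longrightarrow> y \<in> carrier V \<Longrightarrow> z \<in> carrier V \<Longrightarrow>
      (x \<oplus>\<^bsub>V\<^esub> y) \<oplus>\<^bsub>V\<^esub> z = x \<oplus>\<^bsub>V\<^esub> (y \<oplus>\<^bsub>V\<^esub> z)"
    and "\<And>x y. x \<in> carrier V \<Longrightarrow> y \<in> carrier V \<Longrightarrow> x \<oplus>\<^bsub>V\<^esub> y = y \<oplus>\<^bsub>V\<^esub> x"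
    and "\<And>x. x \<in> carrier V \<Longrightarrow> \<zero>\<^bsub>V\<^esub> \<oplus>\<^bsub>V\<^esub> x = x"
    and "\<And>x. x \<in> carrier V \<Longrightarrow> \<exists>y\<in>carrier V. y \<oplus>\<^bsub>V\<^esub> x = \<zero>\<^bsub>V\<^esub>"
    and "\<And>a x. x \<in> carrier V \<Longrightarrow> a \<odot>\<^bsub>V\<^esub> x \<in> carrier V"
    and "\<And>a b x. x \<in> carrier V \<Longrightarrow> (a + b) \<odot>\<^bsub>V\<^esub> x = (a \<odot>\<^bsub>V\<^esub> x) \<oplus>\<^bsub>V\<^esub> (b \<odot>\<^bsub>V\<^esub> x)"
    and "\<And>a x y. x \<in> carrier V \<Longrightarrow> y \<in> carrier V \<Longrightarrow>
      a \<odot>\<^bsub>V\<^esub> (x \<oplus>\<^bsub>V\<^esub> y) = (a \<odot>\<^bsub>V\<^esub> x) \<oplus>\<^bsub>V\<^esub> (a \<odot>\<^bsub>V\<^esub> y)"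
    and "\<And>a b x. x \<in> carrier V \<Longrightarrow> (a * b) \<odot>\<^bsub>V\<^esub> x = a \<odot>\<^bsub>V\<^esub> (b \<odot>\<^bsub>V\<^esub> x)"
    and "\<And>x. x \<in> carrier V \<Longrightarrow> 1 \<odot>\<^bsub>V\<^esub> x = x"
  shows "vect_space V"
  unfolding vect_space_def
  by (intro Module.moduleI abelian_groupI cring_from_type_algebra)
    (use assms in \<open>simp_all add: ring_of_type_algebra_def\<close>)

lemma vect_space_closed:
  assumes "vect_space V"
  shows "x \<in> carrier V \<Longrightarrow> y \<in> carrier V \<Longrightarrow> x \<oplus>\<^bsub>V\<^esub> y \<in> carrier V"
    and "x \<in> carrier V \<Longrightarrow> a \<odot>\<^bsub>V\<^esub> x \<in> carrier V"
proof -
  interpret Module.module "ring_of_type_algebra" V using assms unfolding vect_space_def .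
  show "x \<in> carrier V \<Longrightarrow> y \<in> carrier V \<Longrightarrow> x \<oplus>\<^bsub>V\<^esub> y \<in> carrier V" by (rule M.a_closed)
  show "x \<in> carrier V \<Longrightarrow> a \<odot>\<^bsub>V\<^esub> x \<in> carrier V" by (rule smult_closed) (auto simp: carrier_ring_of_type)
qed

lemma linear_mapsD:
  assumes "h \<in> linear_maps V W"
  shows "x \<in> carrier V \<Longrightarrow> h x \<in> carrier W"
    and "x \<in> carrier V \<Longrightarrow> y \<in> carrier V \<Longrightarrow> h (x \<oplus>\<^bsub>V\<^esub> y) = h x \<oplus>\<^bsub>W\<^esub> h y"
    and "x \<in> carrier V \<Longrightarrow> h (a \<odot>\<^bsub>V\<^esub> x) = a \<odot>\<^bsub>W\<^esub> h x"
  using assms unfolding linear_maps_def by auto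

lemma linear_maps_inverse:
  assumes V: "vect_space V" and h: "h \<in> linear_maps V W" and bij: "bij_betw h (carrier V) (carrier W)"
  shows "inv_into (carrier V) h \<in> linear_maps W V"
proof -
  let ?g = "inv_into (carrier V) h"
  have g: "?g y \<in> carrier V" "h (?g y) = y" if "y \<in> carrier W" for y
    using bij that by (auto simp: bij_betw_def inv_into_into f_inv_into_f)
  have gh: "?g (h x) = x" if "x \<in> carrier V" for x
    using bij that by (auto simp: bij_betw_def)
  have "?g (x \<oplus>\<^bsub>W\<^esub> y) = ?g x \<oplus>\<^bsub>V\<^esub> ?g y" if "x \<in> carrier W" "y \<in> carrier W" for x y
    using gh[of "?g x \<oplus>\<^bsub>V\<^esub> ?g y"] linear_mapsD(2)[OF h, of "?g x" "?g y"] g that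
      vect_space_closed(1)[OF V, of "?g x" "?g y"] by simp
  moreover have "?g (a \<odot>\<^bsub>W\<^esub> x) = a \<odot>\<^bsub>V\<^esub> ?g x" if "x \<in> carrier W" for x a
    using gh[of "a \<odot>\<^bsub>V\<^esub> ?g x"] linear_mapsD(3)[OF h, of "?g x" a] g that
      vect_space_closed(2)[OF V, of "?g x" a] by simp
  ultimately show ?thesis using g(1) unfolding linear_maps_def by auto
qed

lemma pmodule_iso_sym:
  assumes "pmodule_iso T P Q"
  shows "pmodule_iso T Q P"
proof -
  obtain \<phi> where \<phi>: "\<And>t. t \<in> T \<Longrightarrow> \<phi> t \<in> linear_maps (pspace P t) (pspace Q t)"
      "\<And>t. t \<in> T \<Longrightarrow> bij_betw (\<phi> t) (carrier (pspace P t)) (carrier (pspace Q t))"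
    and nat: "\<And>s t x. s \<in> T \<Longrightarrow> t \<in> T \<Longrightarrow> s \<le> t \<Longrightarrow> x \<in> carrier (pspace P s) \<Longrightarrow>
      \<phi> t (pmap P s t x) = pmap Q s t (\<phi> s x)"
    and P: "persistence_module T P" and Q: "persistence_module T Q"
    using assms unfolding pmodule_iso_def by blast
  let ?\<psi> = "\<lambda>t. inv_into (carrier (pspace P t)) (\<phi> t)"
  have "?\<psi> t (pmap Q s t y) = pmap P s t (?\<psi> s y)"
    if st: "s \<in> T" "t \<in> T" "s \<le> t" and y: "y \<in> carrier (pspace Q s)" for s t y
  proof -
    let ?x = "?\<psi> s y"
    have x: "?x \<in> carrier (pspace P s)" "\<phi> s ?x = y"
      using \<phi>(2)[OF st(1)] y by (auto simp: bij_betw_def inv_into_into f_inv_into_f)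
    have "pmap P s t \<in> linear_maps (pspace P s) (pspace P t)"
      using P st unfolding persistence_module_def by blast
    then have "pmap P s t ?x \<in> carrier (pspace P t)" using x(1) by (rule linear_mapsD(1))
    then have "?\<psi> t (\<phi> t (pmap P s t ?x)) = pmap P s t ?x"
      using \<phi>(2)[OF st(2)] by (auto simp: bij_betw_def)
    then show ?thesis using nat[OF st x(1)] x(2) by simp
  qed
  moreover have "?\<psi> t \<in> linear_maps (pspace Q t) (pspace P t)" if "t \<in> T" for t
    using linear_maps_inverse[OF _ \<phi>[OF that]] P that unfolding persistence_module_def by blast
  moreover have "bij_betw (?\<psi> t) (carrier (pspace Q t)) (carrier (pspace P t))" if "t \<in> T" for t
    using bij_betw_inv_into[OF \<phi>(2)[OF that]] .
  ultimately show ?thesis unfolding pmodule_iso_def using P Q by (intro conjI exI[of _ ?\<psi>]) auto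
qed

abbreviation bars_module :: "'i set \<Rightarrow> ('i \<Rightarrow> real set) \<Rightarrow> ('f::field, 'i \<Rightarrow> 'f) pmodule" where
  "bars_module L J \<equiv> pmodule_sum L (\<lambda>i. interval_module (J i))"

text \<open>The coordinate of a dead bar ranges over \<open>{0}\<close>, so being alive becomes a
  condition on the support.\<close>

lemma carrier_bars:
  "x \<in> carrier (pspace (bars_module L J) t) \<longleftrightarrow>
    x \<in> extensional L \<and> finite {i\<in>L. x i \<noteq> 0} \<and> {i\<in>L. x i \<noteq> 0} \<subseteq> {i\<in>L. t \<in> J i}"
  unfolding pmodule_sum_def direct_sum_def interval_module_def
  by (auto simp: PiE_def Pi_def split: if_splits)

lemma bars_ops:
  "x \<oplus>\<^bsub>pspace (bars_module L J) t\<^esub> y = (\<lambda>i\<in>L. x i + y i)"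
  "a \<odot>\<^bsub>pspace (bars_module L J) t\<^esub> x = (\<lambda>i\<in>L. a * x i)"
  "\<zero>\<^bsub>pspace (bars_module L J) t\<^esub> = (\<lambda>i\<in>L. 0)"
  "pmap (bars_module L J) s t x = (\<lambda>i\<in>L. if s \<in> J i \<and> t \<in> J i then x i else 0)"
  unfolding pmodule_sum_def direct_sum_def interval_module_def by (auto cong: restrict_cong)

lemma bars_closed:
  assumes "x \<in> carrier (pspace (bars_module L J) t)"
  shows "y \<in> carrier (pspace (bars_module L J) t) \<Longrightarrow> (\<lambda>i\<in>L. x i + y i) \<in> carrier (pspace (bars_module L J) t)"
    and "(\<lambda>i\<in>L. a * x i) \<in> carrier (pspace (bars_module L J) t)"
proof -
  note x = assms[unfolded carrier_bars]
  show "(\<lambda>i\<in>L. a * x i) \<in> carrier (pspace (bars_module L J) t)"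
    unfolding carrier_bars using x by (auto elim!: rev_finite_subset)
  assume "y \<in> carrier (pspace (bars_module L J) t)"
  note y = this[unfolded carrier_bars]
  have "finite ({i\<in>L. x i \<noteq> 0} \<union> {i\<in>L. y i \<noteq> 0})" using x y by blast
  moreover have sub: "{i\<in>L. (\<lambda>i\<in>L. x i + y i) i \<noteq> 0} \<subseteq> {i\<in>L. x i \<noteq> 0} \<union> {i\<in>L. y i \<noteq> 0}" by auto
  ultimately have "finite {i\<in>L. (\<lambda>i\<in>L. x i + y i) i \<noteq> 0}" by (rule finite_subset[rotated])
  then show "(\<lambda>i\<in>L. x i + y i) \<in> carrier (pspace (bars_module L J) t)"
    unfolding carrier_bars using x y sub by blast
qed

lemma bars_zero_closed: "(\<lambda>i\<in>L. 0) \<in> carrier (pspace (bars_module L J) t)"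
  unfolding carrier_bars by (auto cong: conj_cong)

lemma vect_space_bars: "vect_space (pspace (bars_module L J) t)"
proof (rule vect_spaceI, unfold bars_ops)
  fix x assume x: "x \<in> carrier (pspace (bars_module L J) t)"
  have "(\<lambda>i\<in>L. (\<lambda>i\<in>L. - 1 * x i) i + x i) = (\<lambda>i\<in>L. 0)" by (auto cong: restrict_cong)
  then show "\<exists>y\<in>carrier (pspace (bars_module L J) t). (\<lambda>i\<in>L. y i + x i) = (\<lambda>i\<in>L. 0)"
    using bars_closed(2)[OF x] by blast
  show "(\<lambda>i\<in>L. (\<lambda>i\<in>L. 0) i + x i) = x" "(\<lambda>i\<in>L. 1 * x i) = x"
    using x unfolding carrier_bars by (auto simp: extensional_def fun_eq_iff)
qed (auto intro: bars_closed bars_zero_closed simp: algebra_simps fun_eq_iff)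

lemma persistence_module_bars:
  assumes J: "\<And>i. i \<in> L \<Longrightarrow> is_interval_in T (J i)"
  shows "persistence_module T (bars_module L J)"
proof -
  have "pmap (bars_module L J) s t \<in> linear_maps (pspace (bars_module L J) s) (pspace (bars_module L J) t)" for s t
  proof -
    have "(\<lambda>i\<in>L. if s \<in> J i \<and> t \<in> J i then x i else 0) \<in> carrier (pspace (bars_module L J) t)"
      if "x \<in> carrier (pspace (bars_module L J) s)" for x
      using that unfolding carrier_bars by (auto elim!: rev_finite_subset split: if_splits)
    then show ?thesis unfolding linear_maps_def bars_ops by (auto simp: fun_eq_iff bars_ops)
  qed
  moreover have "pmap (bars_module L J) t t x = x" if "x \<in> carrier (pspace (bars_module L J) t)" for t x
    using that unfolding carrier_bars bars_ops by (auto simp: extensional_def fun_eq_iff)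
  moreover have "pmap (bars_module L J) s t (pmap (bars_module L J) r s x) = pmap (bars_module L J) r t x"
    if "r \<in> T" "s \<in> T" "t \<in> T" "r \<le> s" "s \<le> t" for r s t x
  proof -
    \<comment> \<open>Convexity of the intervals: the composite must not kill a bar that is alive at
      \<open>r\<close> and \<open>t\<close>.\<close>
    have "s \<in> J i" if "i \<in> L" "r \<in> J i" "t \<in> J i" for i
      using J[OF that(1)] that \<open>s \<in> T\<close> \<open>r \<le> s\<close> \<open>s \<le> t\<close> unfolding is_interval_in_def by meson
    then show ?thesis unfolding bars_ops by (auto simp: fun_eq_iff)
  qed
  ultimately show ?thesis unfolding persistence_module_def using vect_space_bars by blast
qed

text \<open>Coefficients \<open>k\<close> on \<open>S\<close>, cut to \<open>L\<close> because
  elements of the direct sum are extensional.\<close>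

definition bar_vec :: "'i set \<Rightarrow> 'i set \<Rightarrow> ('i \<Rightarrow> 'f::zero) \<Rightarrow> 'i \<Rightarrow> 'f" where
  "bar_vec L S k = (\<lambda>i\<in>L. if i \<in> S then k i else 0)"

lemma bar_vec_carrier:
  assumes "finite S" "S \<subseteq> {i\<in>L. t \<in> J i}"
  shows "bar_vec L S k \<in> carrier (pspace (bars_module L J) t)"
  using assms unfolding carrier_bars bar_vec_def by (auto intro: rev_finite_subset[of S] split: if_splits)

lemma bar_vec_eq: "x \<in> carrier (pspace (bars_module L J) t) \<Longrightarrow> bar_vec L {i\<in>L. x i \<noteq> 0} x = x"
  unfolding carrier_bars bar_vec_def by (auto simp: extensional_def fun_eq_iff)

section \<open>The quotients \<open>Z t / B t\<close> as a persistence module\<close>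

locale filtered_chains = filtered_quotient "\<lambda>a (c :: 'b list \<Rightarrow> 'f) xs. a * c xs" Z B
  for Z B :: "real \<Rightarrow> ('b list \<Rightarrow> 'f::field) set"
begin

definition quot :: "('f, ('b list \<Rightarrow> 'f) set) pmodule" where
  "quot = \<lparr>pspace = (\<lambda>t. quotient_module (chain_module (Z t)) (B t)),
     pmap = (\<lambda>s t A. \<Union>c\<in>A. B t +>\<^bsub>chain_module (Z t)\<^esub> c)\<rparr>"

definition cls :: "real \<Rightarrow> ('b list \<Rightarrow> 'f) \<Rightarrow> ('b list \<Rightarrow> 'f) set" where
  "cls t z = {x. x - z \<in> B t}"

lemma coset_eq_cls: "B t +>\<^bsub>chain_module (Z t)\<^esub> z = cls t z"
proof -
  have "x \<in> (\<Union>h\<in>B t. {h + z}) \<longleftrightarrow> x - z \<in> B t" for x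
    by (auto simp: algebra_simps intro: bexI[of _ "x - z"])
  then show ?thesis unfolding cls_def a_r_coset_def' by (auto simp: chain_module_def plus_fun_def)
qed

lemma cls_eq_iff: "cls t z = cls t w \<longleftrightarrow> z - w \<in> B t"
proof
  assume "cls t z = cls t w"
  moreover have "z \<in> cls t z" unfolding cls_def using B_simps(1) by simp
  ultimately show "z - w \<in> B t" unfolding cls_def by auto
next
  assume "z - w \<in> B t"
  then show "cls t z = cls t w" unfolding cls_def using B_trans B_sym by blast
qed

lemma cls_self: "z \<in> cls t z"
  unfolding cls_def using B_simps(1) by simp

lemma quot_carrier: "carrier (pspace quot t) = cls t ` Z t"
proof -
  have "carrier (chain_module (Z t)) = Z t" unfolding chain_module_def by simp
  then show ?thesis
    unfolding quot_def quotient_module_def A_RCOSETS_def' by (auto simp: coset_eq_cls)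
qed

lemma quot_add: "cls t z \<oplus>\<^bsub>pspace quot t\<^esub> cls t w = cls t (z + w)"
proof -
  have "cls t z \<oplus>\<^bsub>pspace quot t\<^esub> cls t w = (\<Union>h\<in>cls t z. \<Union>k\<in>cls t w. {h + k})"
    unfolding quot_def quotient_module_def by (simp add: set_add_def' chain_module_def plus_fun_def)
  also have "\<dots> = cls t (z + w)"
  proof (intro equalityI subsetI)
    fix x assume "x \<in> (\<Union>h\<in>cls t z. \<Union>k\<in>cls t w. {h + k})"
    then obtain h k where hk: "h - z \<in> B t" "k - w \<in> B t" "x = h + k" unfolding cls_def by blast
    then show "x \<in> cls t (z + w)" using B_simps(2)[OF hk(1,2)] unfolding cls_def by (simp add: algebra_simps)
  next
    fix x assume "x \<in> cls t (z + w)"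
    then have "x - w \<in> cls t z" unfolding cls_def by (simp add: algebra_simps)
    then show "x \<in> (\<Union>h\<in>cls t z. \<Union>k\<in>cls t w. {h + k})" using cls_self[of w t]
      by (intro UN_I[of "x - w"] UN_I[of w]) auto
  qed
  finally show ?thesis .
qed

lemma quot_smult: "a \<odot>\<^bsub>pspace quot t\<^esub> cls t z = cls t (\<lambda>xs. a * z xs)"
proof -
  have "a \<odot>\<^bsub>pspace quot t\<^esub> cls t z = (\<Union>x\<in>cls t z. cls t (\<lambda>xs. a * x xs))"
    unfolding quot_def quotient_module_def by (simp add: coset_eq_cls) (simp add: chain_module_def)
  also have "cls t (\<lambda>xs. a * x xs) = cls t (\<lambda>xs. a * z xs)" if "x \<in> cls t z" for x
  proof -
    have "x - z \<in> B t" using that unfolding cls_def by simp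
    then have "(\<lambda>xs. a * (x - z) xs) \<in> B t" by (rule B_simps(5))
    moreover have "(\<lambda>xs. a * (x - z) xs) = (\<lambda>xs. a * x xs) - (\<lambda>xs. a * z xs)"
      by (auto simp: fun_eq_iff algebra_simps)
    ultimately show ?thesis unfolding cls_eq_iff by simp
  qed
  then have "(\<Union>x\<in>cls t z. cls t (\<lambda>xs. a * x xs)) = cls t (\<lambda>xs. a * z xs)" using cls_self by blast
  finally show ?thesis .
qed

lemma quot_zero: "\<zero>\<^bsub>pspace quot t\<^esub> = cls t 0"
  unfolding quot_def quotient_module_def cls_def by simp

lemma quot_pmap:
  assumes "s \<le> t"
  shows "pmap quot s t (cls s z) = cls t z"
proof -
  have "pmap quot s t (cls s z) = (\<Union>x\<in>cls s z. cls t x)"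
    unfolding quot_def by (simp add: coset_eq_cls)
  also have "cls t x = cls t z" if "x \<in> cls s z" for x
    using that B_mono[OF assms] unfolding cls_eq_iff unfolding cls_def by auto
  then have "(\<Union>x\<in>cls s z. cls t x) = cls t z" using cls_self by blast
  finally show ?thesis .
qed

lemma vect_space_quot: "vect_space (pspace quot t)"
proof (rule vect_spaceI, unfold quot_carrier)
  have "cls t (- z) \<oplus>\<^bsub>pspace quot t\<^esub> cls t z = \<zero>\<^bsub>pspace quot t\<^esub>" if "z \<in> Z t" for z
    unfolding quot_add quot_zero by simp
  then show "\<exists>y\<in>cls t ` Z t. y \<oplus>\<^bsub>pspace quot t\<^esub> x = \<zero>\<^bsub>pspace quot t\<^esub>" if "x \<in> cls t ` Z t" for x
    using that Z_simps(4) by blast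
  show "\<zero>\<^bsub>pspace quot t\<^esub> \<in> cls t ` Z t" unfolding quot_zero using Z_simps(1) by blast
  show "x \<oplus>\<^bsub>pspace quot t\<^esub> y \<in> cls t ` Z t" if "x \<in> cls t ` Z t" "y \<in> cls t ` Z t" for x y
    using that Z_simps(2) by (auto simp: quot_add)
  show "a \<odot>\<^bsub>pspace quot t\<^esub> x \<in> cls t ` Z t" if "x \<in> cls t ` Z t" for a x
    using that Z_simps(5) by (auto simp: quot_smult)
  have fun_add: "(\<lambda>xs. (a + b) * z xs) = (\<lambda>xs. a * z xs) + (\<lambda>xs. b * z xs)"
    "(\<lambda>xs. a * (z + w) xs) = (\<lambda>xs. a * z xs) + (\<lambda>xs. a * w xs)" for a b and z w :: "'b list \<Rightarrow> 'f"
    by (auto simp: fun_eq_iff algebra_simps)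
  show "(a + b) \<odot>\<^bsub>pspace quot t\<^esub> x = (a \<odot>\<^bsub>pspace quot t\<^esub> x) \<oplus>\<^bsub>pspace quot t\<^esub> (b \<odot>\<^bsub>pspace quot t\<^esub> x)"
    if "x \<in> cls t ` Z t" for a b x
    using that by (elim imageE) (simp only: quot_add quot_smult fun_add)
  show "a \<odot>\<^bsub>pspace quot t\<^esub> (x \<oplus>\<^bsub>pspace quot t\<^esub> y) = (a \<odot>\<^bsub>pspace quot t\<^esub> x) \<oplus>\<^bsub>pspace quot t\<^esub> (a \<odot>\<^bsub>pspace quot t\<^esub> y)"
    if "x \<in> cls t ` Z t" "y \<in> cls t ` Z t" for a x y
    using that by (elim imageE) (simp only: quot_add quot_smult fun_add)
  show "(a * b) \<odot>\<^bsub>pspace quot t\<^esub> x = a \<odot>\<^bsub>pspace quot t\<^esub> (b \<odot>\<^bsub>pspace quot t\<^esub> x)"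
    if "x \<in> cls t ` Z t" for a b x
    using that by (elim imageE) (simp only: quot_smult mult.assoc)
  show "1 \<odot>\<^bsub>pspace quot t\<^esub> x = x" if "x \<in> cls t ` Z t" for x
    using that by (elim imageE) (simp only: quot_smult mult_1)
  show "x \<oplus>\<^bsub>pspace quot t\<^esub> y \<oplus>\<^bsub>pspace quot t\<^esub> z = x \<oplus>\<^bsub>pspace quot t\<^esub> (y \<oplus>\<^bsub>pspace quot t\<^esub> z)"
    if "x \<in> cls t ` Z t" "y \<in> cls t ` Z t" "z \<in> cls t ` Z t" for x y z
    using that by (elim imageE) (simp only: quot_add add.assoc)
  show "x \<oplus>\<^bsub>pspace quot t\<^esub> y = y \<oplus>\<^bsub>pspace quot t\<^esub> x"
    if "x \<in> cls t ` Z t" "y \<in> cls t ` Z t" for x y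
    using that by (elim imageE) (simp only: quot_add add.commute)
  show "\<zero>\<^bsub>pspace quot t\<^esub> \<oplus>\<^bsub>pspace quot t\<^esub> x = x" if "x \<in> cls t ` Z t" for x
    using that by (elim imageE) (simp only: quot_add quot_zero add_0)
qed

lemma persistence_module_quot: "persistence_module T quot"
proof -
  have "pmap quot s t \<in> linear_maps (pspace quot s) (pspace quot t)" if "s \<le> t" for s t
    unfolding linear_maps_def quot_carrier using Z_mono[OF that]
    by (auto simp: quot_pmap[OF that] quot_add quot_smult)
  moreover have "pmap quot t t x = x" if "x \<in> carrier (pspace quot t)" for t x
    using that unfolding quot_carrier by (auto simp: quot_pmap)
  moreover have "pmap quot s t (pmap quot r s x) = pmap quot r t x"
    if "r \<le> s" "s \<le> t" "x \<in> carrier (pspace quot r)" for r s t x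
    using that unfolding quot_carrier by (auto simp: quot_pmap)
  ultimately show ?thesis by (simp add: persistence_module_def vect_space_quot)
qed

text \<open>For \<open>x\<close> in the carrier at time \<open>t\<close> the support contains only
  living bars, so the junk values of \<open>c\<close> never enter.\<close>

definition ev :: "'i set \<Rightarrow> ('i \<Rightarrow> real \<Rightarrow> 'b list \<Rightarrow> 'f) \<Rightarrow> real \<Rightarrow> ('i \<Rightarrow> 'f) \<Rightarrow> 'b list \<Rightarrow> 'f" where
  "ev L c t x = (\<Sum>i | i \<in> L \<and> x i \<noteq> 0. (\<lambda>xs. x i * c i t xs))"

lemma ev_eq:
  assumes "finite S" "{i\<in>L. x i \<noteq> 0} \<subseteq> S" "S \<subseteq> L"
  shows "ev L c t x = (\<Sum>i\<in>S. (\<lambda>xs. x i * c i t xs))"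
  unfolding ev_def using assms by (intro sum.mono_neutral_left) (auto simp: fun_eq_iff)

text \<open>The isomorphism evaluates coefficients on representatives: independence makes it
  injective, spanning makes it surjective, and the rules for living and dead bars make it
  natural.\<close>

theorem persistence_barcode_of_adapted_bars:
  assumes ad: "adapted_bars L J c"
  shows "persistence_barcode {0<..} quot L J"
proof -
  let ?Q = "bars_module L J :: ('f, _) pmodule"
  define \<psi> where "\<psi> t x = cls t (ev L c t x)" for t x
  note int = adapted_bars_interval[OF ad]
  have evZ: "ev L c t x \<in> Z t" if "x \<in> carrier (pspace ?Q t)" for t x
    unfolding ev_def using that adapted_bars_Z[OF ad]
    by (intro Z_simps(5,6)) (auto simp: carrier_bars)
  have ev_add: "ev L c t (\<lambda>i\<in>L. x i + y i) = ev L c t x + ev L c t y"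
    if "x \<in> carrier (pspace ?Q t)" "y \<in> carrier (pspace ?Q t)" for t x y
  proof -
    let ?S = "{i\<in>L. x i \<noteq> 0} \<union> {i\<in>L. y i \<noteq> 0}"
    have fin: "finite ?S" using that unfolding carrier_bars by blast
    have "ev L c t (\<lambda>i\<in>L. x i + y i) = (\<Sum>i\<in>?S. (\<lambda>xs. (\<lambda>i\<in>L. x i + y i) i * c i t xs))"
      by (rule ev_eq[OF fin]) auto
    also have "\<dots> = (\<Sum>i\<in>?S. (\<lambda>xs. x i * c i t xs)) + (\<Sum>i\<in>?S. (\<lambda>xs. y i * c i t xs))"
      unfolding sum.distrib[symmetric] by (intro sum.cong) (auto simp: fun_eq_iff algebra_simps)
    also have "\<dots> = ev L c t x + ev L c t y"
      by (subst (1 2) ev_eq[OF fin]) auto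
    finally show ?thesis .
  qed
  have ev_smult: "ev L c t (\<lambda>i\<in>L. a * x i) = (\<lambda>xs. a * ev L c t x xs)"
    if "x \<in> carrier (pspace ?Q t)" for t a x
  proof -
    let ?S = "{i\<in>L. x i \<noteq> 0}"
    have fin: "finite ?S" using that unfolding carrier_bars by blast
    have "ev L c t (\<lambda>i\<in>L. a * x i) = (\<Sum>i\<in>?S. (\<lambda>xs. (\<lambda>i\<in>L. a * x i) i * c i t xs))"
      by (rule ev_eq[OF fin]) auto
    also have "\<dots> = (\<lambda>xs. a * (\<Sum>i\<in>?S. (\<lambda>xs. x i * c i t xs)) xs)"
      unfolding fun_eq_iff sum_fun_apply sum_distrib_left by (intro allI sum.cong) (auto simp: mult.assoc)
    finally show ?thesis unfolding ev_def .
  qed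
  have lin: "\<psi> t \<in> linear_maps (pspace ?Q t) (pspace quot t)" for t
    unfolding linear_maps_def \<psi>_def quot_carrier
    using evZ by (auto simp: bars_ops ev_add ev_smult quot_add quot_smult)
  have bij: "bij_betw (\<psi> t) (carrier (pspace ?Q t)) (carrier (pspace quot t))" if t: "t > 0" for t
    unfolding bij_betw_def
  proof (intro conjI inj_onI equalityI subsetI)
    fix x y assume xy: "x \<in> carrier (pspace ?Q t)" "y \<in> carrier (pspace ?Q t)" "\<psi> t x = \<psi> t y"
    let ?d = "\<lambda>i\<in>L. x i + (\<lambda>i\<in>L. - 1 * y i) i"
    have y': "(\<lambda>i\<in>L. - 1 * y i) \<in> carrier (pspace ?Q t)" by (rule bars_closed(2)[OF xy(2)])
    have d: "?d \<in> carrier (pspace ?Q t)" by (rule bars_closed(1)[OF xy(1) y'])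
    have "ev L c t ?d = ev L c t x - ev L c t y"
      unfolding ev_add[OF xy(1) y'] ev_smult[OF xy(2)] by (auto simp: fun_eq_iff)
    then have "ev L c t ?d \<in> B t" using xy(3) unfolding \<psi>_def cls_eq_iff by simp
    then have "?d i = 0" if "i \<in> L" "?d i \<noteq> 0" for i
      using adapted_bars_indep[OF ad t, of "{i\<in>L. ?d i \<noteq> 0}" ?d i] d that
      unfolding ev_def carrier_bars by blast
    then have "x i = y i" if "i \<in> L" for i using that by (cases "?d i = 0") auto
    then show "x = y" using xy(1,2) unfolding carrier_bars by (auto intro: extensionalityI)
  next
    fix A assume "A \<in> \<psi> t ` carrier (pspace ?Q t)"
    then show "A \<in> carrier (pspace quot t)" using linear_mapsD(1)[OF lin] by blast
  next
    fix A assume "A \<in> carrier (pspace quot t)"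
    then obtain z where z: "z \<in> Z t" "A = cls t z" unfolding quot_carrier by blast
    obtain S k where S: "finite S" "S \<subseteq> {i\<in>L. t \<in> J i}" "z - (\<Sum>i\<in>S. (\<lambda>xs. k i * c i t xs)) \<in> B t"
      by (rule adapted_bars_span[OF ad t z(1)])
    have "ev L c t (bar_vec L S k) = (\<Sum>i\<in>S. (\<lambda>xs. bar_vec L S k i * c i t xs))"
      using S by (intro ev_eq) (auto simp: bar_vec_def)
    also have "\<dots> = (\<Sum>i\<in>S. (\<lambda>xs. k i * c i t xs))"
      using S by (intro sum.cong) (auto simp: bar_vec_def)
    finally have "\<psi> t (bar_vec L S k) = A" unfolding \<psi>_def z cls_eq_iff using S(3) B_sym by metis
    moreover have "bar_vec L S k \<in> carrier (pspace ?Q t)" using S by (intro bar_vec_carrier) auto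
    ultimately show "A \<in> \<psi> t ` carrier (pspace ?Q t)" by blast
  qed
  have nat: "\<psi> t (pmap ?Q s t x) = pmap quot s t (\<psi> s x)"
    if st: "s \<le> t" and x: "x \<in> carrier (pspace ?Q s)" for s t x
  proof -
    let ?S = "{i\<in>L. x i \<noteq> 0}" and ?y = "\<lambda>i\<in>L. if s \<in> J i \<and> t \<in> J i then x i else 0"
    have fin: "finite ?S" and alive: "\<And>i. i \<in> ?S \<Longrightarrow> i \<in> L \<and> s \<in> J i" using x unfolding carrier_bars by blast+
    have "ev L c t ?y = (\<Sum>i\<in>?S. (\<lambda>xs. ?y i * c i t xs))"
      by (rule ev_eq[OF fin]) (auto split: if_splits)
    \<comment> \<open>A living bar changes its representative only modulo \<open>B t\<close>; for a
      dead one the representative at \<open>s\<close> lies in \<open>B t\<close>.\<close>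
    moreover have "(\<lambda>xs. ?y i * c i t xs) - (\<lambda>xs. x i * c i s xs) \<in> B t" if "i \<in> ?S" for i
    proof -
      have i: "i \<in> L" "s \<in> J i" using alive[OF that] by auto
      show "(\<lambda>xs. ?y i * c i t xs) - (\<lambda>xs. x i * c i s xs) \<in> B t"
      proof (cases "t \<in> J i")
        case True
        then have "c i t - c i s \<in> B t" using adapted_bars_alive[OF ad i True st] B_sym by blast
        then have "(\<lambda>xs. x i * (c i t - c i s) xs) \<in> B t" by (rule B_simps(5))
        moreover have "(\<lambda>xs. ?y i * c i t xs) - (\<lambda>xs. x i * c i s xs) = (\<lambda>xs. x i * (c i t - c i s) xs)"
          using True i by (auto simp: fun_eq_iff algebra_simps)
        ultimately show ?thesis by simp
      next
        case False
        then have "(\<lambda>xs. (- x i) * c i s xs) \<in> B t" using adapted_bars_dead[OF ad i False st] by (intro B_simps(5))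
        moreover have "(\<lambda>xs. ?y i * c i t xs) - (\<lambda>xs. x i * c i s xs) = (\<lambda>xs. (- x i) * c i s xs)"
          using False i by (auto simp: fun_eq_iff)
        ultimately show ?thesis by simp
      qed
    qed
    then have "(\<Sum>i\<in>?S. (\<lambda>xs. ?y i * c i t xs) - (\<lambda>xs. x i * c i s xs)) \<in> B t" by (rule B_simps(6))
    ultimately have "ev L c t ?y - ev L c s x \<in> B t"
      by (simp only: sum_subtractf ev_def[of L c s x])
    then show ?thesis unfolding \<psi>_def quot_pmap[OF st] bars_ops cls_eq_iff .
  qed
  have "pmodule_iso {0<..} ?Q quot"
    unfolding pmodule_iso_def
    by (intro conjI exI[of _ \<psi>] persistence_module_quot persistence_module_bars int ballI impI lin bij nat) auto
  then show ?thesis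
    unfolding persistence_barcode_def using int pmodule_iso_sym by blast
qed

text \<open>The same dictionary read backwards: the images of the unit vectors have representatives,
  and these are adapted bars.\<close>

theorem adapted_bars_of_persistence_barcode:
  assumes bar: "persistence_barcode {0<..} quot L J"
  shows "\<exists>c. adapted_bars L J c"
proof -
  let ?Q = "bars_module L J :: ('f, _) pmodule"
  have int: "\<And>i. i \<in> L \<Longrightarrow> is_interval_in {0<..} (J i)"
    using bar unfolding persistence_barcode_def by blast
  have "pmodule_iso {0<..} ?Q quot"
    using bar pmodule_iso_sym unfolding persistence_barcode_def by blast
  then obtain \<psi> where lin: "\<And>t. t > 0 \<Longrightarrow> \<psi> t \<in> linear_maps (pspace ?Q t) (pspace quot t)"
    and bij: "\<And>t. t > 0 \<Longrightarrow> bij_betw (\<psi> t) (carrier (pspace ?Q t)) (carrier (pspace quot t))"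
    and nat: "\<And>s t x. s > 0 \<Longrightarrow> t > 0 \<Longrightarrow> s \<le> t \<Longrightarrow> x \<in> carrier (pspace ?Q s) \<Longrightarrow>
      \<psi> t (pmap ?Q s t x) = pmap quot s t (\<psi> s x)"
    unfolding pmodule_iso_def by (metis greaterThan_iff)
  have pos: "t > 0" if "i \<in> L" "t \<in> J i" for i t
    using int[OF that(1)] that(2) unfolding is_interval_in_def by auto
  define e where "e i = bar_vec L {i} (\<lambda>_. 1 :: 'f)" for i
  have e: "e i \<in> carrier (pspace ?Q t)" if "i \<in> L" "t \<in> J i" for i t
    unfolding e_def using that by (intro bar_vec_carrier) auto
  \<comment> \<open>Representatives are chosen at each time separately; naturality makes them fit
    together modulo \<open>B t\<close>.\<close>
  have "\<exists>z. i \<in> L \<longrightarrow> t \<in> J i \<longrightarrow> z \<in> Z t \<and> \<psi> t (e i) = cls t z" for i t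
    using linear_mapsD(1)[OF lin[OF pos] e, of i t] unfolding quot_carrier by blast
  then obtain c where c: "\<And>i t. i \<in> L \<Longrightarrow> t \<in> J i \<Longrightarrow> c i t \<in> Z t \<and> \<psi> t (e i) = cls t (c i t)"
    by metis
  have zero: "\<psi> t (\<lambda>i\<in>L. 0) = cls t 0" if t: "t > 0" for t
  proof -
    let ?z = "\<lambda>i\<in>L. 0 :: 'f"
    have z: "?z \<in> carrier (pspace ?Q t)" by (rule bars_zero_closed)
    obtain w where "\<psi> t ?z = cls t w" using linear_mapsD(1)[OF lin[OF t] z] unfolding quot_carrier by blast
    moreover have "\<psi> t (0 \<odot>\<^bsub>pspace ?Q t\<^esub> ?z) = 0 \<odot>\<^bsub>pspace quot t\<^esub> \<psi> t ?z"
      by (rule linear_mapsD(3)[OF lin[OF t] z])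
    moreover have "0 \<odot>\<^bsub>pspace ?Q t\<^esub> ?z = ?z" unfolding bars_ops by (auto cong: restrict_cong)
    moreover have "(\<lambda>xs. 0 * w xs) = 0" by (auto simp: fun_eq_iff)
    ultimately show ?thesis by (simp add: quot_smult)
  qed
  have rep: "\<psi> t (bar_vec L S k) = cls t (\<Sum>i\<in>S. (\<lambda>xs. k i * c i t xs))"
    if t: "t > 0" and "finite S" "S \<subseteq> {i\<in>L. t \<in> J i}" for t S k
    using that(2,3)
  proof (induction S rule: finite_induct)
    case empty
    have "bar_vec L {} k = (\<lambda>i\<in>L. 0)" unfolding bar_vec_def by simp
    then show ?case using zero[OF t] by (simp only: sum.empty)
  next
    case (insert i S)
    have i: "i \<in> L" "t \<in> J i" using insert.prems by auto
    have S: "bar_vec L S k \<in> carrier (pspace ?Q t)" using insert by (intro bar_vec_carrier) auto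
    have ke: "k i \<odot>\<^bsub>pspace ?Q t\<^esub> e i \<in> carrier (pspace ?Q t)"
      using bars_closed(2)[OF e[OF i]] unfolding bars_ops .
    have "bar_vec L (insert i S) k = (k i \<odot>\<^bsub>pspace ?Q t\<^esub> e i) \<oplus>\<^bsub>pspace ?Q t\<^esub> bar_vec L S k"
      unfolding bars_ops bar_vec_def e_def using insert.hyps by (auto simp: fun_eq_iff)
    then have "\<psi> t (bar_vec L (insert i S) k) = (k i \<odot>\<^bsub>pspace quot t\<^esub> \<psi> t (e i)) \<oplus>\<^bsub>pspace quot t\<^esub> \<psi> t (bar_vec L S k)"
      using linear_mapsD(2)[OF lin[OF t] ke S] linear_mapsD(3)[OF lin[OF t] e[OF i]] by simp
    moreover have "\<psi> t (bar_vec L S k) = cls t (\<Sum>i\<in>S. (\<lambda>xs. k i * c i t xs))" using insert by blast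
    ultimately have "\<psi> t (bar_vec L (insert i S) k) = cls t ((\<lambda>xs. k i * c i t xs) + (\<Sum>i\<in>S. (\<lambda>xs. k i * c i t xs)))"
      using c[OF i] by (simp only: quot_add quot_smult)
    then show ?case using sum.insert[OF insert.hyps, of "\<lambda>i xs. k i * c i t xs"] by (simp only:)
  qed
  have "adapted_bars L J c"
    unfolding adapted_bars_def
  proof (intro conjI ballI allI impI)
    fix i assume i: "i \<in> L"
    show "is_interval_in {0<..} (J i)" by (rule int[OF i])
    fix s assume s: "s \<in> J i"
    show "c i s \<in> Z s" using c[OF i s] by blast
    fix t assume st: "s \<le> t"
    have pst: "s > 0" "t > 0" using pos[OF i s] st by auto
    have *: "\<psi> t (pmap ?Q s t (e i)) = cls t (c i s)"
      using nat[OF pst st e[OF i s]] c[OF i s] quot_pmap[OF st] by simp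
    show "if t \<in> J i then c i s - c i t \<in> B t else c i s \<in> B t"
    proof (cases "t \<in> J i")
      case True
      have "pmap ?Q s t (e i) = e i" unfolding bars_ops e_def bar_vec_def using True s by (auto simp: fun_eq_iff)
      then have "cls t (c i s) = cls t (c i t)" using * c[OF i True] by simp
      then show ?thesis using True cls_eq_iff by simp
    next
      case False
      have "pmap ?Q s t (e i) = (\<lambda>i\<in>L. 0)" unfolding bars_ops e_def bar_vec_def using False by (auto simp: fun_eq_iff)
      then have "cls t (c i s) = cls t 0" using * zero[OF pst(2)] by simp
      then show ?thesis using False cls_eq_iff by simp
    qed
  next
    fix t :: real and S k i
    assume t: "0 < t" and S: "finite S" "S \<subseteq> {i\<in>L. t \<in> J i}"
      and sum: "(\<Sum>i\<in>S. (\<lambda>xs. k i * c i t xs)) \<in> B t" and i: "i \<in> S"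
    have "\<psi> t (bar_vec L S k) = cls t 0" unfolding rep[OF t S] cls_eq_iff using sum by simp
    then have "bar_vec L S k = (\<lambda>i\<in>L. 0)"
      using bij[OF t] bar_vec_carrier[OF S] bars_zero_closed zero[OF t] by (metis bij_betw_def inj_onD)
    then have "bar_vec L S k i = 0" using S i by auto
    then show "k i = 0" unfolding bar_vec_def using S i by auto
  next
    fix t :: real and z assume t: "0 < t" and z: "z \<in> Z t"
    then have "cls t z \<in> carrier (pspace quot t)" unfolding quot_carrier by blast
    then have "cls t z \<in> \<psi> t ` carrier (pspace ?Q t)" using bij[OF t] unfolding bij_betw_def by simp
    then obtain x where x: "x \<in> carrier (pspace ?Q t)" "\<psi> t x = cls t z" by (elim imageE) simp
    let ?S = "{i\<in>L. x i \<noteq> 0}"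
    have S: "finite ?S" "?S \<subseteq> {i\<in>L. t \<in> J i}" using x(1) unfolding carrier_bars by auto
    have "cls t z = cls t (\<Sum>i\<in>?S. (\<lambda>xs. x i * c i t xs))"
      using rep[OF t S, of x] x(2) bar_vec_eq[OF x(1)] by simp
    then show "\<exists>S k. finite S \<and> S \<subseteq> {i\<in>L. t \<in> J i} \<and> z - (\<Sum>i\<in>S. (\<lambda>xs. k i * c i t xs)) \<in> B t"
      using S by (intro exI[of _ ?S] exI[of _ x]) (simp only: cls_eq_iff simp_thms)
  qed
  then show ?thesis by blast
qed

theorem barcode_exists: "\<exists>(L :: (real \<times> ('b list \<Rightarrow> 'f) set) set) J. persistence_barcode {0<..} quot L J"
proof -
  obtain L :: "(real \<times> ('b list \<Rightarrow> 'f) set) set" and J c where "adapted_bars L J c"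
    using adapted_bars_small_index[OF exists_adapted_bars] by auto
  then show ?thesis using persistence_barcode_of_adapted_bars by blast
qed

theorem barcode_unique:
  assumes "persistence_barcode {0<..} quot L J" "persistence_barcode {0<..} quot L' J'"
  shows "\<exists>\<sigma>. bij_betw \<sigma> L L' \<and> (\<forall>i\<in>L. J' (\<sigma> i) = J i)"
proof -
  obtain c where c: "adapted_bars L J c" using adapted_bars_of_persistence_barcode[OF assms(1)] by blast
  obtain c' where c': "adapted_bars L' J' c'" using adapted_bars_of_persistence_barcode[OF assms(2)] by blast
  show ?thesis by (rule adapted_bars_unique[OF c c'])
qed

end

section \<open>Vietoris-Rips homology\<close>

text \<open>Swaps of neighbours suffice and suit recursion on lists. Vanishing on repetitions is a
  clause of its own because in characteristic 2 it does not follow from the change of sign.\<close>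

definition alt :: "('b list \<Rightarrow> 'f::field) \<Rightarrow> bool" where
  "alt c \<longleftrightarrow> (\<forall>xs a b ys. c (xs @ a # b # ys) = - c (xs @ b # a # ys)) \<and>
     (\<forall>xs a ys. c (xs @ a # a # ys) = 0)"

lemma alt_swap: "alt c \<Longrightarrow> c (xs @ a # b # ys) = - c (xs @ b # a # ys)"
  and alt_same: "alt c \<Longrightarrow> c (xs @ a # a # ys) = 0"
  unfolding alt_def by blast+

lemma alt_swap0: "alt c \<Longrightarrow> c (a # b # ys) = - c (b # a # ys)"
  and alt_same0: "alt c \<Longrightarrow> c (a # a # ys) = 0"
  using alt_swap[of c "[]" a b ys] alt_same[of c "[]" a ys] by (simp_all only: append_Nil)

text \<open>Swaps bring the two equal entries next to each other.\<close>

lemma alt_not_distinct: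
  assumes "alt c" "\<not> distinct xs"
  shows "c xs = 0"
proof -
  have *: "c (us @ y # vs @ y # ws) = 0" for us vs ws y
  proof (induction vs arbitrary: us)
    case Nil
    then show ?case using alt_same[OF assms(1)] by simp
  next
    case (Cons v vs)
    then show ?case using alt_swap[OF assms(1), of us y v] Cons[of "us @ [v]"] by simp
  qed
  obtain us vs ws y where "xs = us @ [y] @ vs @ [y] @ ws" using not_distinct_decomp[OF assms(2)] by blast
  then show ?thesis using * by simp
qed

text \<open>Moving \<open>v\<close> past \<open>xs\<close> costs only a sign, which does not affect
  vanishing.\<close>

lemma alt_front:
  assumes "alt c" "c (v # xs @ ys) = 0"
  shows "c (xs @ v # ys) = 0"
proof -
  have "c (zs @ v # xs @ ys) = 0 \<Longrightarrow> c (zs @ xs @ v # ys) = 0" for zs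
  proof (induction xs arbitrary: zs)
    case (Cons x xs)
    have "c (zs @ x # v # xs @ ys) = 0" using alt_swap[OF assms(1), of zs x v] Cons.prems by simp
    then show ?case using Cons.IH[of "zs @ [x]"] by simp
  qed simp
  from this[of "[]"] show ?thesis using assms by simp
qed

lemma permute_list_adjacent:
  "permute_list (Transposition.transpose (length us) (Suc (length us))) (us @ a # b # vs) = us @ b # a # vs"
proof (rule nth_equalityI)
  fix i assume "i < length (permute_list (Transposition.transpose (length us) (Suc (length us))) (us @ a # b # vs))"
  then have i: "i < length us + 2 + length vs" by simp
  consider "i < length us" | "i = length us" | "i = Suc (length us)" | m where "i = Suc (Suc (length us + m))"
  proof (cases "i \<le> Suc (length us)")
    case True
    then show thesis using that(1-3) by linarith
  next
    case False
    then have "i = Suc (Suc (length us + (i - Suc (Suc (length us)))))" by simp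
    then show thesis by (rule that(4))
  qed
  then show "permute_list (Transposition.transpose (length us) (Suc (length us))) (us @ a # b # vs) ! i =
      (us @ b # a # vs) ! i"
    using i by cases (simp_all add: permute_list_def nth_append Transposition.transpose_def Suc_diff_le del: upt_Suc)
qed simp

text \<open>A transposition of distant positions is a shorter one conjugated by a swap of
  neighbours: three changes of sign in all.\<close>

lemma alt_transpose:
  assumes c: "alt c"
  shows "i < j \<Longrightarrow> j < length xs \<Longrightarrow> c (permute_list (Transposition.transpose i j) xs) = - c xs"
proof (induction "j - i" arbitrary: i xs)
  case (Suc d)
  have adj: "c (permute_list (Transposition.transpose i (Suc i)) ys) = - c ys" if "Suc i < length ys" for ys
  proof -
    define us where "us = take i ys"
    have len: "length us = i" unfolding us_def using that by simp
    have ys: "ys = us @ ys ! i # ys ! Suc i # drop (Suc (Suc i)) ys"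
      unfolding us_def using that by (metis Cons_nth_drop_Suc Suc_lessD append_take_drop_id)
    have "permute_list (Transposition.transpose i (Suc i)) ys = us @ ys ! Suc i # ys ! i # drop (Suc (Suc i)) ys"
      using permute_list_adjacent[of us "ys ! i" "ys ! Suc i" "drop (Suc (Suc i)) ys"] ys len by simp
    then show ?thesis using alt_swap[OF c, of us "ys ! Suc i" "ys ! i"] ys by simp
  qed
  show ?case
  proof (cases "j = Suc i")
    case True
    then show ?thesis using adj Suc.prems by simp
  next
    case False
    then have ij: "Suc i < j" using Suc.prems by simp
    let ?s = "Transposition.transpose i (Suc i)" and ?t = "Transposition.transpose (Suc i) j"
    have eq: "Transposition.transpose i j = (?s \<circ> ?t) \<circ> ?s"
      using ij by (auto simp: Transposition.transpose_def fun_eq_iff)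
    let ?n = "{..<length xs}"
    have s: "?s permutes ?n" and t: "?t permutes ?n" using ij Suc.prems by (auto intro!: permutes_swap_id)
    have "permute_list (Transposition.transpose i j) xs = permute_list ?s (permute_list ?t (permute_list ?s xs))"
      unfolding eq using s t by (simp add: permute_list_compose)
    moreover have "c (permute_list ?t ys) = - c ys" if "length ys = length xs" for ys
      using Suc.hyps(1)[of "Suc i" ys] Suc.hyps(2) ij Suc.prems that by simp
    ultimately show ?thesis using adj ij Suc.prems by simp
  qed
qed simp

lemma alt_permute_list:
  assumes c: "alt c" and p: "p permutes {..<length xs}"
  shows "c (permute_list p xs) = of_int (sign p) * c xs"
  using finite_lessThan p
proof (induction rule: permutes_rev_induct)
  case id
  then show ?case by simp
next
  case (swap a b q)
  have t: "Transposition.transpose a b permutes {..<length xs}" using swap by (auto intro!: permutes_swap_id)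
  have "permute_list (q \<circ> Transposition.transpose a b) xs = permute_list (Transposition.transpose a b) (permute_list q xs)"
    using t by (simp add: permute_list_compose)
  moreover have "c (permute_list (Transposition.transpose a b) ys) = - c ys" if "length ys = length xs" for ys
    using alt_transpose[OF c, of a b ys] alt_transpose[OF c, of b a ys] swap.hyps that
    by (cases a b rule: linorder_cases) (auto simp: Transposition.transpose_commute)
  moreover have "sign (q \<circ> Transposition.transpose a b) = - sign q"
  proof -
    have "permutation q" "permutation (Transposition.transpose a b)"
      using swap.hyps t by (auto simp: permutation_permutes)
    then show ?thesis using swap.hyps by (simp add: sign_compose sign_swap_id)
  qed
  ultimately have "c (permute_list (q \<circ> Transposition.transpose a b) xs) = - c (permute_list q xs)"
    "sign (q \<circ> Transposition.transpose a b) = - sign q"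
    by (simp_all only: length_permute_list)
  then show ?case using swap.IH by (simp only: of_int_minus minus_mult_left)
qed

text \<open>Trades the condition on all permutations for swaps of neighbours, which can be checked
  by recursion for boundaries and exterior products.\<close>

lemma chains_iff:
  "c \<in> chains K k \<longleftrightarrow> alt c \<and> finite {xs. c xs \<noteq> 0} \<and> (\<forall>xs. c xs \<noteq> 0 \<longrightarrow> length xs = Suc k \<and> set xs \<in> K)"
proof
  assume c: "c \<in> chains K k"
  then have dis: "distinct xs" if "c xs \<noteq> 0" for xs using that unfolding chains_def by blast
  have perm: "c (permute_list p xs) = of_int (sign p) * c xs" if "p permutes {..<length xs}" for p xs
    using that c unfolding chains_def by blast
  have "c (xs @ a # b # ys) = - c (xs @ b # a # ys)" for xs a b ys
    using perm[of "Transposition.transpose (length xs) (Suc (length xs))" "xs @ b # a # ys"]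
    by (simp add: permute_list_adjacent permutes_swap_id sign_swap_id)
  moreover have "c (xs @ a # a # ys) = 0" for xs a ys using dis[of "xs @ a # a # ys"] by auto
  ultimately have "alt c" unfolding alt_def by blast
  then show "alt c \<and> finite {xs. c xs \<noteq> 0} \<and> (\<forall>xs. c xs \<noteq> 0 \<longrightarrow> length xs = Suc k \<and> set xs \<in> K)"
    using c unfolding chains_def by blast
next
  assume c: "alt c \<and> finite {xs. c xs \<noteq> 0} \<and> (\<forall>xs. c xs \<noteq> 0 \<longrightarrow> length xs = Suc k \<and> set xs \<in> K)"
  then show "c \<in> chains K k"
    unfolding chains_def using alt_not_distinct[of c] alt_permute_list[of c] by blast
qed

lemma chains_mono: "K \<subseteq> K' \<Longrightarrow> chains K k \<subseteq> chains K' k"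
  unfolding chains_def by blast

section \<open>Boundaries and the subspaces of chains, cycles and boundaries\<close>

definition verts :: "('b list \<Rightarrow> 'f::zero) \<Rightarrow> 'b set" where
  "verts c = (\<Union>xs\<in>{xs. c xs \<noteq> 0}. set xs)"

lemma vertsI: "c xs \<noteq> 0 \<Longrightarrow> set xs \<subseteq> verts c"
  unfolding verts_def by blast

lemma finite_verts: "c \<in> chains K k \<Longrightarrow> finite (verts c)"
  unfolding verts_def chains_iff by auto

text \<open>The range of summation in the definition varies with \<open>c\<close> and
  \<open>ys\<close>; a common finite set of vertices makes linearity visible.\<close>

lemma boundary_eq:
  assumes "finite V" "verts c \<subseteq> V"
  shows "boundary c ys = (if ys = [] then 0 else \<Sum>v\<in>V. c (v # ys))"
proof -
  have "(\<Sum>v | c (v # ys) \<noteq> 0. c (v # ys)) = (\<Sum>v\<in>V. c (v # ys))"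
    using assms vertsI[of c] by (intro sum.mono_neutral_left) force+
  then show ?thesis unfolding boundary_def by simp
qed

lemma boundary_nonzero: "boundary c ys \<noteq> 0 \<Longrightarrow> ys \<noteq> [] \<and> (\<exists>v. c (v # ys) \<noteq> 0)"
  unfolding boundary_def by (auto split: if_splits dest: sum.not_neutral_contains_not_neutral)

lemma boundary_add:
  assumes "finite (verts c)" "finite (verts d)"
  shows "boundary (c + d) = boundary c + boundary d"
proof
  fix ys
  let ?V = "verts c \<union> verts d"
  have fin: "finite ?V" using assms by blast
  have "set xs \<subseteq> ?V" if "(c + d) xs \<noteq> 0" for xs
    using that vertsI[of c xs] vertsI[of d xs] by (cases "c xs = 0") auto
  then have "verts (c + d) \<subseteq> ?V" unfolding verts_def[of "c + d"] by blast
  then show "boundary (c + d) ys = (boundary c + boundary d) ys"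
    using boundary_eq[OF fin, of "c + d" ys] boundary_eq[OF fin, of c ys] boundary_eq[OF fin, of d ys]
    by (simp add: sum.distrib)
qed

lemma boundary_scale:
  assumes "finite (verts c)"
  shows "boundary (\<lambda>xs. a * c xs) = (\<lambda>xs. a * boundary c xs)"
proof
  fix ys
  have "verts (\<lambda>xs. a * c xs) \<subseteq> verts c" unfolding verts_def by auto
  then show "boundary (\<lambda>xs. a * c xs) ys = a * boundary c ys"
    using boundary_eq[OF assms, of "\<lambda>xs. a * c xs" ys] boundary_eq[OF assms, of c ys]
    by (simp add: sum_distrib_left)
qed

lemma alt_Cons: "alt c \<Longrightarrow> alt (\<lambda>ys. c (v # ys))"
  unfolding alt_def by (metis append_Cons)

lemma alt_add: "alt c \<Longrightarrow> alt d \<Longrightarrow> alt (c + d)"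
  unfolding alt_def by (metis (no_types, lifting) add.right_neutral minus_add_distrib plus_fun_apply)

lemma alt_scale: "alt c \<Longrightarrow> alt (\<lambda>xs. a * c xs)"
  unfolding alt_def by (metis mult_minus_right mult_zero_right)

abbreviation chain_scale_fun :: "'f::field \<Rightarrow> ('b list \<Rightarrow> 'f) \<Rightarrow> 'b list \<Rightarrow> 'f" where
  "chain_scale_fun \<equiv> \<lambda>a c xs. a * c xs"

global_interpretation ch: vector_space "chain_scale_fun :: 'f::field \<Rightarrow> ('b list \<Rightarrow> 'f) \<Rightarrow> 'b list \<Rightarrow> 'f"
  by unfold_locales (auto simp: fun_eq_iff algebra_simps)

lemma subspace_chains: "ch.subspace (chains K k :: ('b list \<Rightarrow> 'f::field) set)"
proof -
  have "c + d \<in> chains K k" if cd: "c \<in> chains K k" "d \<in> chains K k" for c d :: "'b list \<Rightarrow> 'f"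
  proof -
    have "finite ({xs. c xs \<noteq> 0} \<union> {xs. d xs \<noteq> 0})" using cd unfolding chains_iff by blast
    moreover have sub: "{xs. (c + d) xs \<noteq> 0} \<subseteq> {xs. c xs \<noteq> 0} \<union> {xs. d xs \<noteq> 0}" by auto
    ultimately have "finite {xs. (c + d) xs \<noteq> 0}" by (rule finite_subset[rotated])
    then show ?thesis using cd sub alt_add[of c d] unfolding chains_iff by blast
  qed
  moreover have "(\<lambda>xs. a * c xs) \<in> chains K k" if c: "c \<in> chains K k" for a and c :: "'b list \<Rightarrow> 'f"
  proof -
    have sub: "{xs. a * c xs \<noteq> 0} \<subseteq> {xs. c xs \<noteq> 0}" by auto
    then have "finite {xs. a * c xs \<noteq> 0}" using c finite_subset unfolding chains_iff by blast
    then show ?thesis using c sub alt_scale[of c a] unfolding chains_iff by blast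
  qed
  moreover have "(0 :: 'b list \<Rightarrow> 'f) \<in> chains K k" unfolding chains_iff alt_def by simp
  ultimately show ?thesis unfolding ch.subspace_def by blast
qed

lemma subspace_cycles: "ch.subspace (cycles K k :: ('b list \<Rightarrow> 'f::field) set)"
proof -
  note sc = subspace_chains[of K k, unfolded ch.subspace_def]
  have mem: "c \<in> cycles K k \<longleftrightarrow> c \<in> chains K k \<and> boundary c = 0" for c :: "'b list \<Rightarrow> 'f"
    unfolding cycles_def by (simp add: zero_fun_def)
  have "boundary 0 = (0 :: 'b list \<Rightarrow> 'f)" by (auto simp: boundary_def fun_eq_iff)
  moreover have "boundary (c + d) = 0" if "c \<in> cycles K k" "d \<in> cycles K k" for c d :: "'b list \<Rightarrow> 'f"
    using that boundary_add[OF finite_verts finite_verts, of c K k d K k] unfolding mem by simp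
  moreover have "boundary (\<lambda>xs. a * c xs) = 0" if "c \<in> cycles K k" for a and c :: "'b list \<Rightarrow> 'f"
    using that boundary_scale[OF finite_verts, of c K k a] unfolding mem by (simp add: zero_fun_def)
  ultimately show ?thesis unfolding ch.subspace_def using sc by (simp add: mem Ball_def) blast
qed

lemma subspace_boundaries: "ch.subspace (boundaries K k :: ('b list \<Rightarrow> 'f::field) set)"
proof -
  note sc = subspace_chains[of K "Suc k", unfolded ch.subspace_def]
  have "x + y \<in> boundaries K k" if xy: "x \<in> boundaries K k" "y \<in> boundaries K k" for x y :: "'b list \<Rightarrow> 'f"
  proof -
    obtain c d where cd: "c \<in> chains K (Suc k)" "x = boundary c" "d \<in> chains K (Suc k)" "y = boundary d"
      using xy unfolding boundaries_def by blast
    then have "x + y = boundary (c + d)" by (simp add: boundary_add finite_verts)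
    then show ?thesis using cd sc unfolding boundaries_def by blast
  qed
  moreover have "(\<lambda>xs. a * x xs) \<in> boundaries K k" if x: "x \<in> boundaries K k" for a and x :: "'b list \<Rightarrow> 'f"
  proof -
    obtain c where cd: "c \<in> chains K (Suc k)" "x = boundary c" using x unfolding boundaries_def by blast
    then have "(\<lambda>xs. a * x xs) = boundary (\<lambda>xs. a * c xs)" by (simp add: boundary_scale finite_verts)
    then show ?thesis using cd sc unfolding boundaries_def by blast
  qed
  moreover have "(0 :: 'b list \<Rightarrow> 'f) \<in> boundaries K k"
  proof -
    have "(0 :: 'b list \<Rightarrow> 'f) = boundary 0" by (auto simp: boundary_def fun_eq_iff)
    then show ?thesis unfolding boundaries_def by (rule image_eqI[OF _ conjunct1[OF sc]])
  qed
  ultimately show ?thesis unfolding ch.subspace_def by blast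
qed

definition simplicial_complex :: "'b set set \<Rightarrow> bool" where
  "simplicial_complex K \<longleftrightarrow> (\<forall>\<sigma>\<in>K. \<forall>\<tau>\<subseteq>\<sigma>. \<tau> \<noteq> {} \<longrightarrow> \<tau> \<in> K)"

lemma boundary_chain:
  assumes K: "simplicial_complex K" and c: "c \<in> chains K (Suc k)"
  shows "boundary c \<in> chains K k"
  unfolding chains_iff
proof (intro conjI allI impI)
  note c' = c[unfolded chains_iff]
  have alt: "alt c" using c' by blast
  note eq = boundary_eq[OF finite_verts[OF c] subset_refl]
  have "boundary c (xs @ a # b # ys) = - boundary c (xs @ b # a # ys)" for xs a b ys
    using alt_swap[OF alt_Cons[OF alt], where xs = xs and a = a and b = b and ys = ys] unfolding eq by (simp flip: sum_negf)
  moreover have "boundary c (xs @ a # a # ys) = 0" for xs a ys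
    using alt_same[OF alt_Cons[OF alt], where xs = xs and a = a and ys = ys] unfolding eq by simp
  ultimately show "alt (boundary c)" unfolding alt_def by blast
  have "{ys. boundary c ys \<noteq> 0} \<subseteq> tl ` {xs. c xs \<noteq> 0}"
  proof
    fix ys assume "ys \<in> {ys. boundary c ys \<noteq> 0}"
    then obtain v where "c (v # ys) \<noteq> 0" using boundary_nonzero by blast
    then show "ys \<in> tl ` {xs. c xs \<noteq> 0}" by (intro image_eqI[of _ _ "v # ys"]) auto
  qed
  then show "finite {ys. boundary c ys \<noteq> 0}" using c' finite_surj by blast
  fix ys assume "boundary c ys \<noteq> 0"
  then obtain v where v: "c (v # ys) \<noteq> 0" "ys \<noteq> []" using boundary_nonzero by blast
  then have "length (v # ys) = Suc (Suc k)" "set (v # ys) \<in> K" using c' by blast+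
  then show "length ys = Suc k" "set ys \<in> K"
    using K v(2) unfolding simplicial_complex_def by (auto dest!: bspec)
qed

text \<open>Terms off the diagonal cancel in pairs. The diagonal vanishes by its own hypothesis,
  which covers characteristic 2.\<close>

lemma sum_alternating_pairs:
  assumes "finite V" "\<And>u v. g u v = - g v u" "\<And>u. g u u = (0 :: 'f::field)"
  shows "(\<Sum>u\<in>V. \<Sum>v\<in>V. g u v) = 0"
  using assms(1)
proof (induction V rule: finite_induct)
  case (insert w V)
  have "(\<Sum>u\<in>V. g u w) = - (\<Sum>v\<in>V. g w v)" unfolding sum_negf[symmetric]
    by (intro sum.cong refl assms(2))
  then show ?case using insert by (simp add: sum.distrib assms(3))
qed simp

lemma boundary_boundary:
  assumes c: "c \<in> chains K k"
  shows "boundary (boundary c) = (\<lambda>ys. 0)"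
proof
  fix ys
  have alt: "alt c" using c unfolding chains_iff by blast
  let ?V = "verts c"
  have fin: "finite ?V" using c by (rule finite_verts)
  have "verts (boundary c) \<subseteq> ?V"
    unfolding verts_def using boundary_nonzero by fastforce
  then have "boundary (boundary c) ys = (if ys = [] then 0 else \<Sum>u\<in>?V. \<Sum>v\<in>?V. c (v # u # ys))"
    using boundary_eq[OF fin, of "boundary c" ys] boundary_eq[OF fin, of c] by simp
  also have "(\<Sum>u\<in>?V. \<Sum>v\<in>?V. c (v # u # ys)) = 0"
    by (rule sum_alternating_pairs[OF fin]) (rule alt_swap0[OF alt], rule alt_same0[OF alt])
  finally show "boundary (boundary c) ys = 0" by simp
qed

section \<open>Exterior multiplication and moving a vertex of a cycle\<close>

text \<open>Left exterior multiplication by a vertex, by recursion on the anticommutation rule with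
  the contraction \<open>\<lambda>ys. a (y # ys)\<close>.\<close>

fun wedge :: "'b \<Rightarrow> ('b list \<Rightarrow> 'f::field) \<Rightarrow> 'b list \<Rightarrow> 'f" where
  "wedge w a [] = 0"
| "wedge w a (y # ys) = (if y = w then a ys else 0) - wedge w (\<lambda>zs. a (y # zs)) ys"

lemma wedge_zero: "wedge w (\<lambda>zs. 0) ys = 0"
  by (induction ys) auto

lemma wedge_uminus: "wedge w (\<lambda>zs. - a zs) ys = - wedge w a ys"
  by (induction ys arbitrary: a) auto

lemma wedge_add: "wedge w (\<lambda>zs. a zs + b zs) ys = wedge w a ys + wedge w b ys"
  by (induction ys arbitrary: a b) auto

lemma wedge_sum: "finite V \<Longrightarrow> wedge w (\<lambda>zs. \<Sum>v\<in>V. a v zs) ys = (\<Sum>v\<in>V. wedge w (a v) ys)"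
  by (induction V rule: finite_induct) (auto simp: wedge_zero wedge_add)

lemma alt_wedge:
  assumes "alt a"
  shows "alt (wedge w a)"
proof -
  have "wedge w a (xs @ x # y # ys) = - wedge w a (xs @ y # x # ys)" for xs x y ys
    using assms
  proof (induction xs arbitrary: a)
    case Nil
    have "(\<lambda>z. a (x # y # z)) = (\<lambda>z. - a (y # x # z))" using alt_swap0[OF Nil] by (intro ext)
    then show ?case by (simp add: wedge_uminus)
  next
    case (Cons u xs)
    then show ?case using alt_swap[OF Cons.prems, of xs x y ys] Cons.IH[OF alt_Cons[OF Cons.prems], of u] by simp
  qed
  moreover have "wedge w a (xs @ x # x # ys) = 0" for xs x ys
    using assms
  proof (induction xs arbitrary: a)
    case Nil
    have "(\<lambda>z. a (x # x # z)) = (\<lambda>z. 0)" using alt_same0[OF Nil] by (intro ext)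
    then show ?case by (simp add: wedge_zero)
  next
    case (Cons u xs)
    then show ?case using alt_same[OF Cons.prems, of xs x ys] Cons.IH[OF alt_Cons[OF Cons.prems], of u] by simp
  qed
  ultimately show ?thesis unfolding alt_def by blast
qed

lemma wedge_nonzero: "wedge w a xs \<noteq> 0 \<Longrightarrow> \<exists>zs. a zs \<noteq> 0 \<and> set xs = insert w (set zs) \<and> length xs = Suc (length zs)"
proof (induction xs arbitrary: a)
  case (Cons y ys)
  show ?case
  proof (cases "y = w \<and> a ys \<noteq> 0")
    case False
    then have "wedge w (\<lambda>zs. a (y # zs)) ys \<noteq> 0" using Cons.prems by (auto split: if_splits)
    then obtain zs where "a (y # zs) \<noteq> 0" "set ys = insert w (set zs)" "length ys = Suc (length zs)"
      using Cons.IH[of "\<lambda>zs. a (y # zs)"] by blast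
    then show ?thesis by (intro exI[of _ "y # zs"]) auto
  qed (auto intro!: exI[of _ ys])
qed simp

text \<open>The Leibniz rule \<partial>(w \<and> a) = a - w \<and> \<partial>a. It uses the plain
  sum because \<open>boundary\<close> is cut to zero at the empty list, while the link part of a
  0-cycle at a vertex is supported there.\<close>

lemma sum_Cons_wedge:
  assumes "finite V" "w \<in> V"
  shows "(\<Sum>v\<in>V. wedge w a (v # ys)) = a ys - wedge w (\<lambda>zs. \<Sum>v\<in>V. a (v # zs)) ys"
  using assms by (simp add: sum_subtractf wedge_sum)

text \<open>Moving the vertex \<open>v\<close> of a cycle to \<open>w\<close>: the two cycles differ by the boundary of
  \<open>w \<and> v \<and> a\<close>, where \<open>a\<close> is the link part of the cycle at \<open>v\<close>.\<close>

lemma replace_vertex: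
  assumes K: "simplicial_complex K" and c: "c \<in> cycles K k" and wv: "w \<noteq> v"
    and cone: "\<And>\<tau>. \<tau> \<in> K \<Longrightarrow> v \<in> \<tau> \<Longrightarrow> insert w \<tau> \<in> K"
  shows "\<exists>c'\<in>cycles K k. c - c' \<in> boundaries K k \<and> verts c' \<subseteq> insert w (verts c - {v})"
proof (cases "v \<in> verts c")
  case False
  have "c - c \<in> boundaries K k" using ch.subspace_0[OF subspace_boundaries] by simp
  then show ?thesis using c False by (intro bexI[of _ c]) auto
next
  case True
  have cc: "c \<in> chains K k" using c unfolding cycles_def by blast
  have alt: "alt c" using cc unfolding chains_iff by blast
  \<comment> \<open>The part of \<open>c\<close> that contains \<open>v\<close> is the exterior
    product of \<open>v\<close> with \<open>a\<close>.\<close>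
  define a where "a ys = c (v # ys)" for ys
  have alta: "alt a" unfolding a_def using alt_Cons[OF alt] .
  define h where "h = wedge w (wedge v a)"
  define V where "V = insert w (verts c)"
  have finV: "finite V" unfolding V_def using finite_verts[OF cc] by blast
  have vV: "v \<in> V" "w \<in> V" and cV: "verts c \<subseteq> V" unfolding V_def using True by auto
  have h_supp: "\<exists>zs. c (v # zs) \<noteq> 0 \<and> set xs = insert w (set (v # zs)) \<and> length xs = Suc (length (v # zs))"
    if "h xs \<noteq> 0" for xs
  proof -
    obtain ys where ys: "wedge v a ys \<noteq> 0" "set xs = insert w (set ys)" "length xs = Suc (length ys)"
      using wedge_nonzero[of w "wedge v a" xs] \<open>h xs \<noteq> 0\<close> unfolding h_def by blast
    then obtain zs where "a zs \<noteq> 0" "set ys = insert v (set zs)" "length ys = Suc (length zs)"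
      using wedge_nonzero[of v a ys] by blast
    then show ?thesis using ys unfolding a_def by auto
  qed
  have vertsh: "verts h \<subseteq> V"
    unfolding verts_def V_def using h_supp vertsI[of c] by fastforce
  have h: "h \<in> chains K (Suc k)"
    unfolding chains_iff
  proof (intro conjI allI impI)
    show "alt h" unfolding h_def by (intro alt_wedge alta)
    have len: "length xs = Suc (Suc k) \<and> set xs \<in> K" if xs: "h xs \<noteq> 0" for xs
    proof -
      obtain zs where zs: "c (v # zs) \<noteq> 0" "set xs = insert w (set (v # zs))" "length xs = Suc (length (v # zs))"
        using h_supp[OF xs] by blast
      then have "length (v # zs) = Suc k" "set (v # zs) \<in> K" using cc unfolding chains_iff by blast+
      then show ?thesis using zs cone[of "set (v # zs)"] by simp
    qed
    then show "length xs = Suc (Suc k)" "set xs \<in> K" if "h xs \<noteq> 0" for xs using that by blast+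
    have "{xs. h xs \<noteq> 0} \<subseteq> {xs. set xs \<subseteq> V \<and> length xs = Suc (Suc k)}"
      using len vertsh vertsI[of h] by blast
    then show "finite {xs. h xs \<noteq> 0}" using finite_lists_length_eq[OF finV] finite_subset by blast
  qed
  \<comment> \<open>The link part of a cycle is a cycle: up to sign, its boundary at
    \<open>zs\<close> is that of \<open>c\<close> at \<open>v # zs\<close>.\<close>
  have "(\<Sum>u\<in>V. a (u # zs)) = 0" for zs
  proof -
    have "(\<Sum>u\<in>V. a (u # zs)) = - (\<Sum>u\<in>V. c (u # v # zs))"
      unfolding a_def sum_negf[symmetric] using alt_swap0[OF alt, of v] by simp
    also have "(\<Sum>u\<in>V. c (u # v # zs)) = boundary c (v # zs)"
      using boundary_eq[OF finV cV, of "v # zs"] by simp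
    also have "\<dots> = 0" using c unfolding cycles_def by simp
    finally show ?thesis by simp
  qed
  then have "(\<Sum>u\<in>V. wedge v a (u # ys)) = a ys" for ys
    using sum_Cons_wedge[OF finV vV(1), of a ys] by (simp add: wedge_zero)
  then have "(\<Sum>u\<in>V. h (u # ys)) = wedge v a ys - wedge w a ys" for ys
    unfolding h_def using sum_Cons_wedge[OF finV vV(2), of "wedge v a" ys] by simp
  then have bh: "boundary h ys = wedge v a ys - wedge w a ys" for ys
    using boundary_eq[OF finV vertsh, of ys] by (cases ys) auto
  \<comment> \<open>In effect the part \<open>wedge v a\<close> of \<open>c\<close> is replaced by
    \<open>wedge w a\<close>.\<close>
  define c' where "c' = c - boundary h"
  have bhK: "boundary h \<in> chains K k" by (rule boundary_chain[OF K h])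
  have bh_cyc: "boundary h \<in> cycles K k" unfolding cycles_def using bhK boundary_boundary[OF h] by blast
  have c'_cyc: "c' \<in> cycles K k" unfolding c'_def by (rule ch.subspace_diff[OF subspace_cycles c bh_cyc])
  have "c - c' \<in> boundaries K k" unfolding c'_def boundaries_def using h by simp
  moreover have "verts c' \<subseteq> insert w (verts c - {v})"
  proof -
    have altc': "alt c'" using c'_cyc unfolding cycles_def chains_iff by blast
    have "(\<lambda>zs. a (v # zs)) = (\<lambda>zs. 0)" unfolding a_def using alt_same0[OF alt] by (intro ext)
    then have c'v: "c' (v # ys) = 0" for ys
      using wv unfolding c'_def by (simp add: bh wedge_zero) (simp add: a_def)
    have "v \<notin> set xs \<and> set xs \<subseteq> V" if "c' xs \<noteq> 0" for xs
    proof
      show "v \<notin> set xs"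
      proof
        assume "v \<in> set xs"
        then obtain us vs where "xs = us @ v # vs" by (meson split_list)
        then show False using alt_front[OF altc' c'v] \<open>c' xs \<noteq> 0\<close> by simp
      qed
      show "set xs \<subseteq> V"
      proof (cases "c xs = 0")
        case True
        then have "boundary h xs \<noteq> 0" using that unfolding c'_def by simp
        then obtain u where "h (u # xs) \<noteq> 0" using boundary_nonzero by blast
        then show ?thesis using vertsI[of h "u # xs"] vertsh by auto
      qed (use vertsI[of c xs] V_def in auto)
    qed
    then show ?thesis unfolding verts_def[of c'] using V_def wv by blast
  qed
  ultimately show ?thesis using c'_cyc by blast
qed

text \<open>Each move lowers the number of vertices outside \<open>N\<close>. The hypothesis
  concerns all simplices of \<open>K\<close>, since the cycle that is moved changes every
  time.\<close>

lemma push_to_net: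
  assumes K: "simplicial_complex K"
    and f: "\<And>\<tau> v. \<tau> \<in> K \<Longrightarrow> v \<in> \<tau> \<Longrightarrow> v \<notin> N \<Longrightarrow> f v \<in> N \<and> insert (f v) \<tau> \<in> K"
  shows "c \<in> cycles K k \<Longrightarrow> \<exists>c'\<in>cycles K k. c - c' \<in> boundaries K k \<and> verts c' \<subseteq> N"
proof (induction "card (verts c - N)" arbitrary: c rule: less_induct)
  case less
  have cc: "c \<in> chains K k" using less.prems unfolding cycles_def by blast
  have fin: "finite (verts c)" by (rule finite_verts[OF cc])
  show ?case
  proof (cases "verts c \<subseteq> N")
    case True
    have "c - c \<in> boundaries K k" using ch.subspace_0[OF subspace_boundaries] by simp
    then show ?thesis using less.prems True by blast
  next
    case False
    then obtain v where v: "v \<in> verts c" "v \<notin> N" by blast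
    then obtain xs where "c xs \<noteq> 0" "v \<in> set xs" unfolding verts_def by blast
    then have fv: "f v \<in> N" using f[of "set xs" v] v cc unfolding chains_iff by blast
    have fvv: "f v \<noteq> v" using fv v by metis
    moreover have "insert (f v) \<tau> \<in> K" if "\<tau> \<in> K" "v \<in> \<tau>" for \<tau> using f[OF that v(2)] by blast
    ultimately have "\<exists>c1\<in>cycles K k. c - c1 \<in> boundaries K k \<and> verts c1 \<subseteq> insert (f v) (verts c - {v})"
      by (rule replace_vertex[OF K less.prems])
    then obtain c1 where c1: "c1 \<in> cycles K k" "c - c1 \<in> boundaries K k" "verts c1 \<subseteq> insert (f v) (verts c - {v})"
      by (elim bexE conjE)
    define w where "w = f v"
    have w: "w \<in> N" "w \<noteq> v" "verts c1 \<subseteq> insert w (verts c - {v})"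
      using fv fvv c1(3) unfolding w_def by auto
    have "verts c1 - N \<subset> verts c - N" using w v by blast
    then have "card (verts c1 - N) < card (verts c - N)" using fin by (intro psubset_card_mono) auto
    then obtain c' where c': "c' \<in> cycles K k" "c1 - c' \<in> boundaries K k" "verts c' \<subseteq> N"
      using less.hyps[OF _ c1(1)] by blast
    have "(c - c1) + (c1 - c') \<in> boundaries K k"
      by (rule ch.subspace_add[OF subspace_boundaries c1(2) c'(2)])
    then show ?thesis using c' by (intro bexI[of _ c']) auto
  qed
qed

section \<open>The Vietoris-Rips filtration\<close>

context Metric_space
begin

lemma VR_iff: "S \<in> VR r \<longleftrightarrow> S \<noteq> {} \<and> finite S \<and> S \<subseteq> M \<and> (\<forall>x\<in>S. \<forall>y\<in>S. d x y < r)"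
proof -
  have "mdiameter S < r \<longleftrightarrow> (\<forall>x\<in>S. \<forall>y\<in>S. d x y < r)" if "S \<noteq> {}" "finite S"
  proof -
    have "mdiameter S = Max ((\<lambda>(x, y). d x y) ` (S \<times> S))"
      unfolding mdiameter_def using that by (simp add: cSup_eq_Max)
    then show ?thesis using that by (subst \<open>mdiameter S = _\<close>, subst Max_less_iff) auto
  qed
  then show ?thesis unfolding VR_def by blast
qed

lemma simplicial_complex_VR: "simplicial_complex (VR r)"
  unfolding simplicial_complex_def
proof (intro ballI allI impI)
  fix \<sigma> \<tau> assume "\<sigma> \<in> VR r" "\<tau> \<subseteq> \<sigma>" "\<tau> \<noteq> {}"
  then show "\<tau> \<in> VR r" unfolding VR_iff using finite_subset by blast
qed

lemma VR_mono: "r \<le> s \<Longrightarrow> VR r \<subseteq> VR s"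
  unfolding VR_def by auto

text \<open>Each simplex has diameter strictly below \<open>r\<close>, and finitely many of them
  leave room for a common smaller bound. This is the source of left continuity.\<close>

lemma VR_left: "finite A \<Longrightarrow> A \<subseteq> VR r \<Longrightarrow> \<exists>s<r. A \<subseteq> VR s"
proof (induction A rule: finite_induct)
  case empty
  then show ?case using lt_ex[of r] by auto
next
  case (insert S A)
  then obtain s where s: "s < r" "A \<subseteq> VR s" by auto
  have "mdiameter S < r" using insert.prems unfolding VR_def by auto
  then obtain s' where s': "mdiameter S < s'" "s' < r" using dense by blast
  then have "S \<in> VR s'" using insert.prems unfolding VR_def by auto
  then have "insert S A \<subseteq> VR (max s s')" using s VR_mono[of s "max s s'"] VR_mono[of s' "max s s'"] by auto
  then show ?case using s s' by (intro exI[of _ "max s s'"]) auto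
qed

lemma VR_nonpos: "r \<le> 0 \<Longrightarrow> VR r = {}"
proof (intro equals0I)
  fix S assume "r \<le> 0" "S \<in> VR r"
  then obtain x where "d x x < r" unfolding VR_iff by blast
  then show False using nonneg[of x x] \<open>r \<le> 0\<close> by linarith
qed

lemma chains_VR_left:
  assumes "c \<in> chains (VR r) k"
  shows "\<exists>s<r. c \<in> chains (VR s) k"
proof -
  have "finite (set ` {xs. c xs \<noteq> 0})" "set ` {xs. c xs \<noteq> 0} \<subseteq> VR r"
    using assms unfolding chains_iff by auto
  then obtain s where "s < r" "set ` {xs. c xs \<noteq> 0} \<subseteq> VR s" using VR_left by blast
  then show ?thesis using assms unfolding chains_iff by (intro exI[of _ s]) auto
qed

text \<open>The moves take place in an intermediate complex \<open>K\<close>. A simplex of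
  \<open>VR s\<close> may already be too large to admit the net point of one of its vertices,
  whereas a simplex of \<open>K\<close> stays inside a simplex of \<open>VR r\<close> together with
  its net points, however many vertices have been moved.\<close>

lemma VR_tame:
  assumes tb: "mtotally_bounded M" and rs: "r < s"
  shows "\<exists>F. finite F \<and> (\<forall>z\<in>(cycles (VR r) k :: ('a list \<Rightarrow> 'f::field) set).
    \<exists>f\<in>ch.span F. z - f \<in> boundaries (VR s) k)"
proof -
  \<comment> \<open>Two points within \<open>e\<close> of a simplex of \<open>VR r\<close> have
    distance less than \<open>e + r + e\<close>.\<close>
  define e where "e = (s - r) / 2"
  have e: "e > 0" "r + e + e = s" unfolding e_def using rs by (auto simp: field_simps)
  obtain N where N: "finite N" "N \<subseteq> M" "M \<subseteq> (\<Union>x\<in>N. mball x e)"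
    using tb e(1) unfolding mtotally_bounded_def by meson
  have "\<exists>w. v \<in> M \<longrightarrow> w \<in> N \<and> d v w < e" for v
  proof (cases "v \<in> M")
    case True
    then obtain w where "w \<in> N" "v \<in> mball w e" using N(3) by blast
    then show ?thesis using commute[of v w] by auto
  qed auto
  then obtain f where f: "\<And>v. v \<in> M \<Longrightarrow> f v \<in> N \<and> d v (f v) < e" by metis
  define K where "K = {\<tau>. \<tau> \<noteq> {} \<and> (\<exists>\<sigma>\<in>VR r. \<tau> \<subseteq> \<sigma> \<union> f ` \<sigma>)}"
  have K: "simplicial_complex K" unfolding simplicial_complex_def K_def by blast
  have "\<sigma> \<in> K" if "\<sigma> \<in> VR r" for \<sigma>
    using that VR_iff[of \<sigma> r] unfolding K_def by blast
  then have rK: "VR r \<subseteq> K" by blast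
  have Ks: "K \<subseteq> VR s"
  proof
    fix \<tau> assume "\<tau> \<in> K"
    then obtain \<sigma> where \<sigma>: "\<sigma> \<in> VR r" "\<tau> \<subseteq> \<sigma> \<union> f ` \<sigma>" "\<tau> \<noteq> {}" unfolding K_def by blast
    then have \<sigma>': "finite \<sigma>" "\<sigma> \<subseteq> M" "\<And>x y. x \<in> \<sigma> \<Longrightarrow> y \<in> \<sigma> \<Longrightarrow> d x y < r" unfolding VR_iff by auto
    have near: "\<exists>x'\<in>\<sigma>. d x x' < e \<and> x \<in> M" if x: "x \<in> \<tau>" for x
    proof (cases "x \<in> \<sigma>")
      case True
      then show ?thesis using e \<sigma>'(2) mdist_zero[of x] by (intro bexI[of _ x]) auto
    next
      case False
      then obtain x' where "x' \<in> \<sigma>" "x = f x'" using \<sigma>(2) x by blast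
      then show ?thesis using f[of x'] \<sigma>'(2) N(2) commute[of x x'] by (intro bexI[of _ x']) auto
    qed
    have "d x y < s" if xy: "x \<in> \<tau>" "y \<in> \<tau>" for x y
    proof -
      obtain x' y' where *: "x' \<in> \<sigma>" "d x x' < e" "x \<in> M" "y' \<in> \<sigma>" "d y y' < e" "y \<in> M"
        using near xy by meson
      then have M: "x' \<in> M" "y' \<in> M" using \<sigma>'(2) by auto
      have "d x y \<le> d x x' + d x' y" "d x' y \<le> d x' y' + d y' y"
        using triangle M * by auto
      moreover have "d x' y' < r" using \<sigma>'(3) * by blast
      ultimately show ?thesis using * e commute[of y y'] by linarith
    qed
    moreover have "\<tau> \<subseteq> M" using near by blast
    moreover have "finite \<tau>" using \<sigma>(2) \<sigma>'(1) by (meson finite_Un finite_imageI finite_subset)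
    ultimately show "\<tau> \<in> VR s" unfolding VR_iff using \<sigma>(3) by blast
  qed
  have cone: "f v \<in> N \<and> insert (f v) \<tau> \<in> K" if \<tau>: "\<tau> \<in> K" "v \<in> \<tau>" "v \<notin> N" for \<tau> v
  proof -
    obtain \<sigma> where \<sigma>: "\<sigma> \<in> VR r" "\<tau> \<subseteq> \<sigma> \<union> f ` \<sigma>" using \<tau>(1) unfolding K_def by blast
    have "\<sigma> \<subseteq> M" using \<sigma> unfolding VR_iff by blast
    \<comment> \<open>Since moved vertices lie in the net, a vertex outside it is an original vertex
      of \<open>\<sigma>\<close>, and its net point is among those allowed with
      \<open>\<sigma>\<close>.\<close>
    then have "f ` \<sigma> \<subseteq> N" using f by blast
    then have "v \<in> \<sigma>" using \<sigma> \<tau> by blast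
    then show ?thesis using \<open>f ` \<sigma> \<subseteq> N\<close> \<sigma> unfolding K_def by blast
  qed
  define \<Lambda> where "\<Lambda> = {xs. set xs \<subseteq> N \<and> length xs = Suc k}"
  have fin\<Lambda>: "finite \<Lambda>" unfolding \<Lambda>_def by (rule finite_lists_length_eq[OF N(1)])
  \<comment> \<open>Indicator functions of single lists, not chains: \<open>F\<close> only has to
    span the pushed cycles, and there are finitely many lists of net points.\<close>
  define \<delta> :: "'a list \<Rightarrow> 'a list \<Rightarrow> 'f" where "\<delta> xs = (\<lambda>ys. if ys = xs then 1 else 0)" for xs
  have "\<exists>f\<in>ch.span (\<delta> ` \<Lambda>). z - f \<in> boundaries (VR s) k" if z: "z \<in> cycles (VR r) k" for z :: "'a list \<Rightarrow> 'f"
  proof -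
    have "z \<in> cycles K k" using z chains_mono[OF rK] unfolding cycles_def by blast
    then obtain c' where c': "c' \<in> cycles K k" "z - c' \<in> boundaries K k" "verts c' \<subseteq> N"
      using push_to_net[of K N f z k, OF K cone] by blast
    have supp: "xs \<in> \<Lambda>" if "c' xs \<noteq> 0" for xs
      unfolding \<Lambda>_def using that c'(1,3) vertsI[of c' xs] unfolding cycles_def chains_iff by blast
    have "c' = (\<Sum>xs\<in>\<Lambda>. (\<lambda>ys. c' xs * \<delta> xs ys))"
    proof
      fix ys
      have "(\<Sum>xs\<in>\<Lambda>. c' xs * \<delta> xs ys) = (\<Sum>xs\<in>\<Lambda>. if ys = xs then c' xs else 0)"
        unfolding \<delta>_def by (intro sum.cong) auto
      also have "\<dots> = c' ys" using fin\<Lambda> supp[of ys] by (auto simp: sum.delta)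
      finally show "c' ys = (\<Sum>xs\<in>\<Lambda>. (\<lambda>ys. c' xs * \<delta> xs ys)) ys" unfolding sum_fun_apply by simp
    qed
    moreover have "(\<Sum>xs\<in>\<Lambda>. (\<lambda>ys. c' xs * \<delta> xs ys)) \<in> ch.span (\<delta> ` \<Lambda>)"
      by (intro ch.span_sum ch.span_scale ch.span_base) auto
    ultimately have "c' \<in> ch.span (\<delta> ` \<Lambda>)" by simp
    moreover have "z - c' \<in> boundaries (VR s) k"
      using c'(2) chains_mono[OF Ks] unfolding boundaries_def by blast
    ultimately show ?thesis by blast
  qed
  then show ?thesis using fin\<Lambda> by (intro exI[of _ "\<delta> ` \<Lambda>"]) blast
qed

lemma filtered_quotient_VR:
  assumes "mtotally_bounded M"
  shows "filtered_quotient (\<lambda>a (c :: 'a list \<Rightarrow> 'f::field) xs. a * c xs)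
    (\<lambda>r. cycles (VR r) k) (\<lambda>r. boundaries (VR r) k)"
proof (unfold_locales)
  show "boundaries (VR t) k \<subseteq> (cycles (VR t) k :: ('a list \<Rightarrow> 'f) set)" for t
    unfolding boundaries_def cycles_def using boundary_chain[OF simplicial_complex_VR] boundary_boundary by blast
  show "cycles (VR s) k \<subseteq> (cycles (VR t) k :: ('a list \<Rightarrow> 'f) set)" if "s \<le> t" for s t
    using chains_mono[OF VR_mono[OF that]] unfolding cycles_def by blast
  show "boundaries (VR s) k \<subseteq> (boundaries (VR t) k :: ('a list \<Rightarrow> 'f) set)" if "s \<le> t" for s t
    using chains_mono[OF VR_mono[OF that]] unfolding boundaries_def by blast
  show "\<exists>s<t. x \<in> cycles (VR s) k" if "x \<in> cycles (VR t) k" for x :: "'a list \<Rightarrow> 'f" and t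
    using chains_VR_left[of x t k] that unfolding cycles_def by blast
  show "\<exists>s<t. x \<in> boundaries (VR s) k" if x: "x \<in> boundaries (VR t) k" for x :: "'a list \<Rightarrow> 'f" and t
  proof -
    obtain e where "e \<in> chains (VR t) (Suc k)" "x = boundary e" using x unfolding boundaries_def by blast
    then show ?thesis using chains_VR_left[of e t "Suc k"] unfolding boundaries_def by blast
  qed
  show "cycles (VR t) k \<subseteq> ({0} :: ('a list \<Rightarrow> 'f) set)" if "t \<le> 0" for t
    unfolding cycles_def chains_iff VR_nonpos[OF that] by (auto simp: fun_eq_iff)
qed (intro subspace_cycles subspace_boundaries VR_tame[OF assms]; assumption)+

end

theorem theorem1:
  fixes M :: "'a set" and d :: "'a \<Rightarrow> 'a \<Rightarrow> real" and k :: nat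
  assumes "Metric_space M d"
    and "Metric_space.mtotally_bounded M d M"
  shows "let PH = (Metric_space.VR_PH M d k :: ('f::field, ('a list \<Rightarrow> 'f) set) pmodule) in
         (\<exists>(L :: ('a, 'f) bar_index set) J. persistence_barcode {0<..} PH L J) \<and>
         (\<forall>(L :: 'i set) J (L' :: 'j set) J'.
            persistence_barcode {0<..} PH L J \<longrightarrow> persistence_barcode {0<..} PH L' J' \<longrightarrow>
            (\<exists>\<sigma>. bij_betw \<sigma> L L' \<and> (\<forall>i\<in>L. J' (\<sigma> i) = J i)))"
proof -
  interpret Metric_space M d by fact
  interpret filtered_chains "\<lambda>r. cycles (VR r) k :: ('a list \<Rightarrow> 'f) set" "\<lambda>r. boundaries (VR r) k"
    by (intro filtered_chains.intro filtered_quotient_VR assms(2))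
  \<comment> \<open>\<open>quot\<close> has the same form as the homology module, structure maps
    included, so the two agree by unfolding.\<close>
  have PH: "(VR_PH k :: ('f, ('a list \<Rightarrow> 'f) set) pmodule) = quot"
    unfolding VR_PH_def quot_def homology_def homology_incl_def ..
  show ?thesis
    unfolding Let_def PH
    by (intro conjI allI impI barcode_exists barcode_unique; assumption)
qed

end
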